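(* Let $q=p^h$ with $p$ prime. (1) Suppose $p$ is odd and $q\ge 5$. Then the linear Singer groups of $\mathcal{P}(q)$ are exactly the groups $\eta_\ell(U)$, where $\ell$ ranges over the points of the line at infinity of $\Pi(x)$ and $U$ ranges over $\mathbf{B}(\ell)$. In particular, if $\gcd(p,h)=1$, then the Singer groups of $\mathcal{P}(q)$ are exactly the groups $\eta_\ell(U)$ of this form. (2) Suppose $q$ is even and $q\ge 8$. Then the linear Singer groups $K$ of $\mathcal{P}(q)$ for which $\mathbb{S}\le\overline{K}$ are exactly the groups $\eta_\ell(U)$, where $\ell$ ranges over the points at infinity of $\Pi(x)$ and $U\in\mathbf{B}(\ell)$.
   Context: $\mathbf{W}(q)$ is the symplectic generalized quadrangle of order $q$ (points of $\mathbf{PG}(3,q)$ and totally isotropic lines of a nondegenerate symplectic polarity), $x$ is a fixed point of it, and $\mathbb{S}$ is the group (of order $q$) of all symmetries with center $x$, i.e. automorphisms of $\mathbf{W}(q)$ fixing every point of $x^\perp$. $\mathcal{P}(q)$ is the Payne-derived quadrangle: its points are the points of $\mathbf{W}(q)$ not collinear with $x$; its lines are the lines of $\mathbf{W}(q)$ not through $x$ together with the sets $\{x,r\}^{\perp\perp}\setminus\{x\}$, $r\not\sim x$. A Singer group of $\mathcal{P}(q)$ is a subgroup of its automorphism group acting sharply transitively on its points. For $q\ge5$ every automorphism of $\mathcal{P}(q)$ is induced by a unique element of $\mathrm{Aut}(\mathbf{W}(q))_x$; for a Singer group $K$, $\overline{K}\le\mathrm{Aut}(\mathbf{W}(q))_x$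 is the group inducing it, and $K$ is linear if $\overline{K}\le\mathbf{PGSp}_4(q)_x$. $\Pi(x)$ is the (Desarguesian) affine plane of order $q$ with points the sets $\{x,z\}^\perp$, $z\not\sim x$, and lines the elements of $x^\perp\setminus\{x\}$; $\mathrm{Aut}(\Pi(x))\cong\mathrm{Aut}(\mathbf{W}(q))_x/\mathbb{S}$ via the natural action. For a subgroup $T\le\mathrm{Aut}(\Pi(x))$ acting sharply transitively on the points, $\chi(T)$ is the Singer group of $\mathcal{P}(q)$ induced by the full preimage of $T$ in $\mathrm{Aut}(\mathbf{W}(q))_x$. For a point $\ell$ on the line at infinity $[\infty]$ of $\Pi(x)$: $A$ is the translation group of $\Pi(x)$ (all elations of the projective completion with axis $[\infty]$), $B$ is the dual translation group with respect to $\ell$ (all elations of the projective completion with center $\ell$), and $H(\ell)=\langle A,B\rangle$, a group of order $q^3$ with center $Z(H(\ell))=A\cap B$ of order $q$. $\mathbf{B}(\ell)$ is the set of subgroups of order $q$ of $H(\ell)/Z(H(\ell))$ meeting $B/Z(H(\ell))$ trivially. For $U\in\mathbf{B}(\ell)$, $\eta_\ell(U)=\chi(T)$, where $T$ is the full preimage of $U$ in $H(\ell)$ (which is sharply transitive on the points of $\Pi(x)$). *)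

theory Defs
  imports
    "HOL-Analysis.Analysis"
    "HOL-Algebra.Bij"
    "HOL-Algebra.Coset"
    "HOL-Algebra.Generated_Groups"
    "HOL-Computational_Algebra.Primes"
begin

section \<open>Incidence structures and their automorphisms\<close>

record ('p, 'l) incidence_structure =
  Points :: "'p set"
  Lines :: "'l set"
  Inc :: "'p \<Rightarrow> 'l \<Rightarrow> bool"

text \<open>
  Automorphisms are represented by their action on points, as elements of \<^const>\<open>Bij\<close> (hence
  extensional). In all structures considered below a line is determined by the set of points
  incident with it, so the accompanying permutation of the lines is unique.
\<close>

definition automorphisms :: "('p, 'l, 'm) incidence_structure_scheme \<Rightarrow> ('p \<Rightarrow> 'p) set" where
  "automorphisms S = {f \<in> Bij (Points S). \<exists>g. bij_betw g (Lines S) (Lines S) \<and>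
     (\<forall>p\<in>Points S. \<forall>l\<in>Lines S. Inc S (f p) (g l) \<longleftrightarrow> Inc S p l)}"

definition aut_group :: "('p, 'l, 'm) incidence_structure_scheme \<Rightarrow> ('p \<Rightarrow> 'p) monoid" where
  "aut_group S = (BijGroup (Points S))\<lparr>carrier := automorphisms S\<rparr>"

definition point_stabilizer ::
  "('p, 'l, 'm) incidence_structure_scheme \<Rightarrow> 'p \<Rightarrow> ('p \<Rightarrow> 'p) set" where
  "point_stabilizer S x = {f \<in> automorphisms S. f x = x}"

definition sharply_transitive_on :: "('p \<Rightarrow> 'p) set \<Rightarrow> 'p set \<Rightarrow> bool" where
  "sharply_transitive_on K X \<longleftrightarrow> (\<forall>y\<in>X. \<forall>z\<in>X. \<exists>!k. k \<in> K \<and> k y = z)"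

definition singer_group ::
  "('p, 'l, 'm) incidence_structure_scheme \<Rightarrow> ('p \<Rightarrow> 'p) set \<Rightarrow> bool" where
  "singer_group S K \<longleftrightarrow> subgroup K (aut_group S) \<and> sharply_transitive_on K (Points S)"

definition collinear_in ::
  "('p, 'l, 'm) incidence_structure_scheme \<Rightarrow> 'p \<Rightarrow> 'p \<Rightarrow> bool" where
  "collinear_in S y z \<longleftrightarrow> (\<exists>l\<in>Lines S. Inc S y l \<and> Inc S z l)"

text \<open>In a generalized quadrangle a point is collinear with itself, so \<open>y \<in> perp S {y}\<close>.\<close>

definition perp :: "('p, 'l, 'm) incidence_structure_scheme \<Rightarrow> 'p set \<Rightarrow> 'p set" where
  "perp S X = {y \<in> Points S. \<forall>z\<in>X. collinear_in S y z}"


section \<open>The symplectic quadrangle\<close>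

definition symplectic_form :: "(('a::field) ^ 4 \<Rightarrow> 'a ^ 4 \<Rightarrow> 'a) \<Rightarrow> bool" where
  "symplectic_form \<beta> \<longleftrightarrow>
     (\<forall>u. Vector_Spaces.linear (*s) (*) (\<beta> u)) \<and>
     (\<forall>v. Vector_Spaces.linear (*s) (*) (\<lambda>u. \<beta> u v)) \<and>
     (\<forall>u. \<beta> u u = 0) \<and>
     (\<forall>u. (\<forall>v. \<beta> u v = 0) \<longrightarrow> u = 0)"

definition pg_points :: "(('a::field) ^ 4) set set" where
  "pg_points = {U. vec.subspace U \<and> vec.dim U = 1}"

text \<open>Lines are point sets: the points contained in a totally isotropic 2-dimensional subspace.\<close>

definition symplectic_quadrangle ::
  "(('a::field) ^ 4 \<Rightarrow> 'a ^ 4 \<Rightarrow> 'a) \<Rightarrow> (('a ^ 4) set, ('a ^ 4) set set) incidence_structure" where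
  "symplectic_quadrangle \<beta> =
     \<lparr>Points = pg_points,
      Lines = {{p \<in> pg_points. p \<subseteq> W} | W.
                 vec.subspace W \<and> vec.dim W = 2 \<and> (\<forall>u\<in>W. \<forall>v\<in>W. \<beta> u v = 0)},
      Inc = (\<in>)\<rparr>"

definition PGSp4 ::
  "(('a::field) ^ 4 \<Rightarrow> 'a ^ 4 \<Rightarrow> 'a) \<Rightarrow> (('a ^ 4) set \<Rightarrow> ('a ^ 4) set) set" where
  "PGSp4 \<beta> = {f \<in> Bij pg_points. \<exists>g c. Vector_Spaces.linear (*s) (*s) g \<and> bij g \<and> c \<noteq> 0 \<and>
     (\<forall>u v. \<beta> (g u) (g v) = c * \<beta> u v) \<and> (\<forall>p\<in>pg_points. f p = g ` p)}"


section \<open>The Payne-derived quadrangle\<close>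

text \<open>
  In this section \<open>S\<close> is a generalized quadrangle with lines given as point sets, and \<open>x\<close> a point.
  A line of \<open>S\<close> not through \<open>x\<close> is kept unchanged as a line; its unique point collinear with \<open>x\<close>
  is not a point of the derived structure.
\<close>

definition payne_derived ::
  "('p, 'p set) incidence_structure \<Rightarrow> 'p \<Rightarrow> ('p, 'p set) incidence_structure" where
  "payne_derived S x =
     \<lparr>Points = {y \<in> Points S. \<not> collinear_in S x y},
      Lines = {l \<in> Lines S. x \<notin> l} \<union>
              {perp S (perp S {x, r}) - {x} | r. r \<in> Points S \<and> \<not> collinear_in S x r},
      Inc = (\<in>)\<rparr>"

definition symmetries ::
  "('p, 'p set) incidence_structure \<Rightarrow> 'p \<Rightarrow> ('p \<Rightarrow> 'p) set" where
  "symmetries S x = {f \<in> automorphisms S. \<forall>y\<in>perp S {x}. f y = y}"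

definition induced_on_payne ::
  "('p, 'p set) incidence_structure \<Rightarrow> 'p \<Rightarrow> ('p \<Rightarrow> 'p) \<Rightarrow> ('p \<Rightarrow> 'p)" where
  "induced_on_payne S x f = restrict f (Points (payne_derived S x))"

text \<open>The group \<open>K\<close> overlined: the elements of \<open>Aut(S)\<^sub>x\<close> that induce an element of \<open>K\<close>.\<close>

definition overline_group ::
  "('p, 'p set) incidence_structure \<Rightarrow> 'p \<Rightarrow> ('p \<Rightarrow> 'p) set \<Rightarrow> ('p \<Rightarrow> 'p) set" where
  "overline_group S x K = {f \<in> point_stabilizer S x. induced_on_payne S x f \<in> K}"

text \<open>
  The first conjunct says that \<open>overline_group\<close> really induces \<open>K\<close>, i.e. that the overlined group
  is meaningful. It is automatic for \<open>q \<ge> 5\<close>, where every automorphism of the Payne-derived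
  quadrangle is induced by a unique element of the stabilizer of \<open>x\<close>.
\<close>

definition linear_singer_group ::
  "(('a::field) ^ 4 \<Rightarrow> 'a ^ 4 \<Rightarrow> 'a) \<Rightarrow> ('a ^ 4) set \<Rightarrow> (('a ^ 4) set \<Rightarrow> ('a ^ 4) set) set \<Rightarrow> bool"
  where
  "linear_singer_group \<beta> x K \<longleftrightarrow>
     singer_group (payne_derived (symplectic_quadrangle \<beta>) x) K \<and>
     induced_on_payne (symplectic_quadrangle \<beta>) x `
       overline_group (symplectic_quadrangle \<beta>) x K = K \<and>
     overline_group (symplectic_quadrangle \<beta>) x K \<subseteq> {f \<in> PGSp4 \<beta>. f x = x}"


section \<open>The affine plane at a point\<close>

definition plane_at ::
  "('p, 'p set) incidence_structure \<Rightarrow> 'p \<Rightarrow> ('p set, 'p) incidence_structure" where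
  "plane_at S x =
     \<lparr>Points = {perp S {x, z} | z. z \<in> Points S \<and> \<not> collinear_in S x z},
      Lines = perp S {x} - {x},
      Inc = (\<lambda>P y. y \<in> P)\<rparr>"

definition induced_on_plane ::
  "('p, 'p set) incidence_structure \<Rightarrow> 'p \<Rightarrow> ('p \<Rightarrow> 'p) \<Rightarrow> ('p set \<Rightarrow> 'p set)" where
  "induced_on_plane S x f = restrict (\<lambda>P. f ` P) (Points (plane_at S x))"

definition chi ::
  "('p, 'p set) incidence_structure \<Rightarrow> 'p \<Rightarrow> ('p set \<Rightarrow> 'p set) set \<Rightarrow> ('p \<Rightarrow> 'p) set" where
  "chi S x T =
     induced_on_payne S x ` {f \<in> point_stabilizer S x. induced_on_plane S x f \<in> T}"


section \<open>Elations of the projective completion of an affine plane\<close>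

definition parallel_class :: "('p, 'l) incidence_structure \<Rightarrow> 'l \<Rightarrow> 'l set" where
  "parallel_class E l =
     {m \<in> Lines E. m = l \<or> \<not> (\<exists>p\<in>Points E. Inc E p l \<and> Inc E p m)}"

definition points_at_infinity :: "('p, 'l) incidence_structure \<Rightarrow> 'l set set" where
  "points_at_infinity E = parallel_class E ` Lines E"

fun completion_inc :: "('p, 'l) incidence_structure \<Rightarrow> 'p + 'l set \<Rightarrow> 'l option \<Rightarrow> bool" where
  "completion_inc E (Inl p) (Some l) = Inc E p l"
| "completion_inc E (Inr c) (Some l) = (l \<in> c)"
| "completion_inc E (Inl p) None = False"
| "completion_inc E (Inr c) None = True"

text \<open>The line at infinity is \<^const>\<open>None\<close>; the points on it are the parallel classes.\<close>

definition completion ::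
  "('p, 'l) incidence_structure \<Rightarrow> ('p + 'l set, 'l option) incidence_structure" where
  "completion E =
     \<lparr>Points = Inl ` Points E \<union> Inr ` points_at_infinity E,
      Lines = insert None (Some ` Lines E),
      Inc = completion_inc E\<rparr>"

text \<open>The identity is an elation with respect to every incident center-axis pair.\<close>

definition elation ::
  "('p, 'l) incidence_structure \<Rightarrow> 'p \<Rightarrow> 'l \<Rightarrow> ('p \<Rightarrow> 'p) \<Rightarrow> bool" where
  "elation E c m f \<longleftrightarrow> f \<in> automorphisms E \<and> c \<in> Points E \<and> m \<in> Lines E \<and> Inc E c m \<and>
     (\<forall>p\<in>Points E. Inc E p m \<longrightarrow> f p = p) \<and>
     (\<forall>l\<in>Lines E. Inc E c l \<longrightarrow> (\<forall>p\<in>Points E. Inc E (f p) l \<longleftrightarrow> Inc E p l))"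

text \<open>
  Collineations of the completion that fix the line at infinity are identified with the
  automorphisms of the affine plane which they extend.
\<close>

definition extends_to_completion ::
  "('p, 'l) incidence_structure \<Rightarrow> ('p \<Rightarrow> 'p) \<Rightarrow> ('p + 'l set \<Rightarrow> 'p + 'l set) \<Rightarrow> bool" where
  "extends_to_completion E f g \<longleftrightarrow> (\<forall>p\<in>Points E. g (Inl p) = Inl (f p))"

definition translation_group :: "('p, 'l) incidence_structure \<Rightarrow> ('p \<Rightarrow> 'p) set" where
  "translation_group E = {f \<in> automorphisms E. \<exists>c g. elation (completion E) c None g \<and>
     extends_to_completion E f g}"

definition dual_translation_group ::
  "('p, 'l) incidence_structure \<Rightarrow> 'l set \<Rightarrow> ('p \<Rightarrow> 'p) set" where
  "dual_translation_group E c = {f \<in> automorphisms E. \<exists>m g. elation (completion E) (Inr c) m g \<and>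
     extends_to_completion E f g}"

definition H_group :: "('p, 'l) incidence_structure \<Rightarrow> 'l set \<Rightarrow> ('p \<Rightarrow> 'p) monoid" where
  "H_group E c =
     subgroup_generated (aut_group E) (translation_group E \<union> dual_translation_group E c)"

definition group_center :: "('g, 'm) monoid_scheme \<Rightarrow> 'g set" where
  "group_center G = {z \<in> carrier G. \<forall>h\<in>carrier G. z \<otimes>\<^bsub>G\<^esub> h = h \<otimes>\<^bsub>G\<^esub> z}"

text \<open>
  The set \<open>\<^bold>B(\<ell>)\<close>; the parameter \<open>q\<close> is the required order of the subgroups. The intersection
  is with the image of the dual translation group in the quotient.
\<close>

definition complement_subgroups ::
  "nat \<Rightarrow> ('p, 'l) incidence_structure \<Rightarrow> 'l set \<Rightarrow> ('p \<Rightarrow> 'p) set set set" where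
  "complement_subgroups q E c =
     (let H = H_group E c; Z = group_center H in
      {U. subgroup U (H Mod Z) \<and> card U = q \<and>
          U \<inter> (\<lambda>b. Z #>\<^bsub>H\<^esub> b) ` dual_translation_group E c = {\<one>\<^bsub>H Mod Z\<^esub>}})"

definition preimage_in_H ::
  "('p, 'l) incidence_structure \<Rightarrow> 'l set \<Rightarrow> ('p \<Rightarrow> 'p) set set \<Rightarrow> ('p \<Rightarrow> 'p) set" where
  "preimage_in_H E c U =
     {h \<in> carrier (H_group E c). group_center (H_group E c) #>\<^bsub>H_group E c\<^esub> h \<in> U}"

definition eta ::
  "('p, 'p set) incidence_structure \<Rightarrow> 'p \<Rightarrow> 'p set \<Rightarrow> ('p set \<Rightarrow> 'p set) set set \<Rightarrow> ('p \<Rightarrow> 'p) set"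
  where
  "eta S x c U = chi S x (preimage_in_H (plane_at S x) c U)"

end

theory Submission
  imports Defs "HOL-Computational_Algebra.Polynomial" "HOL-Number_Theory.Cong"
    "HOL-Algebra.Group_Action"
begin

text \<open>
  Choose a symplectic basis \<open>e\<^sub>0, \<dots>, e\<^sub>3\<close> with \<open>x = \<langle>e\<^sub>3\<rangle>\<close>. The points of the Payne-derived quadrangle
  are then the \<open>\<langle>e\<^sub>0 + a e\<^sub>1 + b e\<^sub>2 + c e\<^sub>3\<rangle>\<close>, and the linear collineations fixing \<open>x\<close> act on the
  triples \<open>(a, b, c)\<close> by affine maps whose action on \<open>(a, b)\<close> is the one induced on \<open>\<Pi>(x)\<close>. A linear
  Singer group is a \<open>p\<close>-group, so its linear parts on \<open>(a, b)\<close> fix a nonzero vector. Adapting the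
  basis to this vector makes all elements unipotent,
  \<open>(a, b, c) \<mapsto> (a + s, b + t a + u, c + (u - s t) a - s b + w)\<close>. By regularity \<open>t\<close> is a function of
  \<open>(s, u, w)\<close>, and its restriction to \<open>s = 0\<close> is additive; conjugation shows that it vanishes there
  (this uses \<open>q\<close> odd or \<open>S \<le> K\<close> to handle the center), so \<open>t\<close> is an additive function of \<open>s\<close>
  alone. The groups \<open>\<eta>(U)\<close> have exactly this form, \<open>U\<close> being the graph of the additive function.

  If \<open>q\<close> is odd, a combinatorial regularity property separates the lines \<open>{x, r}\<^sup>\<bottom>\<^sup>\<bottom>\<close> from the other
  lines of the Payne-derived quadrangle, so that every automorphism is a semilinear collineation. A
  field automorphism of \<open>p\<close>-power order is trivial when \<open>p\<close> does not divide \<open>h\<close>, hence for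
  \<open>gcd p h = 1\<close> every Singer group is linear.
\<close>

section \<open>Finite fields\<close>

text \<open>The frame changes in the middle of the argument. The fixed vector of a linear Singer
  group is known only after coordinates have been introduced, so it is restated without coordinates,
  as a vector \<open>v2\<close> orthogonal to the vector \<open>v3\<close> spanning
  \<open>x\<close>, and a second frame with third vector \<open>v2\<close> is built. In any frame
  the parallel class of the point spanned by \<open>e2\<close> is the vertical one, and every point
  at infinity arises in this way. Hence only one point at infinity is ever computed with, and its
  group \<open>H\<close> is the group of shears. The third coordinate is never free: the points of
  the derived quadrangle are connected through totally isotropic lines, so the action on
  \<open>(a, b)\<close> fixes that on \<open>c\<close> up to an additive constant, which is where
  the symmetries about \<open>x\<close> enter. The characteristic matters because commuting past an
  element with first parameter \<open>s\<close> moves \<open>w\<close> by \<open>2 * s * u\<close>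
  and by a square; for q even the doubled terms vanish. A Singer group is given only on the derived
  quadrangle, which does not contain \<open>x\<close>. Regularity recovers \<open>x\<close>: two
  fibres and their transversals form a grid of fibres, while an isotropic line admits no grid
  through suitable points off it.\<close>

lemma CHAR_eq_prime:
  assumes "prime p" and "CARD('a::{field,finite}) = p ^ h"
  shows "CHAR('a) = p"
proof -
  have "prime CHAR('a)"
    by (intro prime_CHAR_semidom finite_imp_CHAR_pos) simp
  moreover have "CHAR('a) dvd CARD('a)"
  proof -
    \<comment> \<open>Shifting every summand by 1 permutes the field, so q times 1 is 0.\<close>
    have "(\<Sum>y\<in>UNIV. y) = (\<Sum>y\<in>UNIV. y + (1::'a))"
      by (rule sum.reindex_bij_witness[of _ "\<lambda>y. y + 1" "\<lambda>y. y - 1"]) auto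
    then have "of_nat CARD('a) = (0::'a)"
      by (simp add: sum.distrib)
    then show ?thesis
      by (simp add: of_nat_eq_0_iff_char_dvd)
  qed
  ultimately show ?thesis
    using assms by (metis prime_dvd_power primes_dvd_imp_eq)
qed

lemma power_CARD_eq:
  fixes y :: "'a::{field,finite}"
  shows "y ^ CARD('a) = y"
proof (cases "y = 0")
  case False
  have card: "CARD('a) = Suc (card (UNIV - {0::'a}))"
    by (simp add: card_Diff_singleton_if)
  have "(\<Prod>z\<in>UNIV-{0}. y * z) = (\<Prod>z\<in>UNIV-{0}. z)"
    by (rule prod.reindex_bij_witness[of _ "\<lambda>z. z / y" "\<lambda>z. y * z"]) (use False in auto)
  then have "y ^ card (UNIV - {0::'a}) = 1"
    by (simp add: prod.distrib)
  then show ?thesis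
    unfolding card power_Suc by (simp only: mult_1_right)
qed simp

lemma power_CARD_power_eq:
  fixes y :: "'a::{field,finite}"
  shows "y ^ (CARD('a) ^ n) = y"
  by (induction n) (simp_all add: power_CARD_eq power_mult)

text \<open>The polynomial X^p - X has at most p roots, and the p elements of the prime field
  already are roots.\<close>

lemma power_prime_eq_self_imp_of_nat:
  fixes y :: "'a::{field,finite}"
  assumes p: "prime p" and c: "CHAR('a) = p" and y: "y ^ p = y"
  shows "\<exists>n. y = of_nat n"
proof -
  have p1: "p > 1" using p prime_gt_1_nat by blast
  define P :: "'a poly" where "P = monom 1 p - monom 1 1"
  have cP: "coeff P p = 1"
    using p1 by (simp add: P_def)
  then have P0: "P \<noteq> 0" by auto
  have deg: "degree P \<le> p"
    unfolding P_def by (rule degree_diff_le) (use p1 in \<open>auto simp: degree_monom_eq\<close>)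
  have roots: "{z. poly P z = 0} = {z. z ^ p = z}"
    by (auto simp: P_def poly_monom)
  have card: "card {z::'a. z ^ p = z} \<le> p"
    using card_poly_roots_bound[OF P0] deg roots by simp
  have fm: "(of_nat n :: 'a) ^ p = of_nat n" for n
  proof (induction n)
    case 0
    then show ?case using p1 by simp
  next
    case (Suc n)
    have "(1 + of_nat n :: 'a) ^ p = 1 ^ p + of_nat n ^ p"
      by (rule freshmans_dream) (use c p in auto)
    then show ?case using Suc by simp
  qed
  have inj: "inj_on (of_nat :: nat \<Rightarrow> 'a) {..<p}"
    by (rule inj_onI) (simp add: of_nat_eq_iff_cong_CHAR c cong_def)
  have "of_nat ` {..<p} = {z::'a. z ^ p = z}"
  proof (rule card_seteq)
    show "of_nat ` {..<p} \<subseteq> {z::'a. z ^ p = z}" using fm by auto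
    show "card {z::'a. z ^ p = z} \<le> card (of_nat ` {..<p} :: 'a set)"
      using card inj by (simp add: card_image)
  qed simp
  then show ?thesis using y by blast
qed

text \<open>In characteristic p the operator \<tau> = \<rho> - id satisfies (id + \<tau>)^p = id +
  \<tau>^p, so \<rho>^p = id makes \<tau> nilpotent. A moved element then yields, near the end of
  its \<tau>-chain, some \<open>d\<close> with \<open>\<rho> d = d + 1\<close>, as in Artin-Schreier
  theory; the trace of \<open>d\<close> excludes this when p does not divide h.\<close>

lemma field_hom_order_prime_trivial:
  fixes \<rho> :: "'a::{field,finite} \<Rightarrow> 'a"
  assumes p: "prime p" and card: "CARD('a) = p ^ h" and cop: "coprime p h"
    and add: "\<And>a b. \<rho> (a + b) = \<rho> a + \<rho> b" and mult: "\<And>a b. \<rho> (a * b) = \<rho> a * \<rho> b"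
    and one: "\<rho> 1 = 1" and ord: "(\<rho> ^^ p) = id"
  shows "\<rho> a = a"
proof (rule ccontr)
  assume a: "\<rho> a \<noteq> a"
  have c: "CHAR('a) = p" using CHAR_eq_prime[OF p card] .
  have zero: "\<rho> 0 = 0" using add[of 0 0] by (metis add.right_neutral add_left_cancel)
  have minus: "\<rho> (u - v) = \<rho> u - \<rho> v" for u v
    using add[of "u - v" v] by (simp add: algebra_simps)
  define \<tau> where "\<tau> u = \<rho> u - u" for u
  have \<tau>sum: "\<tau> (sum f A) = (\<Sum>i\<in>A. \<tau> (f i))" for f :: "nat \<Rightarrow> 'a" and A
  proof (induction A rule: infinite_finite_induct)
  qed (auto simp: \<tau>_def zero add)
  have \<rho>nat: "\<rho> (of_nat n) = of_nat n" for n
    by (induction n) (auto simp: zero one add)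
  have \<tau>nat: "\<tau> (of_nat n * u) = of_nat n * \<tau> u" for n u
    by (simp add: \<tau>_def mult \<rho>nat algebra_simps)
  \<comment> \<open>Binomial theorem for \<rho> = id + \<tau>; for m = p only the outer two terms
    survive.\<close>
  have bin: "(\<rho> ^^ m) a = (\<Sum>i\<le>m. of_nat (m choose i) * (\<tau> ^^ i) a)" for m
  proof (induction m)
    case (Suc m)
    have *: "(\<Sum>i\<le>m. of_nat (m choose i) * (\<tau> ^^ Suc i) a) =
        (\<Sum>i\<le>Suc m. of_nat (if i = 0 then 0 else m choose (i-1)) * (\<tau> ^^ i) a)"
      by (subst sum.atMost_Suc_shift) simp
    have **: "(\<Sum>i\<le>m. of_nat (m choose i) * (\<tau> ^^ i) a) =
        (\<Sum>i\<le>Suc m. of_nat (m choose i) * (\<tau> ^^ i) a)"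
      by (simp add: binomial_eq_0)
    have "(\<rho> ^^ Suc m) a = \<tau> ((\<rho> ^^ m) a) + (\<rho> ^^ m) a"
      by (simp add: \<tau>_def)
    also have "\<dots> = (\<Sum>i\<le>m. of_nat (m choose i) * (\<tau> ^^ Suc i) a) +
       (\<Sum>i\<le>m. of_nat (m choose i) * (\<tau> ^^ i) a)"
      unfolding Suc by (simp add: \<tau>sum \<tau>nat)
    also have "\<dots> = (\<Sum>i\<le>Suc m. of_nat (Suc m choose i) * (\<tau> ^^ i) a)"
      unfolding * ** sum.distrib[symmetric]
    proof (rule sum.cong)
      fix i assume "i \<in> {..Suc m}"
      then show "of_nat (if i = 0 then 0 else m choose (i - 1)) * (\<tau> ^^ i) a + of_nat (m choose i) * (\<tau> ^^ i) a
         = of_nat (Suc m choose i) * (\<tau> ^^ i) a"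
        by (cases i) (simp_all add: algebra_simps)
    qed simp
    finally show ?case .
  qed simp
  have p0: "p > 0" using p prime_gt_0_nat by blast
  have "a = (\<Sum>i\<le>p. of_nat (p choose i) * (\<tau> ^^ i) a)"
    using bin[of p] ord by simp
  also have "\<dots> = (\<Sum>i\<in>{0,p}. of_nat (p choose i) * (\<tau> ^^ i) a)"
  proof (rule sum.mono_neutral_right)
    show "\<forall>i\<in>{..p} - {0, p}. of_nat (p choose i) * (\<tau> ^^ i) a = 0"
    proof
      fix i assume i: "i \<in> {..p} - {0, p}"
      then have "p dvd (p choose i)"
        by (intro dvd_choose_prime) (use p in auto)
      then have "of_nat (p choose i) = (0::'a)"
        using c of_nat_eq_0_iff_char_dvd by metis
      then show "of_nat (p choose i) * (\<tau> ^^ i) a = 0" by simp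
    qed
  qed auto
  also have "\<dots> = a + (\<tau> ^^ p) a" using p0 by simp
  finally have nil: "(\<tau> ^^ p) a = 0" by simp
  \<comment> \<open>The length of the \<tau>-chain of \<open>a\<close>. It is at least 2, since
    neither \<open>a\<close> nor \<open>\<tau> a\<close> is 0.\<close>
  define k where "k = (LEAST k. (\<tau> ^^ k) a = 0)"
  have k: "(\<tau> ^^ k) a = 0" unfolding k_def using nil by (rule LeastI)
  have kmin: "(\<tau> ^^ j) a \<noteq> 0" if "j < k" for j
    using that not_less_Least unfolding k_def by blast
  have "k \<noteq> 0" using k a zero by (metis funpow_0)
  moreover have "k \<noteq> 1" using k a by (auto simp: \<tau>_def)
  ultimately obtain j where j: "k = Suc (Suc j)"
    by (metis One_nat_def not0_implies_Suc)
  \<comment> \<open>\<open>b\<close> and \<open>e\<close> are the last two nonzero members of the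
    chain. As \<rho> fixes \<open>e\<close> and adds \<open>e\<close> to \<open>b\<close>, it adds 1
    to the quotient \<open>d\<close>.\<close>
  define b where "b = (\<tau> ^^ j) a"
  define e where "e = \<tau> b"
  have e0: "e \<noteq> 0" using kmin[of "Suc j"] j by (simp add: e_def b_def)
  have \<tau>e: "\<tau> e = 0" using k j by (simp add: e_def b_def)
  define d where "d = b / e"
  have "\<rho> d * \<rho> e = \<rho> b"
    using mult[of d e] e0 by (simp add: d_def)
  moreover have "\<rho> e = e" using \<tau>e by (simp add: \<tau>_def)
  moreover have "\<rho> b = b + e" by (simp add: e_def \<tau>_def)
  ultimately have d: "\<rho> d = d + 1"
    using e0 by (simp add: d_def field_simps)
  text \<open>The trace of \<open>d\<close> lies in the prime field, so \<open>\<rho>\<close> fixes it; but \<open>\<rho> d = d + 1\<close> moves it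
    by \<open>h\<close>.\<close>
  define t where "t = (\<Sum>i<h. d ^ (p ^ i))"
  have pw: "\<rho> (u ^ n) = \<rho> u ^ n" for u n
    by (induction n) (auto simp: one mult)
  have \<rho>sum: "\<rho> (\<Sum>i<m. f i) = (\<Sum>i<m. \<rho> (f i))" for f :: "nat \<Rightarrow> 'a" and m
    by (induction m) (auto simp: zero add)
  have "\<rho> t = (\<Sum>i<h. d ^ (p ^ i) + 1)"
    unfolding t_def \<rho>sum pw d
    by (rule sum.cong) (use freshmans_dream'[where ?'a='a] p c in auto)
  then have t1: "\<rho> t = t + of_nat h"
    by (simp add: sum.distrib t_def)
  have "t ^ p = (\<Sum>i<h. d ^ (p ^ Suc i))"
    unfolding t_def by (subst freshmans_dream_sum) (use p c in \<open>auto simp: power_mult[symmetric] mult.commute\<close>)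
  also have "\<dots> = (\<Sum>i<Suc h. d ^ (p ^ i)) - d"
    by (subst sum.lessThan_Suc_shift) simp
  also have "\<dots> = t"
    using power_CARD_eq[of d] card by (simp add: t_def)
  finally obtain n where "t = of_nat n"
    using power_prime_eq_self_imp_of_nat[OF p c] by blast
  then have "of_nat h = (0::'a)" using t1 \<rho>nat by simp
  then have "p dvd h" using c of_nat_eq_0_iff_char_dvd by metis
  then show False using cop p
    by (metis coprime_absorb_left not_prime_unit)
qed

text \<open>The order is lowered by one factor p at a time: \<open>\<sigma> ^^ (p ^ n)\<close> is a
  homomorphism whose p-th iterate is the identity, hence is itself the identity.\<close>

lemma field_hom_order_prime_power_trivial:
  fixes \<sigma> :: "'a::{field,finite} \<Rightarrow> 'a"
  assumes p: "prime p" and card: "CARD('a) = p ^ h" and cop: "coprime p h"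
    and "\<And>a b. \<sigma> (a + b) = \<sigma> a + \<sigma> b" and "\<And>a b. \<sigma> (a * b) = \<sigma> a * \<sigma> b"
    and "\<sigma> 1 = 1" and "(\<sigma> ^^ (p ^ n)) = id"
  shows "\<sigma> a = a"
  using assms(4-)
proof (induction n arbitrary: a)
  case 0
  then show ?case by simp
next
  case (Suc n)
  define \<rho> where "\<rho> = \<sigma> ^^ (p ^ n)"
  have "(\<sigma> ^^ k) (a + b) = (\<sigma> ^^ k) a + (\<sigma> ^^ k) b" for a b k
    by (induction k) (auto simp: Suc.prems)
  moreover have "(\<sigma> ^^ k) (a * b) = (\<sigma> ^^ k) a * (\<sigma> ^^ k) b" for a b k
    by (induction k) (auto simp: Suc.prems)
  moreover have "(\<sigma> ^^ k) 1 = 1" for k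
    by (induction k) (auto simp: Suc.prems)
  moreover have "\<rho> ^^ p = id"
    using Suc.prems(4) unfolding \<rho>_def funpow_mult power_Suc by (metis mult.commute)
  ultimately have "\<rho> b = b" for b
    using field_hom_order_prime_trivial[OF p card cop, of \<rho>] unfolding \<rho>_def by blast
  then have "\<sigma> ^^ (p ^ n) = id" by (auto simp: \<rho>_def)
  then show ?case using Suc by blast
qed

section \<open>Regular groups of unipotent maps\<close>

text \<open>The parameters are chosen so that \<open>(s, u, w)\<close> is the image of the origin,
  while \<open>t\<close> is the only entry of the linear part on \<open>(a, b)\<close> that may
  vary. The coefficients of \<open>a\<close> and \<open>b\<close> in the third coordinate are forced
  by preservation of collinearity.\<close>

definition unipotent_map :: "'a::field \<Rightarrow> 'a \<Rightarrow> 'a \<Rightarrow> 'a \<Rightarrow> 'a \<times> 'a \<times> 'a \<Rightarrow> 'a \<times> 'a \<times> 'a" where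
  "unipotent_map s t u w = (\<lambda>(a, b, c). (a + s, b + t * a + u, c + (u - s * t) * a - s * b + w))"

lemma unipotent_map_simp [simp]:
  "unipotent_map s t u w (a, b, c) = (a + s, b + t * a + u, c + (u - s * t) * a - s * b + w)"
  by (simp add: unipotent_map_def)

lemma unipotent_map_comp:
  "unipotent_map s' t' u' w' \<circ> unipotent_map s t u w =
   unipotent_map (s + s') (t + t') (u + u' + t' * s) (w + w' + (u' - s' * t') * s - s' * u)"
  by (auto simp: fun_eq_iff algebra_simps)

lemma unipotent_map_inject [simp]:
  "unipotent_map s t u w = unipotent_map s' t' u' w' \<longleftrightarrow> s = s' \<and> t = t' \<and> u = u' \<and> w = w'"
proof
  assume eq: "unipotent_map s t u w = unipotent_map s' t' u' w'"
  show "s = s' \<and> t = t' \<and> u = u' \<and> w = w'"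
    using fun_cong[OF eq, of "(0, 0, 0)"] fun_cong[OF eq, of "(1, 0, 0)"] by auto
qed simp

text \<open>Evaluation at the origin makes \<open>t\<close> a function \<open>T\<close> of
  \<open>(s, u, w)\<close>. Its restriction \<open>T0\<close> to \<open>s = 0\<close> is additive
  and invariant under conjugation, and the two properties together leave only \<open>T0 = 0\<close>.
  Multiplying by elements with \<open>s = 0\<close> then shows that \<open>T\<close> depends on
  \<open>s\<close> alone.\<close>

lemma regular_unipotent_group:
  fixes K :: "('a::field \<times> 'a \<times> 'a \<Rightarrow> 'a \<times> 'a \<times> 'a) set"
  assumes shape: "\<And>k. k \<in> K \<Longrightarrow> \<exists>s t u w. k = unipotent_map s t u w"
    and closed: "\<And>k k'. k \<in> K \<Longrightarrow> k' \<in> K \<Longrightarrow> k \<circ> k' \<in> K"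
    and trans: "\<And>y z. \<exists>!k. k \<in> K \<and> k y = z"
    and odd: "(2::'a) \<noteq> 0 \<or> (\<forall>w. unipotent_map 0 0 0 w \<in> K)"
  shows "\<exists>\<tau>. (\<forall>s s'. \<tau> (s + s') = \<tau> s + \<tau> s') \<and> K = {unipotent_map s (\<tau> s) u w | s u w. True}"
proof -
  have ex: "\<exists>t. unipotent_map s t u w \<in> K" for s u w
  proof -
    obtain k where k: "k \<in> K" "k (0, 0, 0) = (s, u, w)" using trans by metis
    obtain s' t u' w' where "k = unipotent_map s' t u' w'" using shape k by metis
    then show ?thesis using k by auto
  qed
  define T where "T s u w = (SOME t. unipotent_map s t u w \<in> K)" for s u w
  have T: "unipotent_map s (T s u w) u w \<in> K" for s u w
    unfolding T_def by (rule someI_ex[OF ex])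
  have uniq: "t = t'" if "unipotent_map s t u w \<in> K" "unipotent_map s t' u w \<in> K" for s t t' u w
  proof -
    have "unipotent_map s t u w (0, 0, 0) = unipotent_map s t' u w (0, 0, 0)" by simp
    then have "unipotent_map s t u w = unipotent_map s t' u w" using that trans by metis
    then show ?thesis by simp
  qed
  have Teq: "T s u w = t" if "unipotent_map s t u w \<in> K" for s t u w
    using uniq T that by blast
  have mult: "T (s + s') (u + u' + T s' u' w' * s) (w + w' + (u' - s' * T s' u' w') * s - s' * u) =
      T s u w + T s' u' w'" for s s' u u' w w'
    using closed[OF T T, of s' u' w' s u w] unfolding unipotent_map_comp by (rule Teq)
  define T0 where "T0 = T 0"
  have T0add: "T0 (u + u') (w + w') = T0 u w + T0 u' w'" for u u' w w'
    using mult[of 0 0 u u' w' w] by (simp add: T0_def)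
  have T00: "T0 0 0 = 0" using T0add[of 0 0 0 0] by (metis add.right_neutral add_left_cancel)
  have T0neg: "T0 (- u) (- w) = - T0 u w" for u w
    using T0add[of u "- u" w "- w"] T00 by (simp add: eq_neg_iff_add_eq_0 add.commute)
  text \<open>Invariance of \<open>T0\<close> under conjugation by an element with first parameter \<open>s\<close>.\<close>
  have conj: "T0 (u - T0 u w * s) (w - 2 * s * u + T0 u w * s\<^sup>2) = T0 u w" for u w s
  proof -
    let ?h = "unipotent_map 0 (T0 u w) u w" and ?k = "unipotent_map s (T s 0 0) 0 0"
    have h: "?h \<in> K" and k: "?k \<in> K" using T by (auto simp: T0_def)
    \<comment> \<open>\<open>h'\<close> is the conjugate of \<open>?h\<close> by \<open>?k\<close>.
      It is produced by transitivity instead of an inverse, and sharpness at the origin gives the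
      commutation relation.\<close>
    obtain h' where h': "h' \<in> K" "h' (?k (0, 0, 0)) = (?k \<circ> ?h) (0, 0, 0)" using trans by metis
    have "h' \<circ> ?k = ?k \<circ> ?h"
      using trans[of "(0,0,0)" "(?k \<circ> ?h) (0,0,0)"] closed h k h' by (metis comp_apply)
    moreover obtain s' t' u' w' where h'eq: "h' = unipotent_map s' t' u' w'"
      using shape h' by metis
    ultimately have e: "s' = 0" "t' = T0 u w" "u' + t' * s = u"
      "w' + u' * s = w - s * u"
      by (auto simp: unipotent_map_comp)
    have u': "u' = u - T0 u w * s" using e by (simp add: eq_diff_eq)
    have w': "w' = w - 2 * s * u + T0 u w * s\<^sup>2"
      using e(4) unfolding u' by (simp add: algebra_simps power2_eq_square)
    show ?thesis
      using h'(1) unfolding h'eq e(1) e(2) u' w' unfolding T0_def by (rule Teq)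
  qed
  have conj0: "T0 (- (T0 u w * s)) (- (2 * s * u) + T0 u w * s\<^sup>2) = 0" for u w s
    using T0add[of u "- (T0 u w * s)" w "- (2 * s * u) + T0 u w * s\<^sup>2"] conj[of u w s]
    by (simp add: algebra_simps)
  have center: "T0 0 w = 0" for w
  proof (cases "(2::'a) = 0")
    case True
    \<comment> \<open>In characteristic 2 the doubling used below gives nothing, so membership of
      all maps \<open>unipotent_map 0 0 0 w\<close> is taken from the hypothesis.\<close>
    then show ?thesis using odd Teq by (auto simp: T0_def)
  next
    case False
    show ?thesis
    proof (rule ccontr)
      assume t: "T0 0 w \<noteq> 0"
      define t where "t = T0 0 w"
      have t0: "t \<noteq> 0" using t by (simp add: t_def)
      \<comment> \<open>The relations for \<open>s\<close> and \<open>- s\<close> are added: their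
        first arguments cancel and the square terms double.\<close>
      have sq2: "T0 0 (2 * t * s\<^sup>2) = 0" for s
        using T0add[of "- (t * s)" "t * s" "t * s\<^sup>2" "t * s\<^sup>2"] conj0[of 0 w s] conj0[of 0 w "- s"]
        by (simp add: t_def mult.assoc)
      text \<open>Every element is a difference of two squares.\<close>
      have "2 * (2 * (2 * t)) \<noteq> 0" using False t0 by (metis mult_eq_0_iff)
      moreover define r where "r = w / (2 * (2 * (2 * t)))"
      ultimately have "w = 2 * t * (r + 1)\<^sup>2 + - (2 * t * (r - 1)\<^sup>2)"
        by (simp add: algebra_simps power2_eq_square)
      then have "T0 0 w = T0 (0 + - 0) (2 * t * (r + 1)\<^sup>2 + - (2 * t * (r - 1)\<^sup>2))"
        by simp
      also have "\<dots> = 0"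
        unfolding T0add T0neg sq2 by simp
      finally show False using t by simp
    qed
  qed
  have T0w: "T0 u w = T0 u w'" for u w w'
    using T0add[of u 0 w "w' - w"] center by simp
  \<comment> \<open>So \<open>T0\<close>, now a function of \<open>u\<close> only, vanishes on all
    multiples of its own values. A nonzero value would have every \<open>u\<close> among its
    multiples.\<close>
  have "T0 (T0 u w * s) 0 = 0" for u w s
    using conj0[of u w "- s"] T0w by (metis minus_mult_minus mult_minus_right minus_minus)
  then have T0: "T0 u w = 0" for u w
  proof (cases "T0 u w = 0")
    case False
    have "T0 u w = T0 (T0 u w * (u / T0 u w)) 0" using False T0w by simp
    then show ?thesis using \<open>\<And>u w s. T0 (T0 u w * s) 0 = 0\<close> by metis
  qed simp
  define \<tau> where "\<tau> s = T s 0 0" for s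
  \<comment> \<open>The element with image \<open>(s, u, w)\<close> of the origin is the one for
    \<open>(s, 0, 0)\<close> followed by the one for \<open>(0, u, w - u * s)\<close>, and the
    latter has \<open>t = 0\<close>.\<close>
  have Ts: "T s u w = \<tau> s" for s u w
    using mult[of s 0 0 u "w - u * s" 0] T0 by (simp add: T0_def \<tau>_def)
  have "\<tau> (s + s') = \<tau> s + \<tau> s'" for s s'
    using mult[of s s' 0 0 0 0] by (simp add: Ts)
  moreover have "K = {unipotent_map s (\<tau> s) u w | s u w. True}"
  proof (intro equalityI subsetI)
    fix k assume k: "k \<in> K"
    then obtain s t u w where "k = unipotent_map s t u w" using shape by blast
    then show "k \<in> {unipotent_map s (\<tau> s) u w | s u w. True}" using Teq Ts k by auto
  qed (use T in \<open>auto simp: Ts\<close>)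
  ultimately show ?thesis by blast
qed

section \<open>The affine plane over a finite field\<close>

definition aff_col :: "'a::field \<times> 'a \<Rightarrow> 'a \<times> 'a \<Rightarrow> 'a \<times> 'a \<Rightarrow> bool" where
  "aff_col p q r \<longleftrightarrow> (fst q - fst p) * (snd r - snd p) = (snd q - snd p) * (fst r - fst p)"

definition aff_par :: "'a::field \<times> 'a \<Rightarrow> 'a \<times> 'a \<Rightarrow> 'a \<times> 'a \<Rightarrow> 'a \<times> 'a \<Rightarrow> bool" where
  "aff_par p q r s \<longleftrightarrow> (fst q - fst p) * (snd s - snd r) = (snd q - snd p) * (fst s - fst r)"

text \<open>The right-hand side mentions collinearity only, which is why collineations respect
  parallelism. The two lines are those joining \<open>p\<close>, \<open>q\<close> and
  \<open>r\<close>, \<open>s\<close>.\<close>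

lemma aff_par_iff:
  assumes pq: "p \<noteq> q" and rs: "r \<noteq> s"
  shows "aff_par p q r s \<longleftrightarrow>
    aff_col p q r \<and> aff_col p q s \<or> \<not> (\<exists>z. aff_col p q z \<and> aff_col r s z)"
proof -
  obtain p1 p2 q1 q2 r1 r2 s1 s2 where [simp]: "p = (p1, p2)" "q = (q1, q2)" "r = (r1, r2)" "s = (s1, s2)"
    by (metis surj_pair)
  have one: "aff_par p q r s" if "aff_col p q r" "aff_col p q s"
    using that unfolding aff_col_def aff_par_def by simp algebra
  have two: "\<exists>z. aff_col p q z \<and> aff_col r s z" if np: "\<not> aff_par p q r s"
  proof -
    \<comment> \<open>Cramer's rule: the lines meet at the point
      \<open>p + k (q - p)\<close>.\<close>
    define D where "D = (q1 - p1) * (s2 - r2) - (q2 - p2) * (s1 - r1)"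
    define k where "k = ((r1 - p1) * (s2 - r2) - (r2 - p2) * (s1 - r1)) / D"
    have D: "D \<noteq> 0" using np by (simp add: aff_par_def D_def)
    have kD: "k * D = (r1 - p1) * (s2 - r2) - (r2 - p2) * (s1 - r1)"
      using D by (simp add: k_def)
    have "aff_col p q (p1 + k * (q1 - p1), p2 + k * (q2 - p2))"
      by (simp add: aff_col_def)
    moreover have "aff_col r s (p1 + k * (q1 - p1), p2 + k * (q2 - p2))"
      using kD by (simp add: aff_col_def D_def algebra_simps)
    ultimately show ?thesis by blast
  qed
  have three: "aff_col p q r \<and> aff_col p q s"
    if par: "aff_par p q r s" and z: "aff_col p q z" "aff_col r s z" for z
  proof -
    obtain z1 z2 where [simp]: "z = (z1, z2)" by (metis surj_pair)
    have P: "(q1 - p1) * (s2 - r2) = (q2 - p2) * (s1 - r1)" using par by (simp add: aff_par_def)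
    have Z: "(q1 - p1) * (z2 - p2) = (q2 - p2) * (z1 - p1)" using z by (simp add: aff_col_def)
    have R: "(s1 - r1) * (z2 - r2) = (s2 - r2) * (z1 - r1)" using z by (simp add: aff_col_def)
    have "(s1 - r1) * ((q1 - p1) * (r2 - p2) - (q2 - p2) * (r1 - p1)) = 0"
      using P Z R by algebra
    moreover have "(s2 - r2) * ((q1 - p1) * (r2 - p2) - (q2 - p2) * (r1 - p1)) = 0"
      using P Z R by algebra
    moreover have "s1 - r1 \<noteq> 0 \<or> s2 - r2 \<noteq> 0" using rs by auto
    ultimately have E: "(q1 - p1) * (r2 - p2) = (q2 - p2) * (r1 - p1)" by auto
    moreover have "(q1 - p1) * (s2 - p2) = (q2 - p2) * (s1 - p1)" using E P by algebra
    ultimately show ?thesis by (simp add: aff_col_def)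
  qed
  show ?thesis using one two three by blast
qed

lemma aff_par_preserved:
  assumes bij: "bij \<phi>" and col: "\<And>p q r. aff_col (\<phi> p) (\<phi> q) (\<phi> r) \<longleftrightarrow> aff_col p q r"
    and par: "aff_par p q r s"
  shows "aff_par (\<phi> p) (\<phi> q) (\<phi> r) (\<phi> s)"
proof (cases "p = q \<or> r = s")
  case True
  then show ?thesis by (auto simp: aff_par_def)
next
  case False
  then have ne: "\<phi> p \<noteq> \<phi> q" "\<phi> r \<noteq> \<phi> s" using bij by (auto dest: bij_is_inj injD)
  have "(\<exists>z. aff_col (\<phi> p) (\<phi> q) z \<and> aff_col (\<phi> r) (\<phi> s) z) \<longleftrightarrow>
      (\<exists>z. aff_col (\<phi> p) (\<phi> q) (\<phi> z) \<and> aff_col (\<phi> r) (\<phi> s) (\<phi> z))"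
    using bij by (metis bij_pointE)
  then show ?thesis
    using par aff_par_iff[of p q r s] aff_par_iff[OF ne] False by (simp add: col)
qed

text \<open>Fundamental theorem of affine geometry with a fixed frame. The field operations are
  recovered by incidence: the line from \<open>(a, b)\<close> to \<open>(a + b, 0)\<close> is
  parallel to the one from \<open>(1, 0)\<close> to \<open>(0, 1)\<close>, and
  \<open>(a, a * b)\<close> lies on the line joining the origin to \<open>(1, b)\<close>.\<close>

lemma collineation_fixing_frame:
  fixes \<phi> :: "'a::field \<times> 'a \<Rightarrow> 'a \<times> 'a"
  assumes bij: "bij \<phi>" and col: "\<And>p q r. aff_col (\<phi> p) (\<phi> q) (\<phi> r) \<longleftrightarrow> aff_col p q r"
    and frm: "\<phi> (0, 0) = (0, 0)" "\<phi> (1, 0) = (1, 0)" "\<phi> (0, 1) = (0, 1)"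
  shows "\<exists>\<sigma>. (\<forall>a b. \<sigma> (a + b) = \<sigma> a + \<sigma> b) \<and> (\<forall>a b. \<sigma> (a * b) = \<sigma> a * \<sigma> b) \<and> \<sigma> 1 = 1 \<and>
    (\<forall>a b. \<phi> (a, b) = (\<sigma> a, \<sigma> b))"
proof -
  note par = aff_par_preserved[OF bij col]
  define \<sigma> where "\<sigma> a = fst (\<phi> (a, 0))" for a
  define \<tau> where "\<tau> a = snd (\<phi> (0, a))" for a
  have x: "\<phi> (a, 0) = (\<sigma> a, 0)" for a
    using col[of "(0,0)" "(1,0)" "(a,0)"] by (simp add: frm aff_col_def \<sigma>_def prod_eq_iff)
  have y: "\<phi> (0, a) = (0, \<tau> a)" for a
    using col[of "(0,0)" "(0,1)" "(0,a)"] by (simp add: frm aff_col_def \<tau>_def prod_eq_iff)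
  have one: "\<sigma> 1 = 1" "\<tau> 1 = 1" using x[of 1] y[of 1] frm by auto
  have zero: "\<sigma> 0 = 0" using x[of 0] frm by auto
  \<comment> \<open>Parallels to the line through \<open>(1, 0)\<close> and \<open>(0, 1)\<close>
    identify the scales on the two axes.\<close>
  have \<tau>: "\<tau> a = \<sigma> a" for a
    using par[of "(a,0)" "(0,a)" "(1,0)" "(0,1)"] by (simp add: frm x y aff_par_def one)
  have xy: "\<phi> (a, b) = (\<sigma> a, \<sigma> b)" for a b
    using par[of "(a,0)" "(a,b)" "(0,0)" "(0,1)"] par[of "(0,b)" "(a,b)" "(0,0)" "(1,0)"]
    by (simp add: frm x y \<tau> one zero aff_par_def prod_eq_iff)
  have add: "\<sigma> (a + b) = \<sigma> a + \<sigma> b" for a b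
    using par[of "(a,b)" "(a+b,0)" "(1,0)" "(0,1)"] 
    by (simp add: xy one zero aff_par_def algebra_simps)
  have mult: "\<sigma> (a * b) = \<sigma> a * \<sigma> b" for a b
    using col[of "(0,0)" "(1,b)" "(a,a*b)"] 
    by (simp add: xy one zero aff_col_def algebra_simps)
  show ?thesis using one add mult xy by blast
qed

lemma collineation_semiaffine:
  fixes \<phi> :: "'a::field \<times> 'a \<Rightarrow> 'a \<times> 'a"
  assumes bij: "bij \<phi>" and col: "\<And>p q r. aff_col (\<phi> p) (\<phi> q) (\<phi> r) \<longleftrightarrow> aff_col p q r"
  shows "\<exists>\<sigma> m11 m12 m21 m22 v1 v2.
    (\<forall>a b. \<sigma> (a + b) = \<sigma> a + \<sigma> b) \<and> (\<forall>a b. \<sigma> (a * b) = \<sigma> a * \<sigma> b) \<and> \<sigma> 1 = 1 \<and>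
    m11 * m22 - m12 * m21 \<noteq> 0 \<and>
    (\<forall>a b. \<phi> (a, b) = (m11 * \<sigma> a + m12 * \<sigma> b + v1, m21 * \<sigma> a + m22 * \<sigma> b + v2))"
proof -
  obtain v1 v2 where v: "\<phi> (0, 0) = (v1, v2)" by (metis surj_pair)
  define m11 m21 where "m11 = fst (\<phi> (1, 0)) - v1" and "m21 = snd (\<phi> (1, 0)) - v2"
  define m12 m22 where "m12 = fst (\<phi> (0, 1)) - v1" and "m22 = snd (\<phi> (0, 1)) - v2"
  have e: "\<phi> (1, 0) = (m11 + v1, m21 + v2)" "\<phi> (0, 1) = (m12 + v1, m22 + v2)"
    by (simp_all add: m11_def m21_def m12_def m22_def prod_eq_iff)
  define D where "D = m11 * m22 - m12 * m21"
  have D: "D \<noteq> 0"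
    using col[of "(0,0)" "(1,0)" "(0,1)"] by (simp add: v e aff_col_def D_def algebra_simps)
  \<comment> \<open>\<open>A\<close> is the affine map that agrees with \<open>\<phi>\<close> on the
    standard frame and \<open>B\<close> is its inverse, so \<open>B\<close> after
    \<open>\<phi>\<close> fixes the frame.\<close>
  define A where "A = (\<lambda>(a, b). (m11 * a + m12 * b + v1, m21 * a + m22 * b + v2))"
  define B where "B = (\<lambda>(x, y). ((m22 * (x - v1) - m12 * (y - v2)) / D, (m11 * (y - v2) - m21 * (x - v1)) / D))"
  have AB: "A (B z) = z" for z
  proof (cases z)
    case (Pair x y)
    have "m11 * (m22 * (x - v1) - m12 * (y - v2)) + m12 * (m11 * (y - v2) - m21 * (x - v1)) = (x - v1) * D"
      "m21 * (m22 * (x - v1) - m12 * (y - v2)) + m22 * (m11 * (y - v2) - m21 * (x - v1)) = (y - v2) * D"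
      unfolding D_def by (simp_all add: algebra_simps)
    then show ?thesis
      using D by (simp add: Pair A_def B_def add_divide_distrib[symmetric])
  qed
  have BA: "B (A z) = z" for z
  proof (cases z)
    case (Pair x y)
    have "m22 * (m11 * x + m12 * y) - m12 * (m21 * x + m22 * y) = x * D"
      "m11 * (m21 * x + m22 * y) - m21 * (m11 * x + m12 * y) = y * D"
      unfolding D_def by (simp_all add: algebra_simps)
    then show ?thesis using D by (simp add: Pair A_def B_def)
  qed
  have "bij B" by (rule o_bij[of A]) (auto simp: AB BA)
  have colA: "aff_col (A p) (A q) (A r) \<longleftrightarrow> aff_col p q r" for p q r
  proof -
    obtain p1 p2 q1 q2 r1 r2 where [simp]: "p = (p1, p2)" "q = (q1, q2)" "r = (r1, r2)"
      by (metis surj_pair)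
    have "(m11 * q1 + m12 * q2 - (m11 * p1 + m12 * p2)) * (m21 * r1 + m22 * r2 - (m21 * p1 + m22 * p2)) -
       (m21 * q1 + m22 * q2 - (m21 * p1 + m22 * p2)) * (m11 * r1 + m12 * r2 - (m11 * p1 + m12 * p2)) =
       D * ((q1 - p1) * (r2 - p2) - (q2 - p2) * (r1 - p1))" (is "?X - ?Y = _")
      unfolding D_def by (simp add: algebra_simps)
    moreover have "aff_col (A p) (A q) (A r) \<longleftrightarrow> ?X - ?Y = 0"
      by (simp add: aff_col_def A_def)
    ultimately show ?thesis using D by (simp add: aff_col_def)
  qed
  have "bij (B \<circ> \<phi>)" using \<open>bij B\<close> bij bij_comp by blast
  moreover have "aff_col ((B \<circ> \<phi>) p) ((B \<circ> \<phi>) q) ((B \<circ> \<phi>) r) \<longleftrightarrow> aff_col p q r" for p q r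
    using colA[of "B (\<phi> p)" "B (\<phi> q)" "B (\<phi> r)"] by (simp add: AB col)
  moreover have "(B \<circ> \<phi>) (0, 0) = (0, 0)" "(B \<circ> \<phi>) (1, 0) = (1, 0)" "(B \<circ> \<phi>) (0, 1) = (0, 1)"
    using BA[of "(0, 0)"] BA[of "(1, 0)"] BA[of "(0, 1)"] by (simp_all add: v e A_def)
  ultimately obtain \<sigma> where \<sigma>: "\<forall>a b. \<sigma> (a + b) = \<sigma> a + \<sigma> b" "\<forall>a b. \<sigma> (a * b) = \<sigma> a * \<sigma> b" "\<sigma> 1 = 1"
      "\<forall>a b. (B \<circ> \<phi>) (a, b) = (\<sigma> a, \<sigma> b)"
    using collineation_fixing_frame by blast
  have "\<phi> (a, b) = A (\<sigma> a, \<sigma> b)" for a b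
    using \<sigma>(4) AB[of "\<phi> (a, b)"] by simp
  then have "\<forall>a b. \<phi> (a, b) = (m11 * \<sigma> a + m12 * \<sigma> b + v1, m21 * \<sigma> a + m22 * \<sigma> b + v2)"
    by (simp add: A_def)
  then show ?thesis
    using \<sigma>(1-3) D[unfolded D_def] by blast
qed

section \<open>Collineations of the Payne-derived quadrangle in coordinates\<close>

text \<open>The point \<open>(a, b, c)\<close> stands for \<open>\<langle>e\<^sub>0 + a e\<^sub>1 + b e\<^sub>2 + c e\<^sub>3\<rangle>\<close>; points with equal
  \<open>(a, b)\<close> lie on a hyperbolic line through \<open>x = \<langle>e\<^sub>3\<rangle>\<close>.\<close>

fun same_fibre :: "'a \<times> 'a \<times> 'a \<Rightarrow> 'a \<times> 'a \<times> 'a \<Rightarrow> bool" where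
  "same_fibre (a, b, c) (a', b', c') \<longleftrightarrow> a = a' \<and> b = b'"

text \<open>The equation expresses that the vectors with coordinates \<open>(1, a, b, c)\<close> and
  \<open>(1, a', b', c')\<close> are orthogonal for the symplectic form; the first alternative
  accounts for the lines through \<open>x\<close>.\<close>

fun payne_coll :: "'a::field \<times> 'a \<times> 'a \<Rightarrow> 'a \<times> 'a \<times> 'a \<Rightarrow> bool" where
  "payne_coll (a, b, c) (a', b', c') \<longleftrightarrow> a = a' \<and> b = b' \<or> c' - c = b * a' - a * b'"

text \<open>Used to show that a discrepancy in the third coordinate is constant. Every point with
  \<open>(a, b)\<close> nonzero has a neighbour of the form \<open>(_, _, 0)\<close> or is one, and
  all of these reach the origin. A point \<open>(0, 0, c)\<close> gets there through
  \<open>(1, 0, c)\<close>.\<close>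

lemma payne_graph_connected:
  fixes D :: "'a::field \<times> 'a \<times> 'a \<Rightarrow> 'b"
  assumes D: "\<And>y z. payne_coll y z \<Longrightarrow> \<not> same_fibre y z \<Longrightarrow> D y = D z"
  shows "D y = D (0, 0, 0)"
proof -
  have step: "D (a, b, c) = D (a', b', c')" if "c' - c = b * a' - a * b'" "(a, b) \<noteq> (a', b')" for a b c a' b' c'
    by (rule D) (use that in auto)
  have zero: "D (a, b, 0) = D (0, 0, 0)" for a b
    using step[of 0 0 b 0 a 0] by (cases "(a, b) = (0, 0)") auto
  obtain a b c where y: "y = (a, b, c)" by (metis surj_pair)
  consider "a \<noteq> 0" | "b \<noteq> 0" | "a = 0" "b = 0" by blast
  then show ?thesis
  proof cases
    case 1
    then have "D (0, c / a, 0) = D (a, b, c)" by (intro step) auto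
    then show ?thesis using zero y by metis
  next
    case 2
    then have "D (- c / b, 0, 0) = D (a, b, c)" by (intro step) auto
    then show ?thesis using zero y by metis
  next
    case 3
    have "D (1, 0, c) = D (0, 0, 0)"
      using step[of c 0 c 1 0 0] zero[of 0 c] by simp
    moreover have "D (1, 0, c) = D (0, 0, c)" by (intro step) auto
    ultimately show ?thesis using y 3 by simp
  qed
qed

text \<open>The action of a symplectic similitude fixing \<open>x\<close>, scaled so that the
  \<open>e0\<close>-coordinate stays 1. The determinant multiplying \<open>c\<close> is the
  similitude factor, and the bilinear correction in \<open>v1\<close>, \<open>v2\<close> compensates
  for the translation of \<open>(a, b)\<close>.\<close>

fun payne_affine :: "'a::field \<Rightarrow> 'a \<Rightarrow> 'a \<Rightarrow> 'a \<Rightarrow> 'a \<Rightarrow> 'a \<Rightarrow> 'a \<Rightarrow> 'a \<times> 'a \<times> 'a \<Rightarrow> 'a \<times> 'a \<times> 'a" where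
  "payne_affine m11 m12 m21 m22 v1 v2 w (a, b, c) =
    (m11 * a + m12 * b + v1, m21 * a + m22 * b + v2,
     (m11 * m22 - m12 * m21) * c + ((m11 * a + m12 * b) * v2 - (m21 * a + m22 * b) * v1) + w)"

lemma linear_2x2_inj:
  fixes m11 :: "'a::field"
  assumes D: "m11 * m22 - m12 * m21 \<noteq> 0"
    and e: "m11 * a + m12 * b = m11 * a' + m12 * b'" "m21 * a + m22 * b = m21 * a' + m22 * b'"
  shows "a = a' \<and> b = b'"
proof -
  have "(m11 * m22 - m12 * m21) * (a - a') = 0" "(m11 * m22 - m12 * m21) * (b - b') = 0"
    using e by algebra+
  then show ?thesis using D by auto
qed

lemma
  assumes D: "m11 * m22 - m12 * m21 \<noteq> 0"
  shows inj_payne_affine: "inj (payne_affine m11 m12 m21 m22 v1 v2 w)"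
    and payne_affine_same_fibre: "same_fibre (payne_affine m11 m12 m21 m22 v1 v2 w y)
        (payne_affine m11 m12 m21 m22 v1 v2 w z) \<longleftrightarrow> same_fibre y z"
    and payne_affine_coll: "payne_coll (payne_affine m11 m12 m21 m22 v1 v2 w y)
        (payne_affine m11 m12 m21 m22 v1 v2 w z) \<longleftrightarrow> payne_coll y z"
proof -
  show "inj (payne_affine m11 m12 m21 m22 v1 v2 w)"
  proof (rule injI)
    fix y z assume eq: "payne_affine m11 m12 m21 m22 v1 v2 w y = payne_affine m11 m12 m21 m22 v1 v2 w z"
    obtain a b c a' b' c' where [simp]: "y = (a, b, c)" "z = (a', b', c')" by (metis surj_pair)
    have "a = a' \<and> b = b'" by (rule linear_2x2_inj[OF D]) (use eq in auto)
    then show "y = z" using eq D by simp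
  qed
  obtain a b c a' b' c' where [simp]: "y = (a, b, c)" "z = (a', b', c')" by (metis surj_pair)
  show sf: "same_fibre (payne_affine m11 m12 m21 m22 v1 v2 w y)
        (payne_affine m11 m12 m21 m22 v1 v2 w z) \<longleftrightarrow> same_fibre y z"
    using linear_2x2_inj[OF D, of a b a' b'] by auto
  define Q where "Q = m11 * m22 - m12 * m21"
  obtain x1 x2 x3 where x: "payne_affine m11 m12 m21 m22 v1 v2 w y = (x1, x2, x3)" by (metis surj_pair)
  obtain z1 z2 z3 where z: "payne_affine m11 m12 m21 m22 v1 v2 w z = (z1, z2, z3)" by (metis surj_pair)
  \<comment> \<open>The defect from collinearity is the value of the symplectic form on the two
    vectors; it is multiplied by the similitude factor.\<close>
  have "z3 - x3 - (x2 * z1 - x1 * z2) = Q * (c' - c - (b * a' - a * b'))"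
  proof -
    have e: "x1 = m11 * a + m12 * b + v1" "x2 = m21 * a + m22 * b + v2"
      "x3 = Q * c + ((m11 * a + m12 * b) * v2 - (m21 * a + m22 * b) * v1) + w"
      "z1 = m11 * a' + m12 * b' + v1" "z2 = m21 * a' + m22 * b' + v2"
      "z3 = Q * c' + ((m11 * a' + m12 * b') * v2 - (m21 * a' + m22 * b') * v1) + w"
      using x z by (auto simp: Q_def)
    show ?thesis unfolding e by (simp add: Q_def algebra_simps)
  qed
  then have "z3 - x3 = x2 * z1 - x1 * z2 \<longleftrightarrow> c' - c = b * a' - a * b'"
    using D Q_def by (metis eq_iff_diff_eq_0 mult_eq_0_iff)
  then show "payne_coll (payne_affine m11 m12 m21 m22 v1 v2 w y)
        (payne_affine m11 m12 m21 m22 v1 v2 w z) \<longleftrightarrow> payne_coll y z"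
    using sf unfolding x z by simp
qed

text \<open>A generalized quadrangle has no triangles, so the points collinear with two distinct
  collinear points form the line joining them. With this encoding no separate type of lines
  occurs.\<close>

definition on_line :: "'a::field \<times> 'a \<times> 'a \<Rightarrow> 'a \<times> 'a \<times> 'a \<Rightarrow> 'a \<times> 'a \<times> 'a \<Rightarrow> bool" where
  "on_line y y' z \<longleftrightarrow> payne_coll z y \<and> payne_coll z y'"

lemma on_line_fibre:
  fixes a b c :: "'a::field"
  assumes "c \<noteq> c'"
  shows "on_line (a, b, c) (a, b, c') (p, r, d) \<longleftrightarrow> p = a \<and> r = b"
proof -
  have "\<not> (c - d = r * a - p * b \<and> c' - d = r * a - p * b)"
    using assms by (metis diff_add_cancel)
  then show ?thesis by (auto simp: on_line_def)
qed

text \<open>The combinatorial property of the line \<open>yy'\<close> which separates, for \<open>q\<close> odd, the lines through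
  \<open>x\<close> from the totally isotropic ones: through every point there is a line that coincides with it
  or forms a regular pair of lines with it.\<close>

definition regular_line :: "'a::field \<times> 'a \<times> 'a \<Rightarrow> 'a \<times> 'a \<times> 'a \<Rightarrow> bool" where
  "regular_line y y' \<longleftrightarrow> (\<forall>z. on_line y y' z \<or>
    (\<exists>z'. z' \<noteq> z \<and> payne_coll z z' \<and> (\<forall>l. \<not> (on_line y y' l \<and> on_line z z' l)) \<and>
      (\<forall>l m n. on_line y y' l \<longrightarrow> on_line z z' m \<longrightarrow> payne_coll l m \<longrightarrow> on_line l m n \<longrightarrow>
        (\<exists>n'. n' \<noteq> n \<and> payne_coll n n' \<and>
          (\<forall>l' m'. on_line y y' l' \<longrightarrow> on_line z z' m' \<longrightarrow> payne_coll l' m' \<longrightarrow>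
            (\<exists>e. on_line n n' e \<and> on_line l' m' e))))))"

text \<open>The predicate is built from \<open>payne_coll\<close>, equality and quantifiers over
  points, so it is parametric in the graph of the bijection \<open>\<kappa>\<close>.\<close>

lemma regular_line_preserved:
  assumes "bij \<kappa>" and "\<And>y z. payne_coll (\<kappa> y) (\<kappa> z) \<longleftrightarrow> payne_coll y z"
  shows "regular_line (\<kappa> y) (\<kappa> y') \<longleftrightarrow> regular_line y y'"
proof -
  define R where "R y z \<longleftrightarrow> z = \<kappa> y" for y z
  have [transfer_rule]: "bi_unique R" "bi_total R"
    using assms(1) unfolding R_def bi_unique_def bi_total_def
    by (metis bij_pointE)+
  have [transfer_rule]: "rel_fun R (rel_fun R (=)) payne_coll payne_coll"
    using assms(2) by (auto simp: R_def rel_fun_def)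
  have "rel_fun R (rel_fun R (=)) regular_line regular_line"
    unfolding regular_line_def on_line_def by transfer_prover
  then show ?thesis unfolding R_def rel_fun_def by blast
qed

text \<open>The second line is the fibre through \<open>z\<close>. Each transversal of two fibres
  projects onto the affine line joining their base points, and therefore meets every fibre over that
  line; these fibres complete the grid. The \<open>+ 1\<close> in the witnesses only names a second
  point of a fibre.\<close>

lemma regular_line_fibre:
  fixes y :: "'a::field \<times> 'a \<times> 'a"
  assumes sf: "same_fibre y y'" and ne: "y \<noteq> y'"
  shows "regular_line y y'"
proof -
  obtain a0 b0 c0 c0' where [simp]: "y = (a0, b0, c0)" "y' = (a0, b0, c0')" "c0 \<noteq> c0'"
    using sf ne by (cases y; cases y') auto
  note ln = on_line_fibre
  show ?thesis
    unfolding regular_line_def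
  proof (intro allI disjCI)
    fix z assume z: "\<not> (\<exists>z'. z' \<noteq> z \<and> payne_coll z z' \<and> (\<forall>l. \<not> (on_line y y' l \<and> on_line z z' l)) \<and>
      (\<forall>l m n. on_line y y' l \<longrightarrow> on_line z z' m \<longrightarrow> payne_coll l m \<longrightarrow> on_line l m n \<longrightarrow>
        (\<exists>n'. n' \<noteq> n \<and> payne_coll n n' \<and>
          (\<forall>l' m'. on_line y y' l' \<longrightarrow> on_line z z' m' \<longrightarrow> payne_coll l' m' \<longrightarrow>
            (\<exists>e. on_line n n' e \<and> on_line l' m' e)))))"
    obtain a1 b1 c1 where [simp]: "z = (a1, b1, c1)" by (metis surj_pair)
    show "on_line y y' z"
    proof (rule ccontr)
      assume "\<not> on_line y y' z"
      then have off: "(a1, b1) \<noteq> (a0, b0)" by (auto simp: ln)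
      have "\<exists>z'. z' \<noteq> z \<and> payne_coll z z' \<and> (\<forall>l. \<not> (on_line y y' l \<and> on_line z z' l)) \<and>
      (\<forall>l m n. on_line y y' l \<longrightarrow> on_line z z' m \<longrightarrow> payne_coll l m \<longrightarrow> on_line l m n \<longrightarrow>
        (\<exists>n'. n' \<noteq> n \<and> payne_coll n n' \<and>
          (\<forall>l' m'. on_line y y' l' \<longrightarrow> on_line z z' m' \<longrightarrow> payne_coll l' m' \<longrightarrow>
            (\<exists>e. on_line n n' e \<and> on_line l' m' e))))"
      proof (rule exI[of _ "(a1, b1, c1 + 1)"], intro conjI allI impI)
        fix l show "\<not> (on_line y y' l \<and> on_line z (a1, b1, c1 + 1) l)"
          using off by (cases l) (auto simp: ln)
      next
        fix l m n assume A: "on_line y y' l" "on_line z (a1, b1, c1 + 1) m" "payne_coll l m" "on_line l m n"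
        obtain cl cm p r d where [simp]: "l = (a0, b0, cl)" "m = (a1, b1, cm)" "n = (p, r, d)"
          using A by (cases l; cases m; cases n) (auto simp: ln)
        have lm: "cm - cl = b0 * a1 - a0 * b1" using A(3) off by auto
        have "p = a0 \<and> r = b0 \<or> cl - d = r * a0 - p * b0" "p = a1 \<and> r = b1 \<or> cm - d = r * a1 - p * b1"
          using A(4) unfolding on_line_def by auto
        then consider "p = a0" "r = b0" | "p = a1" "r = b1" |
            "cl - d = r * a0 - p * b0" "cm - d = r * a1 - p * b1"
          by blast
        \<comment> \<open>The base point of \<open>n\<close> lies on the affine line joining the
          base points of the two fibres.\<close>
        then have det: "(p - a0) * (b1 - b0) = (r - b0) * (a1 - a0)"
        proof cases
          case 3
          have "cm - cl = (cm - d) - (cl - d)" by simp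
          then have "b0 * a1 - a0 * b1 = (r * a1 - p * b1) - (r * a0 - p * b0)"
            unfolding 3 lm .
          then show ?thesis by (simp add: algebra_simps)
        qed (simp_all add: mult.commute)
        show "\<exists>n'. n' \<noteq> n \<and> payne_coll n n' \<and> (\<forall>l' m'. on_line y y' l' \<longrightarrow> on_line z (a1, b1, c1 + 1) m' \<longrightarrow>
            payne_coll l' m' \<longrightarrow> (\<exists>e. on_line n n' e \<and> on_line l' m' e))"
        proof (rule exI[of _ "(p, r, d + 1)"], intro conjI allI impI)
          fix l' m' assume B: "on_line y y' l'" "on_line z (a1, b1, c1 + 1) m'" "payne_coll l' m'"
          obtain cl cm where [simp]: "l' = (a0, b0, cl)" "m' = (a1, b1, cm)"
            using B by (cases l'; cases m') (auto simp: ln)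
          have lm: "cm - cl = b0 * a1 - a0 * b1" using B(3) off by auto
          \<comment> \<open>The third coordinate solves the collinearity equation with
            \<open>l'\<close>; \<open>det\<close> then yields collinearity with \<open>m'\<close> as
            well.\<close>
          have "payne_coll (p, r, cl + b0 * p - a0 * r) l'" by (simp add: algebra_simps)
          moreover have "cm - (cl + b0 * p - a0 * r) = r * a1 - p * b1"
            using lm det by algebra
          then have "payne_coll (p, r, cl + b0 * p - a0 * r) m'" by simp
          ultimately show "\<exists>e. on_line n (p, r, d + 1) e \<and> on_line l' m' e"
            by (intro exI[of _ "(p, r, cl + b0 * p - a0 * r)"]) (auto simp: on_line_def)
        qed auto
      qed auto
      then show False using z by blast
    qed
  qed
qed

text \<open>Absence of triangles. Away from the fibre case, the defect from collinearity of
  \<open>z\<close> and \<open>z'\<close> is annihilated by both \<open>a' - a\<close> and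
  \<open>b' - b\<close>, one of which is nonzero.\<close>

lemma on_line_payne_coll:
  assumes "y \<noteq> y'" "payne_coll y y'" "on_line y y' z" "on_line y y' z'"
  shows "payne_coll z z'"
proof -
  obtain a b c a' b' c' where [simp]: "y = (a, b, c)" "y' = (a', b', c')" by (metis surj_pair)
  obtain p r d p' r' d' where [simp]: "z = (p, r, d)" "z' = (p', r', d')" by (metis surj_pair)
  show ?thesis
  proof (cases "a = a' \<and> b = b'")
    case True
    then have "p = a \<and> r = b" "p' = a \<and> r' = b"
      using assms on_line_fibre[of c c'] by auto
    then show ?thesis by simp
  next
    case False
    moreover have "a = a' \<and> b = b' \<or> c' - c = b * a' - a * b'" using assms(2) by simp
    ultimately have cc: "c' - c = b * a' - a * b'" by blast
    have *: "c - d = r * a - p * b \<and> c' - d = r * a' - p * b'"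
      if "on_line y y' (p, r, d)" for p r d
      using that False cc unfolding on_line_def by (auto simp: algebra_simps)
    have 1: "c - d = r * a - p * b" "c' - d = r * a' - p * b'"
        "c - d' = r' * a - p' * b" "c' - d' = r' * a' - p' * b'"
      using *[of p r d] *[of p' r' d'] assms by auto
    have "(a' - a) * (d' - d - (r * p' - p * r')) = 0" "(b' - b) * (d' - d - (r * p' - p * r')) = 0"
      using 1 cc by algebra+
    then show ?thesis using False by auto
  qed
qed

section \<open>Isotropic lines are not regular when q is odd\<close>

lemma obtain_off:
  assumes "finite (A :: 'a::finite set)" "card A < CARD('a)"
  obtains z where "z \<notin> A"
  by (metis UNIV_eq_I assms(2) less_irrefl)

text \<open>If a grid existed for this line and some line through \<open>?z\<close>, the line
  \<open>n n'\<close> would meet all transversals. The intersection points can be computed, and two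
  of them fail to be collinear.\<close>

lemma not_regular_line_std:
  assumes odd: "(2::'a::{field,finite}) \<noteq> 0" and q: "5 \<le> CARD('a)"
  shows "\<not> regular_line (0, 0, 0 :: 'a) (1, 0, 0)"
proof
  let ?o = "(0, 0, 0) :: 'a \<times> 'a \<times> 'a" and ?i = "(1, 0, 0) :: 'a \<times> 'a \<times> 'a"
    and ?z = "(0, 1, 0) :: 'a \<times> 'a \<times> 'a"
  assume reg: "regular_line ?o ?i"
  have four: "card {a, b, c, d :: 'a} < CARD('a)" for a b c d
    using q card_insert_le_m1 by (auto simp: card_insert_if)
  \<comment> \<open>The test point \<open>(0, \<mu>, 0)\<close> lies on the transversal joining
    \<open>?o\<close> and \<open>?z\<close>. The values 0 and 1 would place it on one of the two
    given lines, 2 is exceptional when the second line is a fibre, and \<open>1/2\<close> when the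
    slope \<open>\<beta>\<close> below is 0. Avoiding four values requires q at least 5.\<close>
  obtain \<mu> :: 'a where \<mu>: "\<mu> \<notin> {0, 1, 2, 1/2}"
    using obtain_off[of "{0, 1, 2, 1/2}"] four[of 0 1 2 "1/2"] by blast
  have L: "on_line ?o ?i (a, b, c) \<longleftrightarrow> b = 0 \<and> c = 0" for a b c
    by (auto simp: on_line_def)
  have "\<not> on_line ?o ?i ?z" by (simp add: L)
  with reg[unfolded regular_line_def, THEN spec, of ?z]
  obtain z' where Z: "z' \<noteq> ?z \<and> payne_coll ?z z' \<and> (\<forall>l. \<not> (on_line ?o ?i l \<and> on_line ?z z' l)) \<and>
      (\<forall>l m n. on_line ?o ?i l \<longrightarrow> on_line ?z z' m \<longrightarrow> payne_coll l m \<longrightarrow> on_line l m n \<longrightarrow>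
        (\<exists>n'. n' \<noteq> n \<and> payne_coll n n' \<and>
          (\<forall>l' m'. on_line ?o ?i l' \<longrightarrow> on_line ?z z' m' \<longrightarrow> payne_coll l' m' \<longrightarrow>
            (\<exists>e. on_line n n' e \<and> on_line l' m' e))))"
    by blast
  have z': "z' \<noteq> ?z" "payne_coll ?z z'" "\<And>l. \<not> (on_line ?o ?i l \<and> on_line ?z z' l)"
    using Z by blast+
  have R: "\<exists>n'. n' \<noteq> n \<and> payne_coll n n' \<and>
          (\<forall>l' m'. on_line ?o ?i l' \<longrightarrow> on_line ?z z' m' \<longrightarrow> payne_coll l' m' \<longrightarrow>
            (\<exists>e. on_line n n' e \<and> on_line l' m' e))"
    if "on_line ?o ?i l" "on_line ?z z' m" "payne_coll l m" "on_line l m n" for l m n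
    using Z that by blast
  have "\<exists>n'. n' \<noteq> (0, \<mu>, 0) \<and> payne_coll (0, \<mu>, 0) n' \<and>
          (\<forall>l' m'. on_line ?o ?i l' \<longrightarrow> on_line ?z z' m' \<longrightarrow> payne_coll l' m' \<longrightarrow>
            (\<exists>e. on_line (0, \<mu>, 0) n' e \<and> on_line l' m' e))"
  proof (rule R[of ?o ?z])
    show "on_line ?z z' ?z" using z'(2) by (simp add: on_line_def)
  qed (auto simp: on_line_def)
  then obtain n' where n': "n' \<noteq> (0, \<mu>, 0)" "payne_coll (0, \<mu>, 0) n'"
    and E: "\<And>l' m'. on_line ?o ?i l' \<Longrightarrow> on_line ?z z' m' \<Longrightarrow> payne_coll l' m' \<Longrightarrow>
            (\<exists>e. on_line (0, \<mu>, 0) n' e \<and> on_line l' m' e)"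
    by blast
  obtain p r d where z'eq: "z' = (p, r, d)" by (metis surj_pair)
  show False
  proof (cases "p = 0 \<and> r = 1")
    case True
    \<comment> \<open>Here the second line is the fibre over \<open>(0, 1)\<close>. The point where
      the line \<open>n n'\<close> meets the transversal from \<open>(s, 0, 0)\<close> has second
      coordinate \<open>\<nu>\<close>, whatever \<open>s\<close> is.\<close>
    define \<nu> where "\<nu> = \<mu> / (\<mu> - 1)"
    have \<nu>: "\<nu> * (\<mu> - 1) = \<mu>" using \<mu> by (simp add: \<nu>_def)
    have w: "on_line (0, \<mu>, 0) n' (s * (1 - \<nu>), \<nu>, - s * \<nu>)" if s: "s \<noteq> 0" for s
    proof -
      have M: "on_line ?z z' (0, 1, - s)" using True z'eq by (simp add: on_line_def)
      obtain e where e: "on_line (0, \<mu>, 0) n' e" "on_line (s, 0, 0) (0, 1, - s) e"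
        using E[OF _ M, of "(s, 0, 0)"] by (auto simp: L)
      obtain x y t where eeq: "e = (x, y, t)" by (metis surj_pair)
      have c: "x = 0 \<and> y = \<mu> \<or> t = x * \<mu>" "x = s \<and> y = 0 \<or> - t = s * y"
          "x = 0 \<and> y = 1 \<or> x = s + t"
        using e unfolding on_line_def eeq by (simp_all add: algebra_simps)
      have t: "t = - (s * y)"
        using c(2)
      proof (elim disjE conjE)
        assume "x = s" "y = 0"
        then show ?thesis using c(3) s by simp
      qed (metis minus_minus)
      have x: "x = s * (1 - y)"
        using c(3)
      proof (elim disjE conjE)
        assume "x = s + t"
        then show ?thesis unfolding t by (simp add: algebra_simps)
      qed simp
      have "\<not> (x = 0 \<and> y = \<mu>)" using x s \<mu> by auto
      then have "- (s * y) = s * (1 - y) * \<mu>" using c(1) unfolding t x by blast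
      then have "s * (y * (\<mu> - 1)) = s * \<mu>" by (simp add: algebra_simps)
      then have "y * (\<mu> - 1) = \<nu> * (\<mu> - 1)" using s \<nu> by simp
      then have "y = \<nu>" using \<mu> by simp
      then show ?thesis using e(1) x t eeq by simp
    qed
    \<comment> \<open>The intersection points for s = 1 and s = -1 lie on one line, hence are
      collinear; this leaves only \<nu> = 0, 1 or 2.\<close>
    have "payne_coll (1 * (1 - \<nu>), \<nu>, - 1 * \<nu>) ((-1) * (1 - \<nu>), \<nu>, - (-1) * \<nu>)"
      by (rule on_line_payne_coll[OF n'(1)[symmetric] n'(2) w w]) auto
    then consider "1 * (1 - \<nu>) = (-1) * (1 - \<nu>)"
      | "- (-1) * \<nu> - - 1 * \<nu> = \<nu> * ((-1) * (1 - \<nu>)) - 1 * (1 - \<nu>) * \<nu>"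
      unfolding payne_coll.simps by blast
    then have "\<nu> = 1 \<or> \<nu> = 0 \<or> \<nu> = 2"
    proof cases
      case 1
      have "2 * (1 - \<nu>) = 1 * (1 - \<nu>) - (-1) * (1 - \<nu>)" by (simp add: algebra_simps)
      also have "\<dots> = 0" unfolding 1 by simp
      finally show ?thesis using odd by simp
    next
      case 2
      have "2 * (\<nu> * (2 - \<nu>)) =
          (- (-1) * \<nu> - - 1 * \<nu>) - (\<nu> * ((-1) * (1 - \<nu>)) - 1 * (1 - \<nu>) * \<nu>)"
        by (simp add: algebra_simps)
      also have "\<dots> = 0" unfolding 2 by simp
      finally show ?thesis using odd by simp
    qed
    then show False
    proof (elim disjE)
      assume "\<nu> = 2"
      then have "\<mu> = 2" using \<nu> by (simp add: algebra_simps)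
      then show False using \<mu> by simp
    qed (use \<nu> \<mu> in auto)
  next
    case False
    then have d: "d = p" using z'(2) z'eq by auto
    have p: "p \<noteq> 0"
    proof
      assume "p = 0"
      then have "on_line ?z z' ?o" using d z'eq by (simp add: on_line_def)
      then show False using z'(3)[of "?o"] by (simp add: L)
    qed
    \<comment> \<open>The slope of the second line, whose points are now
      \<open>(\<rho>, 1 + \<rho> * \<beta>, \<rho>)\<close>.\<close>
    define \<beta> where "\<beta> = (r - 1) / p"
    have r: "r = 1 + p * \<beta>" using p by (simp add: \<beta>_def)
    have w: "\<exists>y. y * (\<mu> * (2 + s * \<beta>) - 1) = \<mu> \<and> on_line (0, \<mu>, 0) n' (- s * y / \<mu>, y, - s * y)"
      if s: "s \<noteq> 0" "1 + s * \<beta> \<noteq> 0" "\<mu> * (2 + s * \<beta>) \<noteq> 1" for s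
    proof -
      \<comment> \<open>The parameter of the point of the second line collinear with
        \<open>(s, 0, 0)\<close>.\<close>
      define \<rho> where "\<rho> = - s / (1 + s * \<beta>)"
      have \<rho>: "\<rho> * (1 + s * \<beta>) = - s" using s by (simp add: \<rho>_def)
      have M: "on_line ?z z' (\<rho>, 1 + \<rho> * \<beta>, \<rho>)"
        unfolding z'eq d r by (simp add: on_line_def algebra_simps)
      obtain e where e: "on_line (0, \<mu>, 0) n' e" "on_line (s, 0, 0) (\<rho>, 1 + \<rho> * \<beta>, \<rho>) e"
        using E[OF _ M, of "(s, 0, 0)"] \<rho> by (auto simp: L algebra_simps)
      obtain x y t where eeq: "e = (x, y, t)" by (metis surj_pair)
      have c: "x = 0 \<and> y = \<mu> \<or> t = x * \<mu>" "x = s \<and> y = 0 \<or> - t = s * y"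
          "x = \<rho> \<and> y = 1 + \<rho> * \<beta> \<or> \<rho> - t = y * \<rho> - x * (1 + \<rho> * \<beta>)"
        using e unfolding on_line_def eeq by (simp_all add: algebra_simps)
      have t: "t = - (s * y)"
      proof (rule ccontr)
        assume "t \<noteq> - (s * y)"
        then have xy: "x = s" "y = 0" using c(2) by (metis minus_minus)+
        then have t: "t = s * \<mu>" using c(1) s by auto
        from c(3) show False
        proof
          assume "x = \<rho> \<and> y = 1 + \<rho> * \<beta>"
          then have "s = \<rho>" "1 + s * \<beta> = 0" using xy by auto
          then show False using s by simp
        next
          assume "\<rho> - t = y * \<rho> - x * (1 + \<rho> * \<beta>)"
          then have "s * \<mu> = 0" using xy t \<rho> by algebra
          then show False using s \<mu> by simp
        qed
      qed
      have x: "x = s - s * y * (2 + s * \<beta>)"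
        using c(3)
      proof
        assume "x = \<rho> \<and> y = 1 + \<rho> * \<beta>"
        then have x: "x = \<rho>" and y: "y = 1 + \<rho> * \<beta>" by auto
        have "y * (1 + s * \<beta>) = (1 + s * \<beta>) + \<beta> * (\<rho> * (1 + s * \<beta>))"
          unfolding y by (simp add: algebra_simps)
        then have y1: "y * (1 + s * \<beta>) = 1" unfolding \<rho> by simp
        have "(1 + s * \<beta>) * (x - (s - s * y * (2 + s * \<beta>))) =
            \<rho> * (1 + s * \<beta>) - s * (1 + s * \<beta>) + s * (2 + s * \<beta>) * (y * (1 + s * \<beta>))"
          unfolding x by (simp add: algebra_simps)
        also have "\<dots> = 0" unfolding \<rho> y1 by (simp add: algebra_simps)
        finally have "(1 + s * \<beta>) * (x - (s - s * y * (2 + s * \<beta>))) = 0" .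
        then show ?thesis using s by auto
      next
        assume "\<rho> - t = y * \<rho> - x * (1 + \<rho> * \<beta>)"
        then have "(1 + s * \<beta>) * (\<rho> + s * y - y * \<rho> + x * (1 + \<rho> * \<beta>)) = 0" using t by algebra
        then show ?thesis using \<rho> by algebra
      qed
      have xm: "x * \<mu> = - (s * y)"
      proof (cases "x = 0 \<and> y = \<mu>")
        case True
        then have "s * (1 - \<mu> * (2 + s * \<beta>)) = s - s * y * (2 + s * \<beta>)"
          by (simp add: algebra_simps)
        also have "\<dots> = 0" using x True by metis
        finally have "s * (1 - \<mu> * (2 + s * \<beta>)) = 0" .
        then show ?thesis using s by simp
      next
        case False
        show ?thesis using c(1) t False by auto
      qed
      have "s * (y * (\<mu> * (2 + s * \<beta>) - 1) - \<mu>) = 0" using xm x by algebra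
      then have "y * (\<mu> * (2 + s * \<beta>) - 1) = \<mu>" using s by simp
      moreover have "x = - s * y / \<mu>" using xm \<mu> by (simp add: field_simps)
      ultimately show ?thesis using e(1) t eeq by auto
    qed
    \<comment> \<open>The parameters excluded in \<open>w\<close>. If \<open>\<beta> = 0\<close>,
      both quotients are 0 by convention; the two remaining conditions then hold because 1 is
      nonzero and \<mu> is not \<open>1/2\<close>. With \<open>s\<close> added there are at most
      four exclusions, so \<open>s'\<close> can be found.\<close>
    define B where "B = {0, - 1 / \<beta>, (1 / \<mu> - 2) / \<beta>}"
    have B: "s \<noteq> 0 \<and> 1 + s * \<beta> \<noteq> 0 \<and> \<mu> * (2 + s * \<beta>) \<noteq> 1" if s: "s \<notin> B" for s
    proof (intro conjI)
      show "s \<noteq> 0" using s by (simp add: B_def)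
      show "1 + s * \<beta> \<noteq> 0"
        using s by (cases "\<beta> = 0") (auto simp: B_def field_simps eq_neg_iff_add_eq_0)
      show "\<mu> * (2 + s * \<beta>) \<noteq> 1"
      proof
        assume e: "\<mu> * (2 + s * \<beta>) = 1"
        show False
        proof (cases "\<beta> = 0")
          case True
          then have "\<mu> = 1/2" using e odd by (simp add: field_simps)
          then show False using \<mu> by simp
        next
          case False
          have "s * \<beta> = 1 / \<mu> - 2" using e \<mu> by (simp add: field_simps)
          then have "s = (1 / \<mu> - 2) / \<beta>" using False by (simp add: field_simps)
          then show False using s by (simp add: B_def)
        qed
      qed
    qed
    have "\<exists>s'. s' \<notin> insert s B" for s
      unfolding B_def by (rule obtain_off[OF _ four]) auto
    then obtain s s' where s: "s \<notin> insert 0 B" and s': "s' \<notin> insert s B" by meson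
    obtain y where y: "y * (\<mu> * (2 + s * \<beta>) - 1) = \<mu>" "on_line (0, \<mu>, 0) n' (- s * y / \<mu>, y, - s * y)"
      using w[of s] B[of s] s by auto
    obtain y' where y': "y' * (\<mu> * (2 + s' * \<beta>) - 1) = \<mu>" "on_line (0, \<mu>, 0) n' (- s' * y' / \<mu>, y', - s' * y')"
      using w[of s'] B[of s'] s' by auto
    have y0: "y \<noteq> 0" "y' \<noteq> 0" using y(1) y'(1) \<mu> by auto
    have "payne_coll (- s * y / \<mu>, y, - s * y) (- s' * y' / \<mu>, y', - s' * y')"
      by (rule on_line_payne_coll[OF n'(1)[symmetric] n'(2) y(2) y'(2)])
    then have "y = y' \<and> s * y = s' * y' \<or> s * y - s' * y' = y * y' * (s - s') / \<mu>"
      using \<mu> by (auto simp: field_simps)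
    then have eq: "s * y - s' * y' = y * y' * (s - s') / \<mu>"
      using y0 s' by auto
    have "(s * y - s' * y') * \<mu> = y * y' * (s - s')"
      unfolding eq using \<mu> by simp
    \<comment> \<open>The equations determining \<open>y\<close> and \<open>y'\<close> eliminate the
      slope from the collinearity condition.\<close>
    then have "y * y' * ((s - s') * (2 * (\<mu> - 1))) = 0" using y(1) y'(1) by algebra
    then show False using y0 s' odd \<mu> by auto
  qed
qed

text \<open>The collineations \<open>payne_affine\<close> take the standard pair
  \<open>(0, 0, 0)\<close>, \<open>(1, 0, 0)\<close> to any two collinear points in different
  fibres, so one isotropic line decides for all.\<close>

lemma regular_line_iff_same_fibre:
  fixes y :: "'a::{field,finite} \<times> 'a \<times> 'a"
  assumes odd: "(2::'a) \<noteq> 0" and q: "5 \<le> CARD('a)"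
    and ne: "y \<noteq> y'" and coll: "payne_coll y y'"
  shows "regular_line y y' \<longleftrightarrow> same_fibre y y'"
proof
  assume reg: "regular_line y y'"
  show "same_fibre y y'"
  proof (rule ccontr)
    assume nsf: "\<not> same_fibre y y'"
    obtain a b c a' b' c' where y: "y = (a, b, c)" "y' = (a', b', c')" by (metis surj_pair)
    have cc: "c' - c = b * a' - a * b'" using coll nsf y by auto
    \<comment> \<open>Any second column completing \<open>(a' - a, b' - b)\<close> to an invertible
      matrix would do.\<close>
    define m12 m22 where "m12 = (if a' - a = 0 then 1 else (0::'a))" and "m22 = (if a' - a = 0 then 0 else (1::'a))"
    have D: "(a' - a) * m22 - m12 * (b' - b) \<noteq> 0"
      using nsf y by (auto simp: m12_def m22_def)
    define \<gamma> where "\<gamma> = payne_affine (a' - a) m12 (b' - b) m22 a b c"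
    have "bij \<gamma>" unfolding \<gamma>_def
      using finite_UNIV_inj_surj[OF _ inj_payne_affine[OF D]] inj_payne_affine[OF D] by (simp add: bij_def)
    moreover have "\<gamma> (0, 0, 0) = y" by (simp add: \<gamma>_def y)
    moreover have "\<gamma> (1, 0, 0) = y'" using cc by (simp add: \<gamma>_def y algebra_simps)
    ultimately have "regular_line (0, 0, 0 :: 'a) (1, 0, 0)"
      using regular_line_preserved[of \<gamma> "(0, 0, 0)" "(1, 0, 0)"] payne_affine_coll[OF D] reg
      unfolding \<gamma>_def by metis
    then show False using not_regular_line_std[OF odd q] by blast
  qed
qed (rule regular_line_fibre[OF _ ne])

section \<open>For q odd, automorphisms of the derived quadrangle are semilinear\<close>

lemma same_fibre_imp_coll: "same_fibre y z \<Longrightarrow> payne_coll y z"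
  by (cases y; cases z) auto

lemma same_fibre_preserved:
  fixes \<kappa> :: "'a::{field,finite} \<times> 'a \<times> 'a \<Rightarrow> 'a \<times> 'a \<times> 'a"
  assumes odd: "(2::'a) \<noteq> 0" and q: "5 \<le> CARD('a)"
    and bij: "bij \<kappa>" and coll: "\<And>y z. payne_coll (\<kappa> y) (\<kappa> z) \<longleftrightarrow> payne_coll y z"
  shows "same_fibre (\<kappa> y) (\<kappa> z) \<longleftrightarrow> same_fibre y z"
proof (cases "y = z \<or> \<not> payne_coll y z")
  case True
  then show ?thesis
  proof
    assume "y = z"
    then show ?thesis by (cases "z"; cases "\<kappa> z") auto
  next
    assume "\<not> payne_coll y z"
    then show ?thesis using same_fibre_imp_coll coll by blast
  qed
next
  case False
  then have "\<kappa> y \<noteq> \<kappa> z" using bij by (auto dest: bij_is_inj injD)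
  then show ?thesis
    using False coll regular_line_iff_same_fibre[OF odd q] regular_line_preserved[OF bij coll] by metis
qed

text \<open>For base points that differ pairwise, adding the three collinearity equations around the
  triangle eliminates the third coordinates and leaves the vanishing of the area determinant. A
  fibre-preserving collineation therefore acts on the affine plane by a collineation.\<close>

lemma aff_col_iff_lift:
  fixes a1 :: "'a::field"
  assumes "(a1, b1) \<noteq> (a2, b2)" "(a1, b1) \<noteq> (a3, b3)" "(a2, b2) \<noteq> (a3, b3)"
  shows "aff_col (a1, b1) (a2, b2) (a3, b3) \<longleftrightarrow>
    (\<exists>c1 c2 c3. payne_coll (a1, b1, c1) (a2, b2, c2) \<and> payne_coll (a1, b1, c1) (a3, b3, c3) \<and>
       payne_coll (a2, b2, c2) (a3, b3, c3))" (is "_ \<longleftrightarrow> ?R")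
proof
  assume "aff_col (a1, b1) (a2, b2) (a3, b3)"
  then have "(b1 * a3 - a1 * b3) - (b1 * a2 - a1 * b2) = b2 * a3 - a2 * b3"
    by (simp add: aff_col_def algebra_simps)
  then show ?R
    by (intro exI[of _ 0] exI[of _ "b1 * a2 - a1 * b2"] exI[of _ "b1 * a3 - a1 * b3"]) simp
next
  assume ?R
  then obtain c1 c2 c3 where "c2 - c1 = b1 * a2 - a1 * b2" "c3 - c1 = b1 * a3 - a1 * b3"
      "c3 - c2 = b2 * a3 - a2 * b3"
    using assms by auto
  moreover have "c3 - c2 = (c3 - c1) - (c2 - c1)" by simp
  ultimately have "b2 * a3 - a2 * b3 = (b1 * a3 - a1 * b3) - (b1 * a2 - a1 * b2)" by metis
  then show "aff_col (a1, b1) (a2, b2) (a3, b3)"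
    by (simp add: aff_col_def algebra_simps)
qed

lemma payne_collineation_semilinear:
  fixes \<kappa> :: "'a::{field,finite} \<times> 'a \<times> 'a \<Rightarrow> 'a \<times> 'a \<times> 'a"
  assumes odd: "(2::'a) \<noteq> 0" and q: "5 \<le> CARD('a)"
    and bij: "bij \<kappa>" and coll: "\<And>y z. payne_coll (\<kappa> y) (\<kappa> z) \<longleftrightarrow> payne_coll y z"
  shows "\<exists>\<sigma> m11 m12 m21 m22 v1 v2 w.
    (\<forall>a b. \<sigma> (a + b) = \<sigma> a + \<sigma> b) \<and> (\<forall>a b. \<sigma> (a * b) = \<sigma> a * \<sigma> b) \<and> \<sigma> 1 = 1 \<and>
    m11 * m22 - m12 * m21 \<noteq> 0 \<and>
    (\<forall>a b c. \<kappa> (a, b, c) = payne_affine m11 m12 m21 m22 v1 v2 w (\<sigma> a, \<sigma> b, \<sigma> c))"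
proof -
  note sf = same_fibre_preserved[OF odd q bij coll]
  define pr where "pr y = (fst y, fst (snd y))" for y :: "'a \<times> 'a \<times> 'a"
  have prs: "pr y = pr z \<longleftrightarrow> same_fibre y z" for y z
    by (cases y; cases z) (simp add: pr_def)
  have pr_simp [simp]: "pr (a, b, c) = (a, b)" for a b c by (simp add: pr_def)
  define \<phi> where "\<phi> v = pr (\<kappa> (fst v, snd v, 0))" for v
  have pk: "pr (\<kappa> (a, b, c)) = \<phi> (a, b)" for a b c
    unfolding \<phi>_def prs by (simp add: sf)
  have inj: "inj \<phi>"
  proof (rule injI)
    fix v w assume "\<phi> v = \<phi> w"
    then show "v = w" unfolding \<phi>_def prs sf by (simp add: prod_eq_iff)
  qed
  then have bij\<phi>: "bij \<phi>" by (simp add: bij_def finite_UNIV_inj_surj)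
  have lift: "(\<exists>c. \<kappa> (a, b, c) = (a', b', c'))" if "\<phi> (a, b) = (a', b')" for a b a' b' c'
  proof -
    obtain d e f where k: "\<kappa> (d, e, f) = (a', b', c')" using bij by (metis bij_pointE surj_pair)
    then have "\<phi> (d, e) = \<phi> (a, b)" using pk[of d e f] that by simp
    then have "(d, e) = (a, b)" using inj by (simp add: inj_eq)
    then show ?thesis using k by auto
  qed
  have col: "aff_col (\<phi> p) (\<phi> q) (\<phi> r) \<longleftrightarrow> aff_col p q r" for p q r
  proof (cases "p \<noteq> q \<and> p \<noteq> r \<and> q \<noteq> r")
    case False
    then have "aff_col p q r" "aff_col (\<phi> p) (\<phi> q) (\<phi> r)"
      by (auto simp: aff_col_def mult.commute)
    then show ?thesis by simp
  next
    case True
    then have d: "\<phi> p \<noteq> \<phi> q" "\<phi> p \<noteq> \<phi> r" "\<phi> q \<noteq> \<phi> r" using inj by (auto simp: inj_eq)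
    obtain a1 b1 a2 b2 a3 b3 where p: "p = (a1, b1)" "q = (a2, b2)" "r = (a3, b3)" by (metis surj_pair)
    obtain x1 y1 x2 y2 x3 y3 where f: "\<phi> p = (x1, y1)" "\<phi> q = (x2, y2)" "\<phi> r = (x3, y3)" by (metis surj_pair)
    have ex: "\<exists>z. \<kappa> (a1, b1, c) = (x1, y1, z)" "\<exists>z. \<kappa> (a2, b2, c) = (x2, y2, z)" "\<exists>z. \<kappa> (a3, b3, c) = (x3, y3, z)" for c
      using pk[of a1 b1 c] pk[of a2 b2 c] pk[of a3 b3 c] f p by (auto simp: pr_def prod_eq_iff)
    have lf: "\<exists>c. \<kappa> (a1, b1, c) = (x1, y1, z)" "\<exists>c. \<kappa> (a2, b2, c) = (x2, y2, z)" "\<exists>c. \<kappa> (a3, b3, c) = (x3, y3, z)" for z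
      using lift f p by auto
    show ?thesis
    proof
      assume "aff_col p q r"
      then obtain c1 c2 c3 where "payne_coll (a1, b1, c1) (a2, b2, c2)" "payne_coll (a1, b1, c1) (a3, b3, c3)"
         "payne_coll (a2, b2, c2) (a3, b3, c3)"
        using aff_col_iff_lift[of a1 b1 a2 b2 a3 b3] True p by auto
      then show "aff_col (\<phi> p) (\<phi> q) (\<phi> r)"
        using aff_col_iff_lift[of x1 y1 x2 y2 x3 y3] d f coll ex by metis
    next
      assume "aff_col (\<phi> p) (\<phi> q) (\<phi> r)"
      then obtain c1 c2 c3 where "payne_coll (x1, y1, c1) (x2, y2, c2)" "payne_coll (x1, y1, c1) (x3, y3, c3)"
         "payne_coll (x2, y2, c2) (x3, y3, c3)"
        using aff_col_iff_lift[of x1 y1 x2 y2 x3 y3] d f by auto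
      then show "aff_col p q r"
        using aff_col_iff_lift[of a1 b1 a2 b2 a3 b3] True p coll lf by metis
    qed
  qed
  obtain \<sigma> m11 m12 m21 m22 v1 v2 where \<sigma>: "\<And>a b. \<sigma> (a + b) = \<sigma> a + \<sigma> b" "\<And>a b. \<sigma> (a * b) = \<sigma> a * \<sigma> b" "\<sigma> 1 = 1"
      and D: "m11 * m22 - m12 * m21 \<noteq> 0"
      and \<phi>: "\<And>a b. \<phi> (a, b) = (m11 * \<sigma> a + m12 * \<sigma> b + v1, m21 * \<sigma> a + m22 * \<sigma> b + v2)"
    using collineation_semiaffine[OF bij\<phi> col] by blast
  have \<sigma>0: "\<sigma> 0 = 0" using \<sigma>(1)[of 0 0] by (metis add.right_neutral add_left_cancel)
  have \<sigma>m: "\<sigma> (a - b) = \<sigma> a - \<sigma> b" for a b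
    using \<sigma>(1)[of "a - b" b] by (simp add: algebra_simps)
  have \<sigma>i: "a = b" if "\<sigma> a = \<sigma> b" for a b
  proof (rule ccontr)
    assume "a \<noteq> b"
    then have "\<sigma> ((a - b) * inverse (a - b)) = 1" using \<sigma>(3) by simp
    then show False using \<sigma>(2) \<sigma>m that by simp
  qed
  define w where "w = snd (snd (\<kappa> (0, 0, 0)))"
  define g where "g = payne_affine m11 m12 m21 m22 v1 v2 w"
  \<comment> \<open>The first two coordinates already agree with those of \<open>g\<close> applied
    to the \<sigma>-image. Since the determinant is nonzero, \<open>g\<close> is bijective in the
    third coordinate, and \<open>F\<close> absorbs what is unknown there.\<close>
  have "\<exists>F. \<forall>y. \<kappa> y = g (\<sigma> (fst y), \<sigma> (fst (snd y)), F y)"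
  proof (rule choice, rule allI)
    fix y :: "'a \<times> 'a \<times> 'a"
    obtain a b c where y: "y = (a, b, c)" by (metis surj_pair)
    obtain x z t where k: "\<kappa> y = (x, z, t)" by (metis surj_pair)
    have xz: "x = m11 * \<sigma> a + m12 * \<sigma> b + v1" "z = m21 * \<sigma> a + m22 * \<sigma> b + v2"
      using pk[of a b c] k y \<phi> by auto
    define u where "u = (t - (((m11 * \<sigma> a + m12 * \<sigma> b) * v2 - (m21 * \<sigma> a + m22 * \<sigma> b) * v1) + w)) / (m11 * m22 - m12 * m21)"
    have "(m11 * m22 - m12 * m21) * u = t - (((m11 * \<sigma> a + m12 * \<sigma> b) * v2 - (m21 * \<sigma> a + m22 * \<sigma> b) * v1) + w)"
      using D by (simp add: u_def)
    then have "\<kappa> y = g (\<sigma> a, \<sigma> b, u)"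
      unfolding k xz g_def by simp
    then show "\<exists>u. \<kappa> y = g (\<sigma> (fst y), \<sigma> (fst (snd y)), u)" using y by auto
  qed
  then obtain F where F: "\<And>a b c. \<kappa> (a, b, c) = g (\<sigma> a, \<sigma> b, F (a, b, c))" by auto
  have F0: "F (0, 0, 0) = 0"
  proof -
    have "w = (m11 * m22 - m12 * m21) * F (0, 0, 0) + w"
      using F[of 0 0 0] unfolding w_def[symmetric] g_def by (simp add: \<sigma>0 w_def prod_eq_iff)
    then show ?thesis using D by simp
  qed
  \<comment> \<open>The deviation from the expected third coordinate. It takes equal values at the
    ends of each isotropic edge, hence is constant, and \<open>w\<close> was chosen to make it 0 at
    the origin.\<close>
  define G where "G y = F y - \<sigma> (snd (snd y))" for y
  have G: "G y = G (0, 0, 0)" for y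
  proof (rule payne_graph_connected[of G])
    fix y z :: "'a \<times> 'a \<times> 'a" assume c: "payne_coll y z" and ns: "\<not> same_fibre y z"
    obtain a b c a' b' c' where y: "y = (a, b, c)" "z = (a', b', c')" by (metis surj_pair)
    have cc: "c' - c = b * a' - a * b'" using c ns y by auto
    have "payne_coll (\<kappa> y) (\<kappa> z)" using c coll by simp
    then have "payne_coll (\<sigma> a, \<sigma> b, F y) (\<sigma> a', \<sigma> b', F z)"
      unfolding y F g_def payne_affine_coll[OF D] by simp
    then have "F z - F y = \<sigma> b * \<sigma> a' - \<sigma> a * \<sigma> b'"
      using ns \<sigma>i y by auto
    also have "\<dots> = \<sigma> (c' - c)" unfolding cc by (simp add: \<sigma>m \<sigma>(2))
    finally have "F z - F y = \<sigma> c' - \<sigma> c" by (simp add: \<sigma>m)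
    then show "G y = G z"
      unfolding G_def by (simp add: y algebra_simps)
  qed
  then have Fc: "F (a, b, c) = \<sigma> c" for a b c
    using G[of "(a, b, c)"] by (simp add: G_def F0 \<sigma>0)
  have k: "\<kappa> (a, b, c) = payne_affine m11 m12 m21 m22 v1 v2 w (\<sigma> a, \<sigma> b, \<sigma> c)" for a b c
    using F Fc unfolding g_def by simp
  show ?thesis
    using \<sigma> D k by (intro exI conjI allI) auto
qed

lemma payne_collineation_linear:
  fixes \<kappa> :: "'a::{field,finite} \<times> 'a \<times> 'a \<Rightarrow> 'a \<times> 'a \<times> 'a"
  assumes p: "prime p" "odd p" and card: "CARD('a) = p ^ h" and q: "5 \<le> CARD('a)" and cop: "coprime p h"
    and bij: "bij \<kappa>" and coll: "\<And>y z. payne_coll (\<kappa> y) (\<kappa> z) \<longleftrightarrow> payne_coll y z"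
    and ord: "\<kappa> ^^ (p ^ n) = id"
  shows "\<exists>m11 m12 m21 m22 v1 v2 w. m11 * m22 - m12 * m21 \<noteq> 0 \<and> \<kappa> = payne_affine m11 m12 m21 m22 v1 v2 w"
proof -
  have "\<not> p dvd 2" using p by (metis dvd_refl primes_dvd_imp_eq two_is_prime_nat)
  then have odd: "(2::'a) \<noteq> 0"
    using of_nat_eq_0_iff_char_dvd[where ?'a = 'a, of 2] CHAR_eq_prime[OF p(1) card] by simp
  obtain \<sigma> m11 m12 m21 m22 v1 v2 w where \<sigma>: "\<And>a b. \<sigma> (a + b) = \<sigma> a + \<sigma> b" "\<And>a b. \<sigma> (a * b) = \<sigma> a * \<sigma> b" "\<sigma> 1 = 1"
      and D: "m11 * m22 - m12 * m21 \<noteq> 0"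
      and k: "\<And>a b c. \<kappa> (a, b, c) = payne_affine m11 m12 m21 m22 v1 v2 w (\<sigma> a, \<sigma> b, \<sigma> c)"
    using payne_collineation_semilinear[OF odd q bij coll] by blast
  have \<sigma>0: "\<sigma> 0 = 0" using \<sigma>(1)[of 0 0] by (metis add.right_neutral add_left_cancel)
  have pw: "(\<sigma> ^^ i) 1 = 1" "(\<sigma> ^^ i) 0 = 0" for i
    by (induction i) (auto simp: \<sigma> \<sigma>0)
  \<comment> \<open>To bound the order of \<sigma> it suffices to follow the first two coordinates;
    the third is left as an unspecified \<open>d\<close>.\<close>
  have "\<exists>A11 A12 A21 A22 B1 B2. \<forall>a b c. \<exists>d. (\<kappa> ^^ i) (a, b, c) =
      (A11 * (\<sigma> ^^ i) a + A12 * (\<sigma> ^^ i) b + B1, A21 * (\<sigma> ^^ i) a + A22 * (\<sigma> ^^ i) b + B2, d)" for i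
  proof (induction i)
    case 0
    show ?case by (rule exI[of _ 1], rule exI[of _ 0], rule exI[of _ 0], rule exI[of _ 1],
        rule exI[of _ 0], rule exI[of _ 0]) auto
  next
    case (Suc i)
    then obtain A11 A12 A21 A22 B1 B2 where A: "\<And>a b c. \<exists>d. (\<kappa> ^^ i) (a, b, c) =
      (A11 * (\<sigma> ^^ i) a + A12 * (\<sigma> ^^ i) b + B1, A21 * (\<sigma> ^^ i) a + A22 * (\<sigma> ^^ i) b + B2, d)" by blast
    show ?case
    proof (rule exI[of _ "m11 * \<sigma> A11 + m12 * \<sigma> A21"], rule exI[of _ "m11 * \<sigma> A12 + m12 * \<sigma> A22"],
        rule exI[of _ "m21 * \<sigma> A11 + m22 * \<sigma> A21"], rule exI[of _ "m21 * \<sigma> A12 + m22 * \<sigma> A22"],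
        rule exI[of _ "m11 * \<sigma> B1 + m12 * \<sigma> B2 + v1"], rule exI[of _ "m21 * \<sigma> B1 + m22 * \<sigma> B2 + v2"],
        intro allI)
      fix a b c
      obtain d where d: "(\<kappa> ^^ i) (a, b, c) =
        (A11 * (\<sigma> ^^ i) a + A12 * (\<sigma> ^^ i) b + B1, A21 * (\<sigma> ^^ i) a + A22 * (\<sigma> ^^ i) b + B2, d)" using A by blast
      show "\<exists>d. (\<kappa> ^^ Suc i) (a, b, c) =
        ((m11 * \<sigma> A11 + m12 * \<sigma> A21) * (\<sigma> ^^ Suc i) a + (m11 * \<sigma> A12 + m12 * \<sigma> A22) * (\<sigma> ^^ Suc i) b + (m11 * \<sigma> B1 + m12 * \<sigma> B2 + v1),
         (m21 * \<sigma> A11 + m22 * \<sigma> A21) * (\<sigma> ^^ Suc i) a + (m21 * \<sigma> A12 + m22 * \<sigma> A22) * (\<sigma> ^^ Suc i) b + (m21 * \<sigma> B1 + m22 * \<sigma> B2 + v2), d)"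
        by (simp add: d k \<sigma>) (simp add: algebra_simps)
    qed
  qed
  then obtain A11 A12 A21 A22 B1 B2 where A: "\<And>a b c. \<exists>d. (\<kappa> ^^ (p ^ n)) (a, b, c) =
      (A11 * (\<sigma> ^^ (p ^ n)) a + A12 * (\<sigma> ^^ (p ^ n)) b + B1, A21 * (\<sigma> ^^ (p ^ n)) a + A22 * (\<sigma> ^^ (p ^ n)) b + B2, d)" by blast
  \<comment> \<open>Evaluation at the origin gives \<open>B1 = 0\<close>, at
    \<open>(1, 0, 0)\<close> then \<open>A11 = 1\<close>, and at \<open>(a, 0, 0)\<close> the
    claim.\<close>
  have "(\<sigma> ^^ (p ^ n)) a = a" for a
    using A[of a 0 0] A[of 1 0 0] A[of 0 0 0] unfolding ord by (auto simp: pw)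
  then have "\<sigma> ^^ (p ^ n) = id" by (simp add: fun_eq_iff)
  then have "\<sigma> a = a" for a
    using field_hom_order_prime_power_trivial[OF p(1) card cop \<sigma>] by blast
  then have "\<kappa> = payne_affine m11 m12 m21 m22 v1 v2 w"
    using k by (auto simp: fun_eq_iff)
  then show ?thesis using D by blast
qed

section \<open>Automorphisms of incidence structures\<close>

text \<open>Restricted to the range because automorphisms are extensional functions; with
  \<open>\<theta>\<close> injective, a coordinate map and its transport then determine each
  other.\<close>

definition transport :: "('c \<Rightarrow> 'p) \<Rightarrow> ('c \<Rightarrow> 'c) \<Rightarrow> 'p \<Rightarrow> 'p" where
  "transport \<theta> \<phi> = restrict (\<lambda>p. \<theta> (\<phi> (inv_into UNIV \<theta> p))) (range \<theta>)"

lemma transport_apply [simp]: "inj \<theta> \<Longrightarrow> transport \<theta> \<phi> (\<theta> v) = \<theta> (\<phi> v)"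
  by (simp add: transport_def)

lemma transport_eqI:
  assumes "inj \<theta>" "f \<in> extensional (range \<theta>)" "\<And>v. f (\<theta> v) = \<theta> (\<phi> v)"
  shows "f = transport \<theta> \<phi>"
  by (rule extensionalityI[of _ "range \<theta>"]) (use assms in \<open>auto simp: transport_def\<close>)

lemma transport_inject [simp]:
  assumes "inj \<theta>"
  shows "transport \<theta> \<phi> = transport \<theta> \<psi> \<longleftrightarrow> \<phi> = \<psi>"
proof
  assume eq: "transport \<theta> \<phi> = transport \<theta> \<psi>"
  have "\<theta> (\<phi> v) = \<theta> (\<psi> v)" for v
    using fun_cong[OF eq, of "\<theta> v"] assms by simp
  then show "\<phi> = \<psi>" using assms by (auto simp: inj_eq)
qed simp

lemma compose_transport:
  assumes "inj \<theta>"
  shows "compose (range \<theta>) (transport \<theta> \<phi>) (transport \<theta> \<psi>) = transport \<theta> (\<phi> \<circ> \<psi>)"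
  by (rule transport_eqI) (use assms in \<open>auto simp: compose_def\<close>)

lemma transport_in_Bij:
  assumes "inj \<theta>"
  shows "transport \<theta> \<phi> \<in> Bij (range \<theta>) \<longleftrightarrow> bij \<phi>"
proof
  assume b: "bij \<phi>"
  have "transport \<theta> \<phi> ` range \<theta> = range \<theta>"
    using assms bij_is_surj[OF b] by (auto simp: image_iff) (metis surjD)
  moreover have "inj_on (transport \<theta> \<phi>) (range \<theta>)"
    using assms bij_is_inj[OF b] by (auto intro!: inj_onI simp: inj_eq)
  ultimately show "transport \<theta> \<phi> \<in> Bij (range \<theta>)"
    by (auto simp: Bij_def bij_betw_def transport_def)
next
  assume b: "transport \<theta> \<phi> \<in> Bij (range \<theta>)"
  then have i: "inj_on (transport \<theta> \<phi>) (range \<theta>)" and s: "transport \<theta> \<phi> ` range \<theta> = range \<theta>"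
    by (auto simp: Bij_def bij_betw_def)
  show "bij \<phi>"
  proof (rule bijI)
    show "inj \<phi>"
    proof (rule injI)
      fix v w assume "\<phi> v = \<phi> w"
      then have "transport \<theta> \<phi> (\<theta> v) = transport \<theta> \<phi> (\<theta> w)" using assms by simp
      then have "\<theta> v = \<theta> w" using i by (auto dest: inj_onD)
      then show "v = w" using assms by (simp add: inj_eq)
    qed
    show "surj \<phi>"
      unfolding surj_def
    proof
      fix w
      have "\<theta> w \<in> transport \<theta> \<phi> ` range \<theta>" using s by auto
      then obtain v where "\<theta> w = \<theta> (\<phi> v)" using assms by auto
      then show "\<exists>v. w = \<phi> v" using assms by (auto simp: inj_eq)
    qed
  qed
qed

lemma Bij_eq_transport:
  assumes "inj \<theta>" "f \<in> Bij (range \<theta>)"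
  obtains \<phi> where "bij \<phi>" "f = transport \<theta> \<phi>"
proof -
  define \<phi> where "\<phi> v = inv_into UNIV \<theta> (f (\<theta> v))" for v
  have "f = transport \<theta> \<phi>"
  proof (rule transport_eqI[OF assms(1)])
    show "f \<in> extensional (range \<theta>)" using assms(2) by (simp add: Bij_def)
    fix v
    have "f (\<theta> v) \<in> range \<theta>" using assms(2) by (auto simp: Bij_def bij_betw_def)
    then show "f (\<theta> v) = \<theta> (\<phi> v)" unfolding \<phi>_def by (simp add: f_inv_into_f)
  qed
  then show ?thesis using that assms transport_in_Bij by metis
qed

lemma automorphisms_Bij: "f \<in> automorphisms S \<Longrightarrow> f \<in> Bij (Points S)"
  by (simp add: automorphisms_def)

lemma automorphism_Points: "f \<in> automorphisms S \<Longrightarrow> p \<in> Points S \<Longrightarrow> f p \<in> Points S"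
  by (auto simp: automorphisms_def Bij_def bij_betw_def)

lemma automorphism_inj: "f \<in> automorphisms S \<Longrightarrow> inj_on f (Points S)"
  by (auto simp: automorphisms_def Bij_def bij_betw_def)

lemma automorphism_surj: "f \<in> automorphisms S \<Longrightarrow> f ` Points S = Points S"
  by (auto simp: automorphisms_def Bij_def bij_betw_def)

lemma automorphism_id: "restrict (\<lambda>p. p) (Points S) \<in> automorphisms S"
  unfolding automorphisms_def
  by (auto intro!: exI[of _ id] simp: id_Bij)

lemma automorphism_compose:
  assumes f: "f \<in> automorphisms S" and g: "g \<in> automorphisms S"
  shows "compose (Points S) f g \<in> automorphisms S"
proof -
  obtain F where F: "bij_betw F (Lines S) (Lines S)"
      "\<forall>p\<in>Points S. \<forall>l\<in>Lines S. Inc S (f p) (F l) \<longleftrightarrow> Inc S p l"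
    using f by (auto simp: automorphisms_def)
  obtain G where G: "bij_betw G (Lines S) (Lines S)"
      "\<forall>p\<in>Points S. \<forall>l\<in>Lines S. Inc S (g p) (G l) \<longleftrightarrow> Inc S p l"
    using g by (auto simp: automorphisms_def)
  have "\<forall>p\<in>Points S. \<forall>l\<in>Lines S. Inc S (compose (Points S) f g p) ((F \<circ> G) l) \<longleftrightarrow> Inc S p l"
    using F(2) G automorphism_Points[OF g] by (auto simp: compose_def bij_betw_apply)
  moreover have "bij_betw (F \<circ> G) (Lines S) (Lines S)"
    using F G bij_betw_trans by blast
  ultimately show ?thesis
    unfolding automorphisms_def using compose_Bij f g automorphisms_Bij by blast
qed

lemma automorphism_inverse:
  assumes f: "f \<in> automorphisms S"
  shows "restrict (inv_into (Points S) f) (Points S) \<in> automorphisms S"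
proof -
  obtain F where F: "bij_betw F (Lines S) (Lines S)"
      "\<forall>p\<in>Points S. \<forall>l\<in>Lines S. Inc S (f p) (F l) \<longleftrightarrow> Inc S p l"
    using f by (auto simp: automorphisms_def)
  let ?g = "restrict (inv_into (Points S) f) (Points S)"
  have "Inc S (?g p) (inv_into (Lines S) F l) \<longleftrightarrow> Inc S p l"
    if p: "p \<in> Points S" and l: "l \<in> Lines S" for p l
  proof -
    have "?g p \<in> Points S" "f (?g p) = p"
      using automorphism_surj[OF f] p by (auto simp: inv_into_into f_inv_into_f)
    moreover have "inv_into (Lines S) F l \<in> Lines S" "F (inv_into (Lines S) F l) = l"
      using F(1) l by (auto simp: bij_betw_def inv_into_into f_inv_into_f)
    ultimately show ?thesis using F(2) by metis
  qed
  then show ?thesis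
    unfolding automorphisms_def
    using restrict_inv_into_Bij[OF automorphisms_Bij[OF f]] bij_betw_inv_into[OF F(1)] by blast
qed

lemma group_aut_group: "group (aut_group S)"
proof -
  interpret B: group "BijGroup (Points S)" by (rule group_BijGroup)
  have "subgroup (automorphisms S) (BijGroup (Points S))"
  proof (rule B.subgroupI)
    show "automorphisms S \<subseteq> carrier (BijGroup (Points S))"
      using automorphisms_Bij by (auto simp: BijGroup_def)
    show "automorphisms S \<noteq> {}" using automorphism_id by blast
  next
    fix f assume f: "f \<in> automorphisms S"
    have fB: "f \<in> Bij (Points S)" using automorphisms_Bij[OF f] .
    have "inv\<^bsub>BijGroup (Points S)\<^esub> f = restrict (inv_into (Points S) f) (Points S)"
      using fB restrict_inv_into_Bij[OF fB] Bij_compose_restrict_eq[OF fB]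
      by (intro B.inv_equality) (auto simp: BijGroup_def)
    then show "inv\<^bsub>BijGroup (Points S)\<^esub> f \<in> automorphisms S"
      using automorphism_inverse[OF f] by simp
  next
    fix f g assume fg: "f \<in> automorphisms S" "g \<in> automorphisms S"
    then show "f \<otimes>\<^bsub>BijGroup (Points S)\<^esub> g \<in> automorphisms S"
      using automorphism_compose[OF fg] fg[THEN automorphisms_Bij] by (simp add: BijGroup_def)
  qed
  then show ?thesis unfolding aut_group_def by (rule B.subgroup_imp_group)
qed

lemma carrier_aut_group [simp]: "carrier (aut_group S) = automorphisms S"
  by (simp add: aut_group_def)

lemma one_aut_group: "\<one>\<^bsub>aut_group S\<^esub> = restrict (\<lambda>p. p) (Points S)"
  by (simp add: aut_group_def BijGroup_def)

lemma mult_aut_group: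
  "f \<in> automorphisms S \<Longrightarrow> g \<in> automorphisms S \<Longrightarrow> f \<otimes>\<^bsub>aut_group S\<^esub> g = compose (Points S) f g"
  by (simp add: aut_group_def BijGroup_def automorphisms_Bij)

lemma mult_aut_group_transport:
  assumes "inj \<theta>" "Points S = range \<theta>"
    and "transport \<theta> \<phi> \<in> automorphisms S" "transport \<theta> \<psi> \<in> automorphisms S"
  shows "transport \<theta> \<phi> \<otimes>\<^bsub>aut_group S\<^esub> transport \<theta> \<psi> = transport \<theta> (\<phi> \<circ> \<psi>)"
  using assms by (simp add: mult_aut_group compose_transport)

lemma one_aut_group_transport:
  assumes "inj \<theta>" "Points S = range \<theta>"
  shows "\<one>\<^bsub>aut_group S\<^esub> = transport \<theta> id"
  unfolding one_aut_group by (rule transport_eqI) (use assms in auto)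

lemma automorphism_collinear:
  assumes f: "f \<in> automorphisms S" and "y \<in> Points S" "z \<in> Points S"
  shows "collinear_in S (f y) (f z) \<longleftrightarrow> collinear_in S y z"
proof -
  obtain F where F: "bij_betw F (Lines S) (Lines S)"
      "\<forall>p\<in>Points S. \<forall>l\<in>Lines S. Inc S (f p) (F l) \<longleftrightarrow> Inc S p l"
    using f by (auto simp: automorphisms_def)
  have "F ` Lines S = Lines S" using F(1) by (simp add: bij_betw_def)
  then have "collinear_in S (f y) (f z) \<longleftrightarrow> (\<exists>l\<in>F ` Lines S. Inc S (f y) l \<and> Inc S (f z) l)"
    by (simp add: collinear_in_def)
  then show ?thesis unfolding collinear_in_def using F(2) assms by simp
qed

lemma automorphism_perp:
  assumes f: "f \<in> automorphisms S" and A: "A \<subseteq> Points S"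
  shows "f ` perp S A = perp S (f ` A)"
proof (intro equalityI subsetI)
  fix y assume "y \<in> f ` perp S A"
  then show "y \<in> perp S (f ` A)"
    using A automorphism_Points[OF f] automorphism_collinear[OF f] by (fastforce simp: perp_def)
next
  fix y assume y: "y \<in> perp S (f ` A)"
  then have "y \<in> f ` Points S" using automorphism_surj[OF f] by (simp add: perp_def)
  then obtain y' where y': "y' \<in> Points S" "y = f y'" by blast
  then have "y' \<in> perp S A"
    using y A automorphism_collinear[OF f] by (fastforce simp: perp_def)
  then show "y \<in> f ` perp S A" using y' by blast
qed

lemma perp_subset: "perp S A \<subseteq> Points S"
  by (auto simp: perp_def)

lemma automorphism_image_line:
  assumes f: "f \<in> automorphisms S" and Inc: "Inc S = (\<in>)" and sub: "\<And>l. l \<in> Lines S \<Longrightarrow> l \<subseteq> Points S"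
    and l: "l \<in> Lines S"
  shows "f ` l \<in> Lines S"
proof -
  obtain F where F: "bij_betw F (Lines S) (Lines S)"
      "\<forall>p\<in>Points S. \<forall>l\<in>Lines S. Inc S (f p) (F l) \<longleftrightarrow> Inc S p l"
    using f by (auto simp: automorphisms_def)
  have Fl: "F l \<in> Lines S" using F(1) l bij_betw_apply by metis
  have "f ` l = F l"
  proof (intro equalityI subsetI)
    fix y assume "y \<in> f ` l"
    then show "y \<in> F l" using F(2) l sub[OF l] by (auto simp: Inc)
  next
    fix y assume y: "y \<in> F l"
    then obtain y' where "y' \<in> Points S" "y = f y'" using sub[OF Fl] automorphism_surj[OF f] by blast
    then show "y \<in> f ` l" using F(2) l y by (auto simp: Inc)
  qed
  then show ?thesis using Fl by simp
qed

lemma automorphismI: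
  assumes "f \<in> Bij (Points S)" and "finite (Lines S)" and "inj_on F (Lines S)"
    and "\<And>l. l \<in> Lines S \<Longrightarrow> F l \<in> Lines S"
    and "\<And>p l. p \<in> Points S \<Longrightarrow> l \<in> Lines S \<Longrightarrow> Inc S (f p) (F l) \<longleftrightarrow> Inc S p l"
  shows "f \<in> automorphisms S"
proof -
  have "F ` Lines S = Lines S"
    by (rule endo_inj_surj) (use assms in auto)
  then show ?thesis
    using assms unfolding automorphisms_def bij_betw_def by blast
qed

section \<open>Restriction to the derived quadrangle, and Singer groups in coordinates\<close>

lemma point_stabilizer_payne_Points:
  assumes f: "f \<in> point_stabilizer S x" and x: "x \<in> Points S"
  shows "f ` Points (payne_derived S x) = Points (payne_derived S x)"
proof -
  have fa: "f \<in> automorphisms S" and fx: "f x = x" using f by (auto simp: point_stabilizer_def)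
  have c: "collinear_in S x (f y) \<longleftrightarrow> collinear_in S x y" if "y \<in> Points S" for y
    using automorphism_collinear[OF fa x that] fx by simp
  show ?thesis
  proof (intro equalityI subsetI)
    fix y assume "y \<in> f ` Points (payne_derived S x)"
    then show "y \<in> Points (payne_derived S x)"
      using c automorphism_Points[OF fa] by (auto simp: payne_derived_def)
  next
    fix y assume y: "y \<in> Points (payne_derived S x)"
    then obtain y' where "y' \<in> Points S" "y = f y'"
      using automorphism_surj[OF fa] by (auto simp: payne_derived_def)
    then show "y \<in> f ` Points (payne_derived S x)" using y c by (auto simp: payne_derived_def)
  qed
qed

text \<open>Each of the two kinds of lines is mapped to itself: \<open>f\<close> permutes the lines
  missing \<open>x\<close>, and since it commutes with \<open>perp\<close> it carries the hyperbolic
  line of \<open>x\<close>, \<open>r\<close> to that of \<open>x\<close>,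
  \<open>f r\<close>.\<close>

lemma induced_on_payne_automorphism:
  fixes S :: "('p, 'p set) incidence_structure"
  assumes f: "f \<in> point_stabilizer S x" and x: "x \<in> Points S" and fin: "finite (Points S)"
    and Inc: "Inc S = (\<in>)" and sub: "\<And>l. l \<in> Lines S \<Longrightarrow> l \<subseteq> Points S"
  shows "induced_on_payne S x f \<in> automorphisms (payne_derived S x)"
proof -
  have fa: "f \<in> automorphisms S" and fx: "f x = x" using f by (auto simp: point_stabilizer_def)
  have inj: "inj_on f (Points S)" using automorphism_inj[OF fa] .
  let ?P = "payne_derived S x"
  have PS: "Points ?P \<subseteq> Points S" by (auto simp: payne_derived_def)
  have LS: "l \<subseteq> Points S" if "l \<in> Lines ?P" for l
    using that sub perp_subset by (fastforce simp: payne_derived_def)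
  have IncP: "Inc ?P = (\<in>)" by (simp add: payne_derived_def)
  show ?thesis
  proof (rule automorphismI[where F = "\<lambda>l. f ` l"])
    have "inj_on f (Points ?P)" using inj PS inj_on_subset by blast
    then show "induced_on_payne S x f \<in> Bij (Points ?P)"
      using point_stabilizer_payne_Points[OF f x]
      by (auto simp: induced_on_payne_def Bij_def bij_betw_def inj_on_restrict_eq)
    show "finite (Lines ?P)"
      by (rule finite_subset[of _ "Pow (Points S)"]) (use LS fin in auto)
    show "inj_on ((`) f) (Lines ?P)"
      using LS inj by (intro inj_onI) (metis inj_on_image_eq_iff)
  next
    fix l assume "l \<in> Lines ?P"
    then consider "l \<in> Lines S" "x \<notin> l"
      | r where "r \<in> Points S" "\<not> collinear_in S x r" "l = perp S (perp S {x, r}) - {x}"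
      by (auto simp: payne_derived_def)
    then show "f ` l \<in> Lines ?P"
    proof cases
      case 1
      have "x \<notin> f ` l"
      proof
        assume "x \<in> f ` l"
        then obtain y where "y \<in> l" "f y = f x" using fx by auto
        then show False using inj 1 sub x by (metis inj_onD subsetD)
      qed
      then show ?thesis
        using automorphism_image_line[OF fa Inc sub] 1 by (auto simp: payne_derived_def)
    next
      case 2
      have "f ` (perp S (perp S {x, r}) - {x}) = f ` perp S (perp S {x, r}) - f ` {x}"
        by (rule inj_on_image_set_diff[OF inj]) (use x in \<open>auto simp: perp_def\<close>)
      also have "\<dots> = perp S (perp S {x, f r}) - {x}"
        using 2 x fx by (simp add: automorphism_perp[OF fa perp_subset] automorphism_perp[OF fa])
      finally have "f ` l = perp S (perp S {x, f r}) - {x}" using 2 by simp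
      moreover have "f r \<in> Points S" "\<not> collinear_in S x (f r)"
        using 2 x automorphism_Points[OF fa] automorphism_collinear[OF fa, of x r] fx by auto
      ultimately show ?thesis by (auto simp: payne_derived_def)
    qed
  next
    fix p l assume "p \<in> Points ?P" "l \<in> Lines ?P"
    then show "Inc ?P (induced_on_payne S x f p) (f ` l) \<longleftrightarrow> Inc ?P p l"
      using PS LS inj by (simp add: IncP induced_on_payne_def) (metis inj_on_image_mem_iff subsetD)
  qed
qed

lemma singer_group_transportD:
  assumes \<theta>: "inj \<theta>" "Points S = range \<theta>" and K: "singer_group S K"
  obtains K' where "K = transport \<theta> ` K'" "\<And>\<kappa>. \<kappa> \<in> K' \<Longrightarrow> bij \<kappa>"
    "\<And>\<kappa> \<kappa>'. \<kappa> \<in> K' \<Longrightarrow> \<kappa>' \<in> K' \<Longrightarrow> \<kappa> \<circ> \<kappa>' \<in> K'"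
    "\<And>y z. \<exists>!\<kappa>. \<kappa> \<in> K' \<and> \<kappa> y = z"
proof (rule that)
  let ?K' = "{\<kappa>. transport \<theta> \<kappa> \<in> K}"
  interpret subgroup K "aut_group S" using K by (simp add: singer_group_def)
  have KA: "K \<subseteq> automorphisms S" using subset by simp
  show eq: "K = transport \<theta> ` ?K'"
  proof (intro equalityI subsetI)
    fix k assume k: "k \<in> K"
    then have "k \<in> Bij (Points S)" using KA by (intro automorphisms_Bij) blast
    then have "k \<in> Bij (range \<theta>)" unfolding \<theta>(2) .
    then obtain \<phi> where "k = transport \<theta> \<phi>" using Bij_eq_transport[OF \<theta>(1)] by blast
    then show "k \<in> transport \<theta> ` ?K'" using k by blast
  qed auto
  show "bij \<kappa>" if "\<kappa> \<in> ?K'" for \<kappa>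
  proof -
    have "transport \<theta> \<kappa> \<in> Bij (Points S)" using that KA by (intro automorphisms_Bij) blast
    then show ?thesis unfolding \<theta>(2) transport_in_Bij[OF \<theta>(1)] .
  qed
  show "\<kappa> \<circ> \<kappa>' \<in> ?K'" if k: "\<kappa> \<in> ?K'" "\<kappa>' \<in> ?K'" for \<kappa> \<kappa>'
  proof -
    have "transport \<theta> \<kappa> \<otimes>\<^bsub>aut_group S\<^esub> transport \<theta> \<kappa>' \<in> K" using k by (intro m_closed) simp_all
    then show ?thesis using mult_aut_group_transport[OF \<theta>, of \<kappa> \<kappa>'] k KA by (simp add: subset_iff)
  qed
  show "\<exists>!\<kappa>. \<kappa> \<in> ?K' \<and> \<kappa> y = z" for y z
  proof -
    have "\<theta> y \<in> Points S" "\<theta> z \<in> Points S" using \<theta>(2) by auto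
    then have ex: "\<exists>!k. k \<in> K \<and> k (\<theta> y) = \<theta> z"
      using K unfolding singer_group_def sharply_transitive_on_def by blast
    then obtain k where k: "k \<in> K" "k (\<theta> y) = \<theta> z" by blast
    then obtain \<kappa> where "\<kappa> \<in> ?K'" "k = transport \<theta> \<kappa>"
      using eq by blast
    then have \<kappa>: "\<kappa> \<in> ?K'" "\<kappa> y = z" using k(2) \<theta>(1) by (simp_all add: inj_eq)
    show ?thesis
    proof (rule ex1I[of _ \<kappa>])
      fix \<kappa>' assume "\<kappa>' \<in> ?K' \<and> \<kappa>' y = z"
      then have "transport \<theta> \<kappa>' = transport \<theta> \<kappa>" using ex \<kappa> \<theta>(1) by (metis mem_Collect_eq transport_apply)
      then show "\<kappa>' = \<kappa>" using \<theta>(1) by simp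
    qed (use \<kappa> in simp)
  qed
qed

text \<open>Identity and inverses come for free: a composition-closed sharply transitive set of
  bijections is a group.\<close>

lemma singer_group_transportI:
  assumes \<theta>: "inj \<theta>" "Points S = range \<theta>"
    and aut: "\<And>\<kappa>. \<kappa> \<in> K' \<Longrightarrow> transport \<theta> \<kappa> \<in> automorphisms S"
    and closed: "\<And>\<kappa> \<kappa>'. \<kappa> \<in> K' \<Longrightarrow> \<kappa>' \<in> K' \<Longrightarrow> \<kappa> \<circ> \<kappa>' \<in> K'"
    and trans: "\<And>y z. \<exists>!\<kappa>. \<kappa> \<in> K' \<and> \<kappa> y = z"
  shows "singer_group S (transport \<theta> ` K')"
proof -
  interpret G: group "aut_group S" by (rule group_aut_group)
  \<comment> \<open>\<open>\<kappa>\<close> and its square agree at \<open>y\<close>, so sharpness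
    makes \<open>\<kappa>\<close> idempotent, and an injective idempotent map is the
    identity.\<close>
  have fixid: "\<kappa> = id" if "\<kappa> \<in> K'" "\<kappa> y = y" for \<kappa> y
  proof -
    have "\<kappa> \<circ> \<kappa> = \<kappa>" using trans[of y y] closed that by (metis comp_apply)
    moreover have "inj \<kappa>"
      using aut that \<theta> automorphisms_Bij transport_in_Bij bij_is_inj by metis
    ultimately show ?thesis by (auto simp: fun_eq_iff inj_eq)
  qed
  have "subgroup (transport \<theta> ` K') (aut_group S)"
  proof (rule G.subgroupI)
    show "transport \<theta> ` K' \<subseteq> carrier (aut_group S)" using aut by auto
    show "transport \<theta> ` K' \<noteq> {}" using trans by blast
  next
    fix f assume "f \<in> transport \<theta> ` K'"
    then obtain \<kappa> where \<kappa>: "\<kappa> \<in> K'" "f = transport \<theta> \<kappa>" by blast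
    fix y0 :: 'a
    obtain \<kappa>' where \<kappa>': "\<kappa>' \<in> K'" "\<kappa>' (\<kappa> y0) = y0" using trans by blast
    have "\<kappa>' \<circ> \<kappa> = id" using fixid[of "\<kappa>' \<circ> \<kappa>" y0] closed \<kappa> \<kappa>' by simp
    then have "inv\<^bsub>aut_group S\<^esub> f = transport \<theta> \<kappa>'"
      using \<kappa> \<kappa>' aut
      by (intro G.inv_equality)
         (auto simp: mult_aut_group_transport[OF \<theta>] one_aut_group_transport[OF \<theta>])
    then show "inv\<^bsub>aut_group S\<^esub> f \<in> transport \<theta> ` K'" using \<kappa>' by blast
  next
    fix f g assume "f \<in> transport \<theta> ` K'" "g \<in> transport \<theta> ` K'"
    then show "f \<otimes>\<^bsub>aut_group S\<^esub> g \<in> transport \<theta> ` K'"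
      using closed aut by (auto simp: mult_aut_group_transport[OF \<theta>])
  qed
  moreover have "sharply_transitive_on (transport \<theta> ` K') (Points S)"
    unfolding sharply_transitive_on_def
  proof (intro ballI)
    fix y z assume "y \<in> Points S" "z \<in> Points S"
    then obtain v w where vw: "y = \<theta> v" "z = \<theta> w" using \<theta> by auto
    obtain \<kappa> where \<kappa>: "\<kappa> \<in> K'" "\<kappa> v = w" using trans by blast
    show "\<exists>!k. k \<in> transport \<theta> ` K' \<and> k y = z"
    proof (rule ex1I[of _ "transport \<theta> \<kappa>"])
      fix k assume "k \<in> transport \<theta> ` K' \<and> k y = z"
      then obtain \<kappa>' where "\<kappa>' \<in> K'" "k = transport \<theta> \<kappa>'" "\<kappa>' v = w" using vw \<theta>(1) by (auto simp: inj_eq)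
      then show "k = transport \<theta> \<kappa>" using trans[of v w] \<kappa> by auto
    qed (use \<kappa> vw \<theta>(1) in auto)
  qed
  ultimately show ?thesis by (simp add: singer_group_def)
qed

section \<open>Elations of a coordinatized affine plane\<close>

definition completion_extension ::
  "('p, 'l) incidence_structure \<Rightarrow> ('p \<Rightarrow> 'p) \<Rightarrow> ('l \<Rightarrow> 'l) \<Rightarrow> 'p + 'l set \<Rightarrow> 'p + 'l set" where
  "completion_extension E f G = restrict (map_sum f ((`) G)) (Points (completion E))"

lemma parallel_class_subset: "parallel_class E l \<subseteq> Lines E"
  by (auto simp: parallel_class_def)

lemma mem_parallel_class: "l \<in> Lines E \<Longrightarrow> l \<in> parallel_class E l"
  by (simp add: parallel_class_def)

lemma image_parallel_class:
  assumes f: "bij_betw f (Points E) (Points E)" and G: "bij_betw G (Lines E) (Lines E)"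
    and inc: "\<And>p l. p \<in> Points E \<Longrightarrow> l \<in> Lines E \<Longrightarrow> Inc E (f p) (G l) \<longleftrightarrow> Inc E p l"
    and l: "l \<in> Lines E"
  shows "G ` parallel_class E l = parallel_class E (G l)"
proof -
  have dis: "(\<exists>p\<in>Points E. Inc E p (G l) \<and> Inc E p (G m)) \<longleftrightarrow> (\<exists>p\<in>Points E. Inc E p l \<and> Inc E p m)"
    if "m \<in> Lines E" for m
  proof -
    have "f ` Points E = Points E" using f by (simp add: bij_betw_def)
    then have "(\<exists>p\<in>Points E. Inc E p (G l) \<and> Inc E p (G m)) \<longleftrightarrow>
        (\<exists>p\<in>f ` Points E. Inc E p (G l) \<and> Inc E p (G m))" by simp
    then show ?thesis using inc l that by simp
  qed
  have inj: "inj_on G (Lines E)" and surj: "G ` Lines E = Lines E" using G by (auto simp: bij_betw_def)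
  show ?thesis
  proof (intro equalityI subsetI)
    fix m assume "m \<in> G ` parallel_class E l"
    then obtain m' where m': "m' \<in> parallel_class E l" "m = G m'" by blast
    then have "m' \<in> Lines E" by (simp add: parallel_class_def)
    then show "m \<in> parallel_class E (G l)"
      using m' dis surj by (auto simp: parallel_class_def)
  next
    fix m assume m: "m \<in> parallel_class E (G l)"
    then have "m \<in> G ` Lines E" using surj by (simp add: parallel_class_def)
    then obtain m' where m': "m' \<in> Lines E" "m = G m'" by blast
    then have "m' \<in> parallel_class E l"
      using m dis inj l by (auto simp: parallel_class_def inj_on_eq_iff)
    then show "m \<in> G ` parallel_class E l" using m' by blast
  qed
qed

lemma completion_extension_automorphism:
  assumes f: "bij_betw f (Points E) (Points E)" and G: "bij_betw G (Lines E) (Lines E)"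
    and inc: "\<And>p l. p \<in> Points E \<Longrightarrow> l \<in> Lines E \<Longrightarrow> Inc E (f p) (G l) \<longleftrightarrow> Inc E p l"
  shows "completion_extension E f G \<in> automorphisms (completion E)"
proof -
  let ?X = "Points (completion E)"
  have X: "?X = Inl ` Points E \<union> Inr ` points_at_infinity E" by (simp add: completion_def)
  have injG: "inj_on G (Lines E)" and surjG: "G ` Lines E = Lines E" using G by (auto simp: bij_betw_def)
  have sub: "c \<subseteq> Lines E" if "c \<in> points_at_infinity E" for c
    using that parallel_class_subset by (fastforce simp: points_at_infinity_def)
  have im: "(`) G ` points_at_infinity E = points_at_infinity E"
  proof -
    have "(`) G ` points_at_infinity E = (\<lambda>l. parallel_class E (G l)) ` Lines E"
      unfolding points_at_infinity_def image_image
      by (rule image_cong) (use image_parallel_class[OF f G inc] in auto)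
    also have "\<dots> = parallel_class E ` (G ` Lines E)" by (simp add: image_image)
    finally show ?thesis by (simp add: surjG points_at_infinity_def)
  qed
  have "map_sum f ((`) G) ` ?X = Inl ` (f ` Points E) \<union> Inr ` ((`) G ` points_at_infinity E)"
    unfolding X image_Un image_image by simp
  then have surj: "map_sum f ((`) G) ` ?X = ?X"
    unfolding im using f by (simp add: X bij_betw_def)
  have inj: "inj_on (map_sum f ((`) G)) ?X"
  proof (rule inj_onI)
    fix y z assume yz: "y \<in> ?X" "z \<in> ?X" and eq: "map_sum f ((`) G) y = map_sum f ((`) G) z"
    show "y = z"
    proof (cases y)
      case (Inl p)
      then show ?thesis using yz eq f by (cases z) (auto simp: X bij_betw_def inj_on_eq_iff)
    next
      case (Inr c)
      then show ?thesis using yz eq sub inj_on_image_eq_iff[OF injG] by (cases z) (auto simp: X)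
    qed
  qed
  have bij: "completion_extension E f G \<in> Bij ?X"
    using surj inj by (simp add: completion_extension_def Bij_def bij_betw_def inj_on_restrict_eq)
  have lines: "bij_betw (map_option G) (Lines (completion E)) (Lines (completion E))"
  proof -
    have "map_option G ` (Some ` Lines E) = Some ` (G ` Lines E)" by (simp add: image_image)
    then show ?thesis
      using injG surjG by (auto simp: bij_betw_def completion_def inj_on_def)
  qed
  have "Inc (completion E) (completion_extension E f G p) (map_option G l) \<longleftrightarrow> Inc (completion E) p l"
    if p: "p \<in> ?X" and l: "l \<in> Lines (completion E)" for p l
  proof -
    have Incc: "Inc (completion E) = completion_inc E" by (simp add: completion_def)
    have e: "completion_extension E f G p = map_sum f ((`) G) p"
      using p by (simp add: completion_extension_def)
    show ?thesis
    proof (cases p)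
      case (Inl a)
      then show ?thesis using p l inc unfolding e Incc by (cases l) (auto simp: X completion_def)
    next
      case (Inr c)
      then have c: "c \<subseteq> Lines E" using p sub by (auto simp: X)
      show ?thesis
      proof (cases l)
        case (Some m)
        then have "m \<in> Lines E" using l by (auto simp: completion_def)
        then show ?thesis
          using Inr Some c injG unfolding e Incc by (simp add: inj_on_image_mem_iff)
      qed (use Inr e Incc in simp)
    qed
  qed
  then show ?thesis using bij lines unfolding automorphisms_def by blast
qed

section \<open>Planes with coordinates, and their shears\<close>

definition line_pts :: "('p, 'l) incidence_structure \<Rightarrow> ('c \<Rightarrow> 'p) \<Rightarrow> 'l \<Rightarrow> 'c set" where
  "line_pts E \<theta> l = {v. Inc E (\<theta> v) l}"

definition vertical :: "'a \<Rightarrow> ('a \<times> 'a) set" where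
  "vertical a = {v. fst v = a}"

definition sloped :: "'a::field \<Rightarrow> 'a \<Rightarrow> ('a \<times> 'a) set" where
  "sloped k n = {v. snd v = k * fst v + n}"

text \<open>These turn out to be the elements of \<open>H\<close> at the vertical point at infinity:
  \<open>t = 0\<close> gives the translations and \<open>s = 0\<close> the elations with that
  centre.\<close>

fun shear :: "'a::field \<Rightarrow> 'a \<Rightarrow> 'a \<Rightarrow> 'a \<times> 'a \<Rightarrow> 'a \<times> 'a" where
  "shear s t u (a, b) = (a + s, b + t * a + u)"

lemma shear_comp: "shear s' t' u' \<circ> shear s t u = shear (s + s') (t + t') (u + u' + t' * s)"
  by (auto simp: fun_eq_iff algebra_simps)

lemma shear_0 [simp]: "shear 0 0 0 = id"
  by (auto simp: fun_eq_iff)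

lemma shear_inject [simp]: "shear s t u = shear s' t' u' \<longleftrightarrow> s = s' \<and> t = t' \<and> u = u'"
proof
  assume eq: "shear s t u = shear s' t' u'"
  show "s = s' \<and> t = t' \<and> u = u'"
    using fun_cong[OF eq, of "(0, 0)"] fun_cong[OF eq, of "(1, 0)"] by auto
qed simp

lemma bij_shear: "bij (shear s t u)"
proof (rule o_bij[of "shear (- s) (- t) (t * s - u)"])
  show "shear (- s) (- t) (t * s - u) \<circ> shear s t u = id"
    unfolding shear_comp by (simp add: fun_eq_iff algebra_simps)
  show "shear s t u \<circ> shear (- s) (- t) (t * s - u) = id"
    unfolding shear_comp by (simp add: fun_eq_iff algebra_simps)
qed

lemma shear_vertical: "shear s t u v \<in> vertical (a + s) \<longleftrightarrow> v \<in> vertical a"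
  by (cases v) (auto simp: vertical_def)

lemma shear_sloped: "shear s t u v \<in> sloped (k + t) (n + u - (k + t) * s) \<longleftrightarrow> v \<in> sloped k n"
  by (cases v) (auto simp: sloped_def algebra_simps)

text \<open>The lines of the plane at \<open>x\<close> are points of the symplectic quadrangle, not
  sets of points of the plane, so lines stay abstract here and \<open>line_eqI\<close> recovers a
  line from its coordinate set.\<close>

locale coord_plane =
  fixes E :: "('p, 'l) incidence_structure" and \<theta> :: "'a::{field,finite} \<times> 'a \<Rightarrow> 'p"
  assumes inj: "inj \<theta>" and Points: "Points E = range \<theta>"
    and line_cases: "\<And>l. l \<in> Lines E \<Longrightarrow> (\<exists>a. line_pts E \<theta> l = vertical a) \<or> (\<exists>k n. line_pts E \<theta> l = sloped k n)"
    and ex_vertical: "\<And>a. \<exists>l\<in>Lines E. line_pts E \<theta> l = vertical a"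
    and ex_sloped: "\<And>k n. \<exists>l\<in>Lines E. line_pts E \<theta> l = sloped k n"
    and line_eqI: "\<And>l m. l \<in> Lines E \<Longrightarrow> m \<in> Lines E \<Longrightarrow> line_pts E \<theta> l = line_pts E \<theta> m \<Longrightarrow> l = m"

abbreviation (in coord_plane) "pts \<equiv> line_pts E \<theta>"
abbreviation (in coord_plane) "tr \<equiv> transport \<theta>"

definition (in coord_plane) "vclass = {l \<in> Lines E. \<exists>a. pts l = vertical a}"
definition (in coord_plane) "sclass k = {l \<in> Lines E. \<exists>n. pts l = sloped k n}"

lemma (in coord_plane) Inc_pts: "Inc E (\<theta> v) l \<longleftrightarrow> v \<in> pts l"
  by (simp add: line_pts_def)

lemma (in coord_plane) finite_Lines: "finite (Lines E)"
proof (rule finite_imageD[of pts])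
  show "inj_on pts (Lines E)" using line_eqI by (auto intro: inj_onI)
qed simp

lemma vertical_eq_iff: "vertical a = vertical a' \<longleftrightarrow> a = a'"
proof
  assume eq: "vertical a = vertical a'"
  have "(a, a) \<in> vertical a" by (simp add: vertical_def)
  then show "a = a'" unfolding eq by (simp add: vertical_def)
qed simp

lemma vertical_ne_sloped: "vertical a \<noteq> sloped k (n::'a::field)"
proof
  assume eq: "vertical a = sloped k n"
  have "(a, k * a + n) \<in> sloped k n" "(a, k * a + n + 1) \<in> vertical a"
    by (auto simp: vertical_def sloped_def)
  then show False using eq by (auto simp: sloped_def)
qed

lemma sloped_eq_iff: "sloped k n = sloped k' (n'::'a::field) \<longleftrightarrow> k = k' \<and> n = n'"
proof
  assume eq: "sloped k n = sloped k' n'"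
  have "(0, n) \<in> sloped k n" "(1, k + n) \<in> sloped k n" by (auto simp: sloped_def)
  then show "k = k' \<and> n = n'" unfolding eq by (auto simp: sloped_def)
qed simp

lemma (in coord_plane) mem_parallel_class_iff:
  assumes "l \<in> Lines E"
  shows "m \<in> parallel_class E l \<longleftrightarrow> m \<in> Lines E \<and> (m = l \<or> pts l \<inter> pts m = {})"
  using assms by (auto simp: parallel_class_def Points line_pts_def)

lemma (in coord_plane) parallel_class_vertical:
  assumes l: "l \<in> Lines E" and a: "pts l = vertical a"
  shows "parallel_class E l = vclass"
proof (intro equalityI subsetI)
  fix m assume m: "m \<in> parallel_class E l"
  then have mL: "m \<in> Lines E" by (simp add: parallel_class_def)
  show "m \<in> vclass"
  proof (rule ccontr)
    assume "m \<notin> vclass"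
    then obtain k n where kn: "pts m = sloped k n" using line_cases[OF mL] mL by (auto simp: vclass_def)
    then have "(a, k * a + n) \<in> pts l \<inter> pts m" using a by (simp add: vertical_def sloped_def)
    moreover have "m \<noteq> l" using kn a vertical_ne_sloped by metis
    ultimately show False using m mem_parallel_class_iff[OF l] by blast
  qed
next
  fix m assume m: "m \<in> vclass"
  then obtain a' where a': "m \<in> Lines E" "pts m = vertical a'" by (auto simp: vclass_def)
  then have "m = l \<or> pts l \<inter> pts m = {}"
    using line_eqI[of m l] l a by (cases "a = a'") (auto simp: vertical_def)
  then show "m \<in> parallel_class E l" using mem_parallel_class_iff[OF l] a' by blast
qed

lemma (in coord_plane) parallel_class_sloped:
  assumes l: "l \<in> Lines E" and a: "pts l = sloped k n"
  shows "parallel_class E l = sclass k"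
proof (intro equalityI subsetI)
  fix m assume m: "m \<in> parallel_class E l"
  then have mL: "m \<in> Lines E" by (simp add: parallel_class_def)
  have dis: "m = l \<or> pts l \<inter> pts m = {}" using m mem_parallel_class_iff[OF l] by blast
  show "m \<in> sclass k"
  proof (rule ccontr)
    assume nm: "m \<notin> sclass k"
    then have ml: "m \<noteq> l" using l a by (auto simp: sclass_def)
    from line_cases[OF mL] have "pts l \<inter> pts m \<noteq> {}"
    proof (elim disjE exE)
      fix a' assume "pts m = vertical a'"
      then have "(a', k * a' + n) \<in> pts l \<inter> pts m" using a by (simp add: vertical_def sloped_def)
      then show ?thesis by blast
    next
      fix k' n' assume m': "pts m = sloped k' n'"
      then have kk: "k - k' \<noteq> 0" using nm mL by (auto simp: sclass_def)
      define z where "z = (n' - n) / (k - k')"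
      have "z * (k - k') = n' - n" using kk by (simp add: z_def)
      then have "k * z + n = k' * z + n'" by (simp add: algebra_simps)
      then have "(z, k * z + n) \<in> pts l \<inter> pts m" using a m' by (simp add: sloped_def)
      then show ?thesis by blast
    qed
    then show False using dis ml by blast
  qed
next
  fix m assume m: "m \<in> sclass k"
  then obtain n' where n': "m \<in> Lines E" "pts m = sloped k n'" by (auto simp: sclass_def)
  then have "m = l \<or> pts l \<inter> pts m = {}"
    using line_eqI[of m l] l a by (cases "n = n'") (auto simp: sloped_def)
  then show "m \<in> parallel_class E l" using mem_parallel_class_iff[OF l] n' by blast
qed

lemma (in coord_plane) points_at_infinity_eq: "points_at_infinity E = insert vclass (range sclass)"
proof (intro equalityI subsetI)
  fix c assume "c \<in> points_at_infinity E"
  then obtain l where l: "l \<in> Lines E" "c = parallel_class E l" by (auto simp: points_at_infinity_def)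
  then show "c \<in> insert vclass (range sclass)"
    using line_cases[OF l(1)] parallel_class_vertical[OF l(1)] parallel_class_sloped[OF l(1)] by auto
next
  fix c assume c: "c \<in> insert vclass (range sclass)"
 obtain l where "l \<in> Lines E" "parallel_class E l = vclass"
    using ex_vertical[of 0] parallel_class_vertical by blast
  moreover obtain m where "m k \<in> Lines E" "parallel_class E (m k) = sclass k" for k
    using ex_sloped[of _ 0] parallel_class_sloped by metis
  ultimately have "vclass \<in> points_at_infinity E" "sclass k \<in> points_at_infinity E" for k
    unfolding points_at_infinity_def by (metis imageI)+
  with c show "c \<in> points_at_infinity E" by auto
qed

lemma (in coord_plane) shear_line_map:
  "\<exists>G. bij_betw G (Lines E) (Lines E) \<and>
    (\<forall>l\<in>Lines E. \<forall>v. shear s t u v \<in> pts (G l) \<longleftrightarrow> v \<in> pts l) \<and>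
    (\<forall>l\<in>Lines E. \<forall>a. pts l = vertical a \<longrightarrow> pts (G l) = vertical (a + s)) \<and>
    (\<forall>l\<in>Lines E. \<forall>k n. pts l = sloped k n \<longrightarrow> pts (G l) = sloped (k + t) (n + u - (k + t) * s))"
proof -
  have "\<forall>l\<in>Lines E. \<exists>m\<in>Lines E. (\<forall>a. pts l = vertical a \<longrightarrow> pts m = vertical (a + s)) \<and>
      (\<forall>k n. pts l = sloped k n \<longrightarrow> pts m = sloped (k + t) (n + u - (k + t) * s))"
  proof
    fix l assume l: "l \<in> Lines E"
    from line_cases[OF l]
    show "\<exists>m\<in>Lines E. (\<forall>a. pts l = vertical a \<longrightarrow> pts m = vertical (a + s)) \<and>
      (\<forall>k n. pts l = sloped k n \<longrightarrow> pts m = sloped (k + t) (n + u - (k + t) * s))"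
    proof (elim disjE exE)
      fix a assume a: "pts l = vertical a"
      obtain m where "m \<in> Lines E" "pts m = vertical (a + s)" using ex_vertical by blast
      then show ?thesis using a vertical_ne_sloped vertical_eq_iff by metis
    next
      fix k n assume a: "pts l = sloped k n"
      obtain m where "m \<in> Lines E" "pts m = sloped (k + t) (n + u - (k + t) * s)" using ex_sloped by blast
      then show ?thesis using a vertical_ne_sloped sloped_eq_iff by metis
    qed
  qed
  then obtain G where G: "\<forall>l\<in>Lines E. G l \<in> Lines E \<and> (\<forall>a. pts l = vertical a \<longrightarrow> pts (G l) = vertical (a + s)) \<and>
      (\<forall>k n. pts l = sloped k n \<longrightarrow> pts (G l) = sloped (k + t) (n + u - (k + t) * s))"
    by metis
  have iff: "shear s t u v \<in> pts (G l) \<longleftrightarrow> v \<in> pts l" if l: "l \<in> Lines E" for l v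
    using line_cases[OF l] G l shear_vertical shear_sloped by metis
  have "inj_on G (Lines E)"
  proof (rule inj_onI)
    fix l m assume lm: "l \<in> Lines E" "m \<in> Lines E" "G l = G m"
    have "pts l = pts m" using iff[OF lm(1)] iff[OF lm(2)] lm(3) by auto
    then show "l = m" using line_eqI lm by blast
  qed
  moreover have "G ` Lines E = Lines E"
    by (rule endo_inj_surj[OF finite_Lines _ calculation]) (use G in auto)
  ultimately have "bij_betw G (Lines E) (Lines E)" by (simp add: bij_betw_def)
  then show ?thesis using iff G by blast
qed

lemma (in coord_plane) bij_betw_tr: "bij \<phi> \<Longrightarrow> bij_betw (tr \<phi>) (Points E) (Points E)"
  using transport_in_Bij[OF inj, of \<phi>] unfolding Points by (simp add: Bij_def)

lemma (in coord_plane) shear_automorphism: "tr (shear s t u) \<in> automorphisms E"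
proof -
  obtain G where G: "bij_betw G (Lines E) (Lines E)"
    "\<forall>l\<in>Lines E. \<forall>v. shear s t u v \<in> pts (G l) \<longleftrightarrow> v \<in> pts l"
    "\<forall>l\<in>Lines E. \<forall>a. pts l = vertical a \<longrightarrow> pts (G l) = vertical (a + s)"
    "\<forall>l\<in>Lines E. \<forall>k n. pts l = sloped k n \<longrightarrow> pts (G l) = sloped (k + t) (n + u - (k + t) * s)"
    using shear_line_map[of s t u] by (elim exE conjE) (rule that)
  have B: "tr (shear s t u) \<in> Bij (Points E)"
    unfolding Points transport_in_Bij[OF inj] by (rule bij_shear)
  moreover have "\<forall>p\<in>Points E. \<forall>l\<in>Lines E. Inc E (tr (shear s t u) p) (G l) \<longleftrightarrow> Inc E p l"
    unfolding Points using G(2) by (simp add: Inc_pts inj)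
  ultimately show ?thesis using G(1) unfolding automorphisms_def by blast
qed

section \<open>Elations of the completion are shears and conversely\<close>

lemma (in coord_plane) vclass_at_infinity: "vclass \<in> points_at_infinity E"
  by (simp add: points_at_infinity_eq)

lemma (in coord_plane) extends_to_completion_tr:
  assumes "extends_to_completion E (tr \<phi>) g"
  shows "g (Inl (\<theta> v)) = Inl (\<theta> (\<phi> v))"
proof -
  have "\<theta> v \<in> Points E" unfolding Points by (rule rangeI)
  then have "g (Inl (\<theta> v)) = Inl (tr \<phi> (\<theta> v))"
    using assms unfolding extends_to_completion_def by blast
  then show ?thesis unfolding transport_apply[OF inj] .
qed

text \<open>Collects what the two kinds of elations need: for \<open>t = 0\<close> slopes do not
  change, so the line at infinity is fixed pointwise; for \<open>s = 0\<close> every vertical line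
  is fixed, so membership of vertical lines in a class is preserved.\<close>

lemma (in coord_plane) completion_extension_shear:
  "\<exists>g. g \<in> automorphisms (completion E) \<and> extends_to_completion E (tr (shear s t u)) g \<and>
    g (Inr vclass) = Inr vclass \<and> (\<forall>c\<in>points_at_infinity E. \<exists>d. g (Inr c) = Inr d) \<and>
    (t = 0 \<longrightarrow> (\<forall>c\<in>points_at_infinity E. g (Inr c) = Inr c)) \<and>
    (s = 0 \<longrightarrow> (\<forall>c\<in>points_at_infinity E. \<forall>d. \<forall>l\<in>vclass. g (Inr c) = Inr d \<longrightarrow> (l \<in> d \<longleftrightarrow> l \<in> c)))"
proof -
  obtain G where G0: "bij_betw G (Lines E) (Lines E)"
    "\<forall>l\<in>Lines E. \<forall>v. shear s t u v \<in> pts (G l) \<longleftrightarrow> v \<in> pts l"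
    "\<forall>l\<in>Lines E. \<forall>a. pts l = vertical a \<longrightarrow> pts (G l) = vertical (a + s)"
    "\<forall>l\<in>Lines E. \<forall>k n. pts l = sloped k n \<longrightarrow> pts (G l) = sloped (k + t) (n + u - (k + t) * s)"
    using shear_line_map[of s t u] by (elim exE conjE) (rule that)
  note G = G0(1) G0(2)[rule_format] G0(3)[rule_format] G0(4)[rule_format]
  have GL: "G l \<in> Lines E" if "l \<in> Lines E" for l using G(1) that by (rule bij_betw_apply)
  have bij: "bij_betw (tr (shear s t u)) (Points E) (Points E)" by (rule bij_betw_tr[OF bij_shear])
  have inc: "Inc E (tr (shear s t u) p) (G l) \<longleftrightarrow> Inc E p l" if "p \<in> Points E" "l \<in> Lines E" for p l
    using that inj G(2) unfolding Points by (auto simp: Inc_pts)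
  note im = image_parallel_class[OF bij G(1) inc]
  define g where "g = completion_extension E (tr (shear s t u)) G"
  have g: "g \<in> automorphisms (completion E)"
    unfolding g_def by (rule completion_extension_automorphism[OF bij G(1) inc])
  have ext: "extends_to_completion E (tr (shear s t u)) g"
    by (simp add: extends_to_completion_def g_def completion_extension_def completion_def)
  have gInr: "g (Inr c) = Inr (G ` c)" if "c \<in> points_at_infinity E" for c
    using that by (simp add: g_def completion_extension_def completion_def)
  have Gv: "G ` vclass = vclass"
  proof -
    obtain l where l: "l \<in> Lines E" "pts l = vertical 0" using ex_vertical by blast
    have "G ` parallel_class E l = parallel_class E (G l)" using im[OF _ _ l(1)] by simp
    then show ?thesis
      using parallel_class_vertical[OF l] parallel_class_vertical[OF GL[OF l(1)] G(3)[OF l]] by simp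
  qed
  have "G ` sclass k = sclass k" if "t = 0" for k
  proof -
    obtain l where l: "l \<in> Lines E" "pts l = sloped k 0" using ex_sloped by blast
    have "G ` parallel_class E l = parallel_class E (G l)" using im[OF _ _ l(1)] by simp
    then show ?thesis
      using parallel_class_sloped[OF l] parallel_class_sloped[OF GL[OF l(1)] G(4)[OF l]] that by simp
  qed
  then have triv: "t = 0 \<Longrightarrow> \<forall>c\<in>points_at_infinity E. g (Inr c) = Inr c"
    using gInr Gv by (auto simp: points_at_infinity_eq)
  have vert: "l \<in> d \<longleftrightarrow> l \<in> c"
    if s: "s = 0" and c: "c \<in> points_at_infinity E" and l: "l \<in> vclass" and d: "g (Inr c) = Inr d" for c d l
  proof -
    obtain a where a: "l \<in> Lines E" "pts l = vertical a" using l by (auto simp: vclass_def)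
    have "G l = l" using line_eqI[OF GL[OF a(1)] a(1)] G(3)[OF a] a(2) s by simp
    moreover have "c \<subseteq> Lines E" using c by (auto simp: points_at_infinity_def parallel_class_def)
    moreover have "d = G ` c" using d gInr[OF c] by simp
    ultimately show ?thesis
      using G(1) a(1) inj_on_image_mem_iff[of G "Lines E" l c] by (simp add: bij_betw_def)
  qed
  have "g (Inr vclass) = Inr vclass" by (simp add: gInr[OF vclass_at_infinity] Gv)
  moreover have "\<forall>c\<in>points_at_infinity E. \<exists>d. g (Inr c) = Inr d" using gInr by blast
  ultimately show ?thesis using g ext triv vert by blast
qed

lemma (in coord_plane) translation_shear: "tr (shear s 0 u) \<in> translation_group E"
proof -
  obtain g where g: "g \<in> automorphisms (completion E)" "extends_to_completion E (tr (shear s 0 u)) g"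
    "g (Inr vclass) = Inr vclass" "\<forall>c\<in>points_at_infinity E. \<exists>d. g (Inr c) = Inr d"
    "0 = (0::'a) \<longrightarrow> (\<forall>c\<in>points_at_infinity E. g (Inr c) = Inr c)"
    "s = (0::'a) \<longrightarrow> (\<forall>c\<in>points_at_infinity E. \<forall>d. \<forall>l\<in>vclass. g (Inr c) = Inr d \<longrightarrow> (l \<in> d \<longleftrightarrow> l \<in> c))"
    using completion_extension_shear[of s 0 u] by (elim exE conjE) (rule that)
  have g3: "g (Inr c) = Inr c" if "c \<in> points_at_infinity E" for c using g(5) that by simp
  \<comment> \<open>The centre is the direction of the translation vector \<open>(s, u)\<close>; the
    identity is assigned the vertical class.\<close>
  define c where "c = (if s = 0 then vclass else sclass (u / s))"
  have c: "c \<in> points_at_infinity E" by (simp add: c_def points_at_infinity_eq)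
  have cL: "shear s 0 u v \<in> pts l \<longleftrightarrow> v \<in> pts l" if l: "l \<in> c" for l v
  proof (cases "s = 0")
    case True
    then obtain a where "pts l = vertical a" using l by (auto simp: c_def vclass_def)
    then show ?thesis using True by (cases v) (auto simp: vertical_def)
  next
    case False
    then obtain n where "pts l = sloped (u / s) n" using l by (auto simp: c_def sclass_def)
    moreover have "u / s * (a + s) = u / s * a + u" for a using False by (simp add: field_simps)
    ultimately show ?thesis by (cases v) (auto simp: sloped_def algebra_simps)
  qed
  have "elation (completion E) (Inr c) None g"
    unfolding elation_def
  proof (intro conjI ballI impI)
    fix p assume "p \<in> Points (completion E)" "Inc (completion E) p None"
    then show "g p = p" using g3 by (cases p) (auto simp: completion_def)
  next
    fix l p assume l: "l \<in> Lines (completion E)" "Inc (completion E) (Inr c) l" and p: "p \<in> Points (completion E)"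
    show "Inc (completion E) (g p) l \<longleftrightarrow> Inc (completion E) p l"
    proof (cases p)
      case (Inl a)
      then obtain v where v: "a = \<theta> v" using p by (auto simp: completion_def Points)
      have gp: "g (Inl (\<theta> v)) = Inl (\<theta> (shear s 0 u v))"
        by (rule extends_to_completion_tr[OF g(2)])
      show ?thesis
      proof (cases l)
        case None
        then show ?thesis by (simp add: gp v Inl completion_def)
      next
        case (Some m)
        then have "m \<in> c" using l by (simp add: completion_def)
        then show ?thesis using cL v by (simp add: gp v Inl Some completion_def Inc_pts)
      qed
    next
      case (Inr d)
      then show ?thesis using p g3 by (auto simp: completion_def)
    qed
  qed (use g(1) c in \<open>auto simp: completion_def\<close>)
  then show ?thesis using g(2) shear_automorphism by (auto simp: translation_group_def)
qed

lemma (in coord_plane) dual_translation_shear: "tr (shear 0 t u) \<in> dual_translation_group E vclass"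
proof -
  obtain g where g: "g \<in> automorphisms (completion E)" "extends_to_completion E (tr (shear 0 t u)) g"
    "g (Inr vclass) = Inr vclass" "\<forall>c\<in>points_at_infinity E. \<exists>d. g (Inr c) = Inr d"
    "t = (0::'a) \<longrightarrow> (\<forall>c\<in>points_at_infinity E. g (Inr c) = Inr c)"
    "0 = (0::'a) \<longrightarrow> (\<forall>c\<in>points_at_infinity E. \<forall>d. \<forall>l\<in>vclass. g (Inr c) = Inr d \<longrightarrow> (l \<in> d \<longleftrightarrow> l \<in> c))"
    using completion_extension_shear[of 0 t u] by (elim exE conjE) (rule that)
  have g5: "l \<in> d \<longleftrightarrow> l \<in> c" if "c \<in> points_at_infinity E" "l \<in> vclass" "g (Inr c) = Inr d" for c d l
    using g(6) that by simp
  \<comment> \<open>For \<open>t\<close> nonzero the shear fixes exactly the points with first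
    coordinate \<open>- u / t\<close>, so this line is the axis; for \<open>t = 0\<close> the axis
    is the line at infinity.\<close>
  obtain m0 where m0: "m0 \<in> Lines E" "pts m0 = vertical (- u / t)" using ex_vertical by blast
  have m0v: "m0 \<in> vclass" using m0 by (auto simp: vclass_def)
  define m where "m = (if t = 0 then None else Some m0)"
  have gInr: "\<exists>d. g (Inr c) = Inr d" if "c \<in> points_at_infinity E" for c
    using g(4) that by blast
  have "elation (completion E) (Inr vclass) m g"
    unfolding elation_def
  proof (intro conjI ballI impI)
    fix p assume p: "p \<in> Points (completion E)" and pm: "Inc (completion E) p m"
    show "g p = p"
    proof (cases "t = 0")
      case True
      then show ?thesis using g(5) p pm by (cases p) (auto simp: m_def completion_def)
    next
      case False
      then have m: "m = Some m0" by (simp add: m_def)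
      show ?thesis
      proof (cases p)
        case (Inl a)
        then obtain v where v: "a = \<theta> v" using p by (auto simp: completion_def Points)
        then have "v \<in> vertical (- u / t)" using pm m0(2) by (simp add: m Inl completion_def Inc_pts)
        then have "shear 0 t u v = v" using False by (cases v) (simp add: vertical_def)
        then show ?thesis
          using extends_to_completion_tr[OF g(2), of v] v Inl by simp
      next
        case (Inr d)
        then have d: "d \<in> points_at_infinity E" "m0 \<in> d" using p pm by (auto simp: m completion_def)
        have "m0 \<notin> sclass k" for k
          using m0(2) vertical_ne_sloped[of "- u / t" k] by (auto simp: sclass_def)
        then have "d = vclass" using d by (auto simp: points_at_infinity_eq)
        then show ?thesis using g(3) Inr by simp
      qed
    qed
  next
    fix l p assume l: "l \<in> Lines (completion E)" "Inc (completion E) (Inr vclass) l" and p: "p \<in> Points (completion E)"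
    show "Inc (completion E) (g p) l \<longleftrightarrow> Inc (completion E) p l"
    proof (cases p)
      case (Inl a)
      then obtain v where v: "a = \<theta> v" using p by (auto simp: completion_def Points)
      have gp: "g (Inl (\<theta> v)) = Inl (\<theta> (shear 0 t u v))"
        by (rule extends_to_completion_tr[OF g(2)])
      show ?thesis
      proof (cases l)
        case None
        then show ?thesis by (simp add: gp v Inl completion_def)
      next
        case (Some m)
        then obtain a where "pts m = vertical a" using l by (auto simp: completion_def vclass_def)
        then have "shear 0 t u v \<in> pts m \<longleftrightarrow> v \<in> pts m" using shear_vertical[of 0 t u v a] by simp
        then show ?thesis by (simp add: gp v Inl Some completion_def Inc_pts)
      qed
    next
      case (Inr c)
      then have c: "c \<in> points_at_infinity E" using p by (auto simp: completion_def)
      then obtain d where d: "g (Inr c) = Inr d" using gInr by blast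
      show ?thesis
      proof (cases l)
        case None
        then show ?thesis by (simp add: Inr d completion_def)
      next
        case (Some m)
        then have "m \<in> vclass" using l by (simp add: completion_def)
        then show ?thesis using g5[OF c _ d] by (simp add: Inr d Some completion_def)
      qed
    qed
  qed (use g(1) m0v m0 in \<open>auto simp: completion_def vclass_at_infinity m_def\<close>)
  then show ?thesis using g(2) shear_automorphism by (auto simp: dual_translation_group_def)
qed

text \<open>Let the displacement of \<open>v\<close> be \<open>(\<xi> v, \<psi> v)\<close>. Fixing
  all points at infinity makes displacement differences parallel to \<open>w - v\<close>, while the
  centre confines displacements to one direction. Points not on a common line through the centre
  therefore have equal displacement.\<close>

lemma (in coord_plane) elation_axis_infinity:
  assumes el: "elation (completion E) c None g" and ext: "extends_to_completion E (tr \<phi>) g"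
  shows "\<exists>s u. \<phi> = shear s 0 u" and "c = Inr vclass \<Longrightarrow> \<exists>u. \<phi> = shear 0 0 u"
proof -
  have gInl: "g (Inl (\<theta> v)) = Inl (\<theta> (\<phi> v))" for v
    by (rule extends_to_completion_tr[OF ext])
  have gInr: "g (Inr d) = Inr d" if "d \<in> points_at_infinity E" for d
    using el that by (simp add: elation_def completion_def)
  obtain F where F: "bij_betw F (Lines (completion E)) (Lines (completion E))"
      "\<And>p l. p \<in> Points (completion E) \<Longrightarrow> l \<in> Lines (completion E) \<Longrightarrow>
        Inc (completion E) (g p) (F l) \<longleftrightarrow> Inc (completion E) p l"
    using el by (auto simp: elation_def automorphisms_def)
  have map: "\<exists>l'\<in>parallel_class E l. \<forall>v. v \<in> pts l \<longrightarrow> \<phi> v \<in> pts l'"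
    if l: "l \<in> Lines E" for l
  proof -
    have Fl: "Inc (completion E) (Inr (parallel_class E l)) (F (Some l))"
      using F(2)[of "Inr (parallel_class E l)" "Some l"] gInr[of "parallel_class E l"] l
      by (simp add: completion_def points_at_infinity_def mem_parallel_class)
    have Fv: "Inc (completion E) (Inl (\<theta> (\<phi> v))) (F (Some l))" if "v \<in> pts l" for v
      using F(2)[of "Inl (\<theta> v)" "Some l"] that l by (simp add: completion_def Points gInl Inc_pts)
    obtain v0 where "v0 \<in> pts l"
      using line_cases[OF l] unfolding vertical_def sloped_def
      by (metis (mono_tags, lifting) fst_conv mem_Collect_eq snd_conv)
    then obtain l' where l': "F (Some l) = Some l'"
      using Fv[of v0] by (cases "F (Some l)") (auto simp: completion_def)
    have "l' \<in> parallel_class E l" using Fl by (simp add: l' completion_def)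
    moreover have "\<forall>v. v \<in> pts l \<longrightarrow> \<phi> v \<in> pts l'" using Fv by (simp add: l' completion_def Inc_pts)
    ultimately show ?thesis by blast
  qed
  have vert: "fst (\<phi> v) = fst (\<phi> w)" if "fst v = fst w" for v w
  proof -
    obtain l where l: "l \<in> Lines E" "pts l = vertical (fst v)" using ex_vertical by blast
    then obtain l' where l': "l' \<in> vclass" "\<forall>v. v \<in> pts l \<longrightarrow> \<phi> v \<in> pts l'"
      using map[OF l(1)] parallel_class_vertical[OF l] by blast
    moreover have "v \<in> pts l" "w \<in> pts l" using l(2) that by (auto simp: vertical_def)
    moreover obtain a where "pts l' = vertical a" using l'(1) by (auto simp: vclass_def)
    ultimately have "\<phi> v \<in> vertical a" "\<phi> w \<in> vertical a" by metis+
    then show ?thesis by (simp add: vertical_def)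
  qed
  have slop: "snd (\<phi> v) - k * fst (\<phi> v) = snd (\<phi> w) - k * fst (\<phi> w)"
    if "snd v - k * fst v = snd w - k * fst w" for v w k
  proof -
    obtain l where l: "l \<in> Lines E" "pts l = sloped k (snd v - k * fst v)" using ex_sloped by blast
    then obtain l' where l': "l' \<in> sclass k" "\<forall>v. v \<in> pts l \<longrightarrow> \<phi> v \<in> pts l'"
      using map[OF l(1)] parallel_class_sloped[OF l] by blast
    moreover have "v \<in> pts l" "w \<in> pts l" using l(2) that by (auto simp: sloped_def algebra_simps)
    moreover obtain n where "pts l' = sloped k n" using l'(1) by (auto simp: sclass_def)
    ultimately have "\<phi> v \<in> sloped k n" "\<phi> w \<in> sloped k n" by metis+
    then show ?thesis by (simp add: sloped_def)
  qed
  define \<xi> where "\<xi> v = fst (\<phi> v) - fst v" for v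
  define \<psi> where "\<psi> v = snd (\<phi> v) - snd v" for v
  have \<phi>: "\<phi> v = (fst v + \<xi> v, snd v + \<psi> v)" for v by (simp add: \<xi>_def \<psi>_def prod_eq_iff)
  have \<xi>v: "\<xi> (a, b) = \<xi> (a, b')" for a b b' using vert[of "(a, b)" "(a, b')"] by (simp add: \<xi>_def)
  \<comment> \<open>The line joining \<open>v\<close> and \<open>w\<close> is mapped into a parallel
    line.\<close>
  have dir: "(\<psi> w - \<psi> v) * (fst w - fst v) = (snd w - snd v) * (\<xi> w - \<xi> v)" for v w
  proof (cases "fst w = fst v")
    case True
    then show ?thesis using \<xi>v[of "fst v" "snd v" "snd w"] by (metis diff_self mult_zero_right prod.collapse)
  next
    case False
    define k where "k = (snd w - snd v) / (fst w - fst v)"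
    have k: "k * (fst w - fst v) = snd w - snd v" using False by (simp add: k_def)
    then have X: "snd v - k * fst v = snd w - k * fst w" by (simp add: algebra_simps)
    have "snd v + \<psi> v - k * (fst v + \<xi> v) - (snd v - k * fst v) =
        snd w + \<psi> w - k * (fst w + \<xi> w) - (snd w - k * fst w)"
      using slop[OF X] X by (simp only: \<phi> fst_conv snd_conv)
    then have "\<psi> v - k * \<xi> v = \<psi> w - k * \<xi> w" by (simp add: algebra_simps)
    then have "\<psi> w - \<psi> v = k * (\<xi> w - \<xi> v)" by (simp add: algebra_simps)
    then show ?thesis using k by (metis mult.assoc mult.commute)
  qed
  have c: "c \<in> Points (completion E)" "Inc (completion E) c None" using el by (auto simp: elation_def)
  then obtain d where d: "c = Inr d" "d \<in> points_at_infinity E" by (auto simp: completion_def)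
  have cen: "\<phi> v \<in> pts l \<longleftrightarrow> v \<in> pts l" if l: "l \<in> d" "l \<in> Lines E" for v l
  proof -
    have "Some l \<in> Lines (completion E)" "Inc (completion E) c (Some l)"
        "Inl (\<theta> v) \<in> Points (completion E)"
      using l by (auto simp: completion_def d Points)
    then have "Inc (completion E) (g (Inl (\<theta> v))) (Some l) \<longleftrightarrow> Inc (completion E) (Inl (\<theta> v)) (Some l)"
      using el unfolding elation_def by blast
    then show ?thesis by (simp add: gInl completion_def Inc_pts)
  qed
  have shear: "\<phi> = shear (\<xi> (0, 0)) 0 (\<psi> (0, 0))" if "\<And>v w. \<xi> v = \<xi> w" "\<And>v w. \<psi> v = \<psi> w"
  proof
    fix v show "\<phi> v = shear (\<xi> (0, 0)) 0 (\<psi> (0, 0)) v"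
      using \<phi>[of v] that[of v "(0,0)"] by (cases v) simp
  qed
  have vc: "\<exists>u. \<phi> = shear 0 0 u" if dv: "d = vclass"
  proof -
    have \<xi>: "\<xi> v = 0" for v
    proof -
      obtain l where l: "l \<in> Lines E" "pts l = vertical (fst v)" using ex_vertical by blast
      then show ?thesis using cen[of l v] dv by (auto simp: vclass_def vertical_def \<xi>_def)
    qed
    have ne: "\<psi> v = \<psi> w" if "fst v \<noteq> fst w" for v w using dir[of w v] that by (simp add: \<xi>)
    \<comment> \<open>Points on a common line through the centre are compared through a third point
      off that line.\<close>
    have "\<psi> v = \<psi> w" for v w
    proof (cases "fst v = fst w")
      case True
      then show ?thesis using ne[of v "(fst v + 1, 0)"] ne[of w "(fst v + 1, 0)"] by simp
    qed (rule ne)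
    then show ?thesis using shear \<xi> by auto
  qed
  show "\<exists>u. \<phi> = shear 0 0 u" if "c = Inr vclass" using vc d that by simp
  show "\<exists>s u. \<phi> = shear s 0 u"
  proof (cases "d = vclass")
    case False
    then obtain k where k: "d = sclass k" using d(2) by (auto simp: points_at_infinity_eq)
    have \<psi>: "\<psi> v = k * \<xi> v" for v
    proof -
      obtain l where l: "l \<in> Lines E" "pts l = sloped k (snd v - k * fst v)" using ex_sloped by blast
      then have "\<phi> v \<in> pts l" using cen[of l v] k by (auto simp: sclass_def sloped_def)
      then show ?thesis using l by (simp add: sloped_def \<phi> algebra_simps)
    qed
    have ne: "\<xi> v = \<xi> w" if "snd v - k * fst v \<noteq> snd w - k * fst w" for v w
    proof -
      have "(\<xi> w - \<xi> v) * ((snd w - k * fst w) - (snd v - k * fst v)) = 0"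
        using dir[of w v] unfolding \<psi> by (simp add: algebra_simps)
      then show ?thesis using that by auto
    qed
    \<comment> \<open>Again a third point, off the common line of slope \<open>k\<close>,
      mediates.\<close>
    have "\<xi> v = \<xi> w" for v w
    proof (cases "snd v - k * fst v = snd w - k * fst w")
      case True
      then show ?thesis
        using ne[of v "(0, snd v - k * fst v + 1)"] ne[of w "(0, snd v - k * fst v + 1)"] by simp
    qed (rule ne)
    then show ?thesis using shear \<psi> by metis
  qed (use vc in blast)
qed

text \<open>With an affine axis, first coordinates are preserved because vertical lines pass through
  the centre. The horizontal class goes to a class of some slope \<open>t\<close>, so each
  horizontal line goes into the line of slope \<open>t\<close> through its fixed point on the
  axis.\<close>

lemma (in coord_plane) elation_center_vertical:
  assumes el: "elation (completion E) (Inr vclass) m g" and ext: "extends_to_completion E (tr \<phi>) g"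
  shows "\<exists>t u. \<phi> = shear 0 t u"
proof (cases m)
  case None
  then show ?thesis using elation_axis_infinity(2)[of "Inr vclass" g \<phi>] el ext by blast
next
  case (Some m')
  have gInl: "g (Inl (\<theta> v)) = Inl (\<theta> (\<phi> v))" for v
    by (rule extends_to_completion_tr[OF ext])
  obtain F where F: "bij_betw F (Lines (completion E)) (Lines (completion E))"
      "\<And>p l. p \<in> Points (completion E) \<Longrightarrow> l \<in> Lines (completion E) \<Longrightarrow>
        Inc (completion E) (g p) (F l) \<longleftrightarrow> Inc (completion E) p l"
    using el by (auto simp: elation_def automorphisms_def)
  have ga: "g \<in> automorphisms (completion E)" using el by (simp add: elation_def)
  have through: "Inc (completion E) (g p) l \<longleftrightarrow> Inc (completion E) p l"
    if "l \<in> Lines (completion E)" "Inc (completion E) (Inr vclass) l" "p \<in> Points (completion E)" for l p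
    using el that unfolding elation_def by blast
  have ptI: "Inl (\<theta> v) \<in> Points (completion E)" for v by (simp add: completion_def Points)
  have fst: "fst (\<phi> v) = fst v" for v
  proof -
    obtain l where l: "l \<in> Lines E" "pts l = vertical (fst v)" using ex_vertical by blast
    then have "Some l \<in> Lines (completion E)" "Inc (completion E) (Inr vclass) (Some l)"
      by (auto simp: completion_def vclass_def)
    from through[OF this ptI[of v]] have "\<phi> v \<in> pts l \<longleftrightarrow> v \<in> pts l"
      by (simp add: gInl completion_def Inc_pts)
    then show ?thesis using l(2) by (simp add: vertical_def)
  qed
  have m': "m' \<in> Lines E" "m' \<in> vclass" using el Some by (auto simp: elation_def completion_def)
  then obtain a0 where a0: "pts m' = vertical a0" by (auto simp: vclass_def)
  have ax: "\<phi> (a0, b) = (a0, b)" for b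
  proof -
    have "Inc (completion E) (Inl (\<theta> (a0, b))) m"
      using a0 by (simp add: Some completion_def Inc_pts vertical_def)
    then have "g (Inl (\<theta> (a0, b))) = Inl (\<theta> (a0, b))"
      using el ptI unfolding elation_def by blast
    then show ?thesis using inj by (simp add: gInl inj_eq)
  qed
  have c0: "sclass 0 \<in> points_at_infinity E" by (simp add: points_at_infinity_eq)
  obtain d where d: "g (Inr (sclass 0)) = Inr d"
  proof -
    have p: "Inr (sclass 0) \<in> Points (completion E)" using c0 by (simp add: completion_def)
    have "Inc (completion E) (g (Inr (sclass 0))) None"
      using through[OF _ _ p, of None] by (simp add: completion_def)
    then show ?thesis using that by (cases "g (Inr (sclass 0))") (auto simp: completion_def)
  qed
  have "Inr d \<in> Points (completion E)"
    using automorphism_Points[OF ga, of "Inr (sclass 0)"] c0 by (simp add: d completion_def)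
  then have dI: "d \<in> points_at_infinity E" by (auto simp: completion_def)
  have im: "\<exists>l'\<in>d. l' \<in> Lines E \<and> (\<forall>a. \<phi> (a, n) \<in> pts l')" for n
  proof -
    obtain l where l: "l \<in> Lines E" "pts l = sloped 0 n" using ex_sloped by blast
    have lL: "Some l \<in> Lines (completion E)" using l by (simp add: completion_def)
    have Fa: "Inc (completion E) (Inl (\<theta> (\<phi> (a, n)))) (F (Some l))" for a
      using F(2)[OF ptI lL, of "(a, n)"] l by (simp add: completion_def gInl Inc_pts sloped_def)
    have "Inr (sclass 0) \<in> Points (completion E)" using c0 by (simp add: completion_def)
    moreover have "l \<in> sclass 0" using l by (auto simp: sclass_def)
    ultimately have Fd: "Inc (completion E) (Inr d) (F (Some l))"
      using F(2)[OF _ lL, of "Inr (sclass 0)"] by (simp add: d completion_def)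
    have FL: "F (Some l) \<in> Lines (completion E)" using F(1) lL by (rule bij_betw_apply)
    obtain l' where l': "F (Some l) = Some l'"
      using Fa[of 0] by (cases "F (Some l)") (auto simp: completion_def)
    show ?thesis
      using Fa Fd FL unfolding l' by (auto simp: completion_def Inc_pts)
  qed
  have "d \<noteq> vclass"
  proof
    assume "d = vclass"
    then obtain a where "\<phi> (0, 0) \<in> vertical a" "\<phi> (1, 0) \<in> vertical a"
      using im[of 0] by (auto simp: vclass_def)
    then show False using fst[of "(0,0)"] fst[of "(1,0)"] by (simp add: vertical_def)
  qed
  then obtain t where t: "d = sclass t" using dI by (auto simp: points_at_infinity_eq)
  have sh: "\<phi> (a, n) = shear 0 t (- t * a0) (a, n)" for a n
  proof -
    obtain n' where n': "\<forall>a. \<phi> (a, n) \<in> sloped t n'"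
      using im[of n] t by (auto simp: sclass_def)
    have "n = t * a0 + n'" using n'[rule_format, of a0] ax[of n] by (simp add: sloped_def)
    moreover have "snd (\<phi> (a, n)) = t * a + n'" using n' fst[of "(a, n)"] by (simp add: sloped_def)
    ultimately show ?thesis using fst[of "(a, n)"] by (simp add: prod_eq_iff)
  qed
  have "\<phi> v = shear 0 t (- t * a0) v" for v
    using sh[of "fst v" "snd v"] unfolding prod.collapse .
  then have "\<phi> = shear 0 t (- t * a0)" by (rule HOL.ext)
  then show ?thesis by blast
qed

section \<open>The group H, its centre and the complements in the quotient\<close>

lemma (in coord_plane) automorphism_tr:
  assumes "f \<in> automorphisms E"
  obtains \<phi> where "f = tr \<phi>"
proof -
  have "f \<in> Bij (range \<theta>)" using automorphisms_Bij[OF assms] unfolding Points .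
  then show ?thesis using Bij_eq_transport[OF inj] that by blast
qed

lemma (in coord_plane) translation_group_eq: "translation_group E = {tr (shear s 0 u) | s u. True}"
proof (intro equalityI subsetI)
  fix f assume "f \<in> translation_group E"
  then obtain c g where f: "f \<in> automorphisms E" and el: "elation (completion E) c None g"
      and ext: "extends_to_completion E f g" by (auto simp: translation_group_def)
  obtain \<phi> where \<phi>: "f = tr \<phi>" using automorphism_tr[OF f] .
  then show "f \<in> {tr (shear s 0 u) | s u. True}"
    using elation_axis_infinity(1)[OF el] ext by blast
qed (use translation_shear in auto)

lemma (in coord_plane) dual_translation_group_eq:
  "dual_translation_group E vclass = {tr (shear 0 t u) | t u. True}"
proof (intro equalityI subsetI)
  fix f assume "f \<in> dual_translation_group E vclass"
  then obtain m g where f: "f \<in> automorphisms E" and el: "elation (completion E) (Inr vclass) m g"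
      and ext: "extends_to_completion E f g" by (auto simp: dual_translation_group_def)
  obtain \<phi> where \<phi>: "f = tr \<phi>" using automorphism_tr[OF f] .
  then show "f \<in> {tr (shear 0 t u) | t u. True}"
    using elation_center_vertical[OF el] ext by blast
qed (use dual_translation_shear in auto)

abbreviation (in coord_plane) "H \<equiv> H_group E vclass"

lemma (in coord_plane) mult_shear:
  "tr (shear s' t' u') \<otimes>\<^bsub>aut_group E\<^esub> tr (shear s t u) = tr (shear (s + s') (t + t') (u + u' + t' * s))"
  by (simp add: mult_aut_group_transport[OF inj Points] shear_automorphism shear_comp)

lemma (in coord_plane) inv_shear:
  "inv\<^bsub>aut_group E\<^esub> (tr (shear s t u)) = tr (shear (- s) (- t) (t * s - u))"
proof -
  interpret G: group "aut_group E" by (rule group_aut_group)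
  have "tr (shear (- s) (- t) (t * s - u)) \<otimes>\<^bsub>aut_group E\<^esub> tr (shear s t u) = \<one>\<^bsub>aut_group E\<^esub>"
    unfolding mult_shear one_aut_group_transport[OF inj Points] by simp
  then show ?thesis by (rule G.inv_equality) (simp_all add: shear_automorphism)
qed

lemma (in coord_plane) subgroup_shears: "subgroup {tr (shear s t u) | s t u. True} (aut_group E)"
proof -
  interpret G: group "aut_group E" by (rule group_aut_group)
  show ?thesis
    by (rule G.subgroupI) (auto simp: shear_automorphism inv_shear mult_shear inj)
qed

lemma (in coord_plane) carrier_H: "carrier H = {tr (shear s t u) | s t u. True}"
proof -
  interpret G: group "aut_group E" by (rule group_aut_group)
  let ?AB = "translation_group E \<union> dual_translation_group E vclass"
  have AB: "?AB \<subseteq> carrier (aut_group E)"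
    unfolding translation_group_eq dual_translation_group_eq using shear_automorphism by auto
  show ?thesis
  proof
    have "?AB \<subseteq> {tr (shear s t u) | s t u. True}"
      unfolding translation_group_eq dual_translation_group_eq by blast
    then show "carrier H \<subseteq> {tr (shear s t u) | s t u. True}"
      unfolding H_group_def by (rule G.subgroup_generated_minimal[OF subgroup_shears])
    show "{tr (shear s t u) | s t u. True} \<subseteq> carrier H"
    proof
      fix f assume "f \<in> {tr (shear s t u) | s t u. True}"
      then obtain s t u where f: "f = tr (shear s t u)" by blast
      \<comment> \<open>Factorization into an element of B and one of A; the offset cancels the term
        \<open>t * s\<close> created by composition.\<close>
      have "f = tr (shear 0 t (u - t * s)) \<otimes>\<^bsub>aut_group E\<^esub> tr (shear s 0 0)"
        unfolding mult_shear f by simp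
      moreover have "tr (shear 0 t (u - t * s)) \<in> carrier (aut_group E) \<inter> ?AB"
        "tr (shear s 0 0) \<in> carrier (aut_group E) \<inter> ?AB"
        using AB translation_shear dual_translation_shear by blast+
      ultimately show "f \<in> carrier H"
        unfolding H_group_def carrier_subgroup_generated
        by (metis generate.eng generate.incl)
    qed
  qed
qed

lemma (in coord_plane) group_H: "group H"
proof -
  interpret G: group "aut_group E" by (rule group_aut_group)
  show ?thesis unfolding H_group_def by simp
qed

lemma (in coord_plane) mult_H:
  "tr (shear s' t' u') \<otimes>\<^bsub>H\<^esub> tr (shear s t u) = tr (shear (s + s') (t + t') (u + u' + t' * s))"
  unfolding H_group_def by (simp add: mult_shear)

lemma (in coord_plane) one_H: "\<one>\<^bsub>H\<^esub> = tr (shear 0 0 0)"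
  unfolding H_group_def by (simp add: one_aut_group_transport[OF inj Points])

lemma (in coord_plane) center_H: "group_center H = {tr (shear 0 0 u) | u. True}"
proof (intro equalityI subsetI)
  fix z assume z: "z \<in> group_center H"
  then obtain s t u where zeq: "z = tr (shear s t u)" unfolding group_center_def carrier_H by blast
  have c: "z \<otimes>\<^bsub>H\<^esub> tr (shear s' t' u') = tr (shear s' t' u') \<otimes>\<^bsub>H\<^esub> z" for s' t' u'
    using z unfolding group_center_def carrier_H by blast
  \<comment> \<open>One horizontal translation detects \<open>t\<close>, and one shear with
    \<open>t' = 1\<close> detects \<open>s\<close>.\<close>
  have "t = 0" using c[of 1 0 0] unfolding zeq mult_H by (simp add: inj)
  moreover have "s = 0" using c[of 0 1 0] unfolding zeq mult_H by (simp add: inj)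
  ultimately show "z \<in> {tr (shear 0 0 u) | u. True}" using zeq by blast
next
  fix z assume "z \<in> {tr (shear 0 0 u) | u. True}"
  then obtain u where z: "z = tr (shear 0 0 u)" by blast
  show "z \<in> group_center H"
    unfolding group_center_def carrier_H z by (auto simp: mult_H add.commute)
qed

text \<open>Cosets of the centre. They identify the quotient with the additive group of pairs
  \<open>(s, t)\<close>, in which B becomes the set \<open>s = 0\<close>.\<close>

definition (in coord_plane) "shear_coset s t = {tr (shear s t u) | u. True}"

lemma (in coord_plane) center_coset:
  "group_center H #>\<^bsub>H\<^esub> tr (shear s t u) = shear_coset s t"
proof -
  have "group_center H #>\<^bsub>H\<^esub> tr (shear s t u) = {tr (shear s t (u + u')) | u'. True}"
    unfolding r_coset_def center_H by (auto simp: mult_H)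
  also have "\<dots> = shear_coset s t"
    unfolding shear_coset_def
  proof (intro equalityI subsetI)
    fix f assume "f \<in> {tr (shear s t u') | u'. True}"
    then obtain u' where "f = tr (shear s t u')" by blast
    then have "f = tr (shear s t (u + (u' - u)))" by simp
    then show "f \<in> {tr (shear s t (u + u')) | u'. True}" by blast
  qed auto
  finally show ?thesis .
qed

lemma (in coord_plane) shear_coset_inject [simp]:
  "shear_coset s t = shear_coset s' t' \<longleftrightarrow> s = s' \<and> t = t'"
proof
  assume eq: "shear_coset s t = shear_coset s' t'"
  have "tr (shear s t 0) \<in> shear_coset s t" by (auto simp: shear_coset_def)
  then show "s = s' \<and> t = t'" unfolding eq by (auto simp: shear_coset_def inj)
qed simp

lemma (in coord_plane) normal_center: "group_center H \<lhd> H"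
proof -
  interpret group H by (rule group_H)
  have inv: "inv\<^bsub>H\<^esub> tr (shear s t u) = tr (shear (- s) (- t) (t * s - u))" for s t u
    by (rule inv_equality) (auto simp: mult_H one_H carrier_H inj)
  show ?thesis
  proof (rule normal_invI)
    show "subgroup (group_center H) H"
      by (rule subgroupI) (auto simp: center_H carrier_H inv mult_H inj)
    show "x \<otimes>\<^bsub>H\<^esub> h \<otimes>\<^bsub>H\<^esub> inv\<^bsub>H\<^esub> x \<in> group_center H" if "x \<in> carrier H" "h \<in> group_center H" for x h
      using that unfolding center_H carrier_H by (auto simp: inv mult_H inj)
  qed
qed

lemma (in coord_plane) carrier_quotient:
  "carrier (H Mod group_center H) = {shear_coset s t | s t. True}"
proof -
  have "rcosets\<^bsub>H\<^esub> group_center H = {shear_coset s t | s t. True}"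
  proof (intro equalityI subsetI)
    fix c assume "c \<in> {shear_coset s t | s t. True}"
    then obtain s t where c: "c = shear_coset s t" by blast
    show "c \<in> rcosets\<^bsub>H\<^esub> group_center H"
      unfolding RCOSETS_def carrier_H c center_coset[of s t 0, symmetric] by blast
  qed (auto simp: RCOSETS_def carrier_H center_coset)
  then show ?thesis by (simp add: FactGroup_def)
qed

lemma (in coord_plane) mult_quotient:
  "shear_coset s t \<otimes>\<^bsub>H Mod group_center H\<^esub> shear_coset s' t' = shear_coset (s + s') (t + t')"
proof -
  interpret Z: normal "group_center H" H by (rule normal_center)
  have "shear_coset s t <#>\<^bsub>H\<^esub> shear_coset s' t' =
      group_center H #>\<^bsub>H\<^esub> (tr (shear s t 0) \<otimes>\<^bsub>H\<^esub> tr (shear s' t' 0))"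
    unfolding center_coset[of s t 0, symmetric] center_coset[of s' t' 0, symmetric]
    by (rule Z.rcos_sum) (auto simp: carrier_H)
  then show ?thesis unfolding mult_H center_coset by (simp add: add.commute FactGroup_def)
qed

lemma (in coord_plane) one_quotient: "\<one>\<^bsub>H Mod group_center H\<^esub> = shear_coset 0 0"
  by (simp add: FactGroup_def center_H shear_coset_def)

definition (in coord_plane) "graph_shears (\<rho> :: 'a \<Rightarrow> 'a) = {tr (shear s (\<rho> s) u) | s u. True}"

text \<open>In the group of pairs \<open>(s, t)\<close>, a subgroup meeting \<open>s = 0\<close>
  trivially projects injectively to \<open>s\<close>; having q elements, it is the graph of a
  function defined on the whole field, and closure under addition makes that function additive. It
  need not be linear over the field.\<close>

lemma (in coord_plane) preimage_complement_subgroups: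
  "preimage_in_H E vclass ` complement_subgroups CARD('a) E vclass =
    {graph_shears \<rho> | \<rho> :: 'a \<Rightarrow> 'a. \<forall>a b. \<rho> (a + b) = \<rho> a + \<rho> b}"
proof (intro equalityI subsetI)
  interpret Q: group "H Mod group_center H" using normal.factorgroup_is_group[OF normal_center] .
  fix T assume "T \<in> preimage_in_H E vclass ` complement_subgroups CARD('a) E vclass"
  then obtain U where U: "U \<in> complement_subgroups CARD('a) E vclass" and T: "T = preimage_in_H E vclass U"
    by blast
  have sub: "subgroup U (H Mod group_center H)" and card: "card U = CARD('a)"
    and meet: "U \<inter> (\<lambda>b. group_center H #>\<^bsub>H\<^esub> b) ` dual_translation_group E vclass = {\<one>\<^bsub>H Mod group_center H\<^esub>}"
    using U unfolding complement_subgroups_def Let_def by auto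
  interpret U: subgroup U "H Mod group_center H" by (rule sub)
  have Ucos: "\<exists>s t. c = shear_coset s t" if "c \<in> U" for c
    using that U.subset carrier_quotient by blast
  define W where "W = {(s, t). shear_coset s t \<in> U}"
  have Weq: "U = (\<lambda>(s, t). shear_coset s t) ` W"
    using Ucos unfolding W_def by (auto simp: image_iff)
  have Wadd: "(s + s', t + t') \<in> W" if "(s, t) \<in> W" "(s', t') \<in> W" for s t s' t'
    using U.m_closed[of "shear_coset s t" "shear_coset s' t'"] that by (simp add: W_def mult_quotient del: mult_FactGroup one_FactGroup)
  have Wneg: "(- s, - t) \<in> W" if "(s, t) \<in> W" for s t
  proof -
    have "inv\<^bsub>H Mod group_center H\<^esub> shear_coset s t = shear_coset (- s) (- t)"
      by (rule Q.inv_equality) (auto simp: mult_quotient one_quotient carrier_quotient simp del: mult_FactGroup one_FactGroup)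
    then show ?thesis using U.m_inv_closed[of "shear_coset s t"] that by (simp add: W_def)
  qed
  have W0: "t = 0" if "(0, t) \<in> W" for t
  proof -
    have "shear_coset 0 t = group_center H #>\<^bsub>H\<^esub> tr (shear 0 t 0)" by (simp add: center_coset)
    then have "shear_coset 0 t \<in> (\<lambda>b. group_center H #>\<^bsub>H\<^esub> b) ` dual_translation_group E vclass"
      using dual_translation_shear by blast
    moreover have "shear_coset 0 t \<in> U" using that by (simp add: W_def)
    ultimately have "shear_coset 0 t = shear_coset 0 0" using meet one_quotient by blast
    then show ?thesis by simp
  qed
  \<comment> \<open>The difference of the two pairs lies in B modulo the centre.\<close>
  have funW: "t = t'" if "(s, t) \<in> W" "(s, t') \<in> W" for s t t'
    using W0[of "t + - t'"] Wadd[OF that(1) Wneg[OF that(2)]] by simp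
  have injc: "inj_on (\<lambda>(s, t). shear_coset s t) W" by (auto simp: inj_on_def)
  have "card W = CARD('a)" using card card_image[OF injc] Weq by simp
  moreover have "card (fst ` W) = card W" using funW by (intro card_image) (auto simp: inj_on_def)
  ultimately have "fst ` W = UNIV" by (intro card_eq_UNIV_imp_eq_UNIV) auto
  then have "\<forall>s. \<exists>t. (s, t) \<in> W" by (metis (no_types) UNIV_I image_iff prod.collapse)
  then obtain \<rho> where \<rho>: "\<And>s. (s, \<rho> s) \<in> W" by metis
  have "\<forall>a b. \<rho> (a + b) = \<rho> a + \<rho> b" using funW[OF \<rho> Wadd[OF \<rho> \<rho>]] by blast
  moreover have "T = graph_shears \<rho>"
  proof -
    have "T = {tr (shear s t u) | s t u. (s, t) \<in> W}"
      unfolding T preimage_in_H_def carrier_H W_def by (auto simp: center_coset inj)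
    also have "\<dots> = graph_shears \<rho>" unfolding graph_shears_def using funW \<rho> by blast
    finally show ?thesis .
  qed
  ultimately show "T \<in> {graph_shears \<rho> | \<rho> :: 'a \<Rightarrow> 'a. \<forall>a b. \<rho> (a + b) = \<rho> a + \<rho> b}" by blast
next
  interpret Q: group "H Mod group_center H" using normal.factorgroup_is_group[OF normal_center] .
  fix T assume "T \<in> {graph_shears \<rho> | \<rho> :: 'a \<Rightarrow> 'a. \<forall>a b. \<rho> (a + b) = \<rho> a + \<rho> b}"
  then obtain \<rho> where T: "T = graph_shears \<rho>" and add: "\<And>a b. \<rho> (a + b) = \<rho> a + \<rho> b" by blast
  have \<rho>0: "\<rho> 0 = 0" using add[of 0 0] by (metis add.right_neutral add_left_cancel)
  have \<rho>m: "\<rho> (- a) = - \<rho> a" for a using add[of a "- a"] \<rho>0 by (simp add: eq_neg_iff_add_eq_0 add.commute)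
  define U where "U = range (\<lambda>s. shear_coset s (\<rho> s))"
  have inv: "inv\<^bsub>H Mod group_center H\<^esub> shear_coset s t = shear_coset (- s) (- t)" for s t
    by (rule Q.inv_equality) (auto simp: mult_quotient one_quotient carrier_quotient simp del: mult_FactGroup one_FactGroup)
  have "subgroup U (H Mod group_center H)"
  proof (rule Q.subgroupI)
    show "U \<subseteq> carrier (H Mod group_center H)" by (auto simp: U_def carrier_quotient)
    show "U \<noteq> {}" by (simp add: U_def)
    show "inv\<^bsub>H Mod group_center H\<^esub> c \<in> U" if "c \<in> U" for c
      using that unfolding U_def by (auto simp: inv \<rho>m[symmetric])
    show "c \<otimes>\<^bsub>H Mod group_center H\<^esub> d \<in> U" if "c \<in> U" "d \<in> U" for c d
      using that unfolding U_def by (auto simp: mult_quotient add[symmetric] simp del: mult_FactGroup one_FactGroup)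
  qed
  moreover have "card U = CARD('a)"
    unfolding U_def by (rule card_image) (auto simp: inj_on_def)
  moreover have "U \<inter> (\<lambda>b. group_center H #>\<^bsub>H\<^esub> b) ` dual_translation_group E vclass = {\<one>\<^bsub>H Mod group_center H\<^esub>}"
  proof -
    have "(\<lambda>b. group_center H #>\<^bsub>H\<^esub> b) ` dual_translation_group E vclass = range (shear_coset 0)"
      unfolding dual_translation_group_eq using center_coset by (auto simp: image_iff) metis
    moreover have "shear_coset 0 0 \<in> U" unfolding U_def using \<rho>0 by (metis rangeI)
    ultimately show ?thesis unfolding one_quotient by (auto simp: U_def \<rho>0)
  qed
  ultimately have "U \<in> complement_subgroups CARD('a) E vclass"
    unfolding complement_subgroups_def Let_def by blast
  moreover have "preimage_in_H E vclass U = T"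
    unfolding T preimage_in_H_def carrier_H graph_shears_def U_def by (auto simp: center_coset inj)
  ultimately show "T \<in> preimage_in_H E vclass ` complement_subgroups CARD('a) E vclass" by blast
qed

section \<open>Symplectic frames\<close>

definition point_of :: "('a::field)^4 \<Rightarrow> ('a^4) set" where
  "point_of v = vec.span {v}"

lemma mem_point_of: "u \<in> point_of v \<longleftrightarrow> (\<exists>k. u = k *s v)"
  by (auto simp: point_of_def vec.span_singleton)

lemma self_mem_point_of [simp]: "v \<in> point_of v"
  by (simp add: point_of_def vec.span_base)

lemma point_of_subset: "vec.subspace U \<Longrightarrow> point_of v \<subseteq> U \<longleftrightarrow> v \<in> U"
  using vec.span_minimal[of "{v}" U] self_mem_point_of[of v] unfolding point_of_def by blast

lemma dim_point_of: "v \<noteq> 0 \<Longrightarrow> vec.dim (point_of v) = 1"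
  unfolding point_of_def by (simp add: vec.dim_span_eq_card_independent)

lemma pg_points_eq: "pg_points = {point_of v | v. v \<noteq> 0}"
proof (intro equalityI subsetI)
  fix U :: "('a^4) set" assume "U \<in> pg_points"
  then have U: "vec.subspace U" "vec.dim U = 1" by (auto simp: pg_points_def)
  obtain B where B: "B \<subseteq> U" "vec.independent B" "U \<subseteq> vec.span B" "card B = vec.dim U"
    using vec.basis_exists by blast
  then obtain v where v: "B = {v}" using U by (auto simp: card_1_singleton_iff)
  have "U = vec.span B" using B U vec.span_minimal by blast
  moreover have "v \<noteq> 0" using B v vec.dependent_zero by blast
  ultimately show "U \<in> {point_of v | v. v \<noteq> 0}" using v by (auto simp: point_of_def)
next
  fix U :: "('a^4) set" assume "U \<in> {point_of v | v. v \<noteq> 0}"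
  then obtain v where "v \<noteq> 0" "U = point_of v" by blast
  then show "U \<in> pg_points"
    using dim_point_of[of v] by (simp add: pg_points_def point_of_def)
qed

lemma point_of_in_pg_points: "v \<noteq> 0 \<Longrightarrow> point_of v \<in> pg_points"
  by (auto simp: pg_points_eq)

lemma point_of_scale: "k \<noteq> 0 \<Longrightarrow> point_of (k *s v) = point_of v"
proof (intro equalityI subsetI)
  fix u assume k: "k \<noteq> 0" and "u \<in> point_of v"
  then obtain j where "u = j *s v" by (auto simp: mem_point_of)
  then have "u = (j / k) *s (k *s v)" using k by simp
  then show "u \<in> point_of (k *s v)" unfolding mem_point_of by blast
qed (auto simp: mem_point_of)

lemma point_of_eqD:
  assumes "point_of u = point_of v" "u \<noteq> 0"
  obtains k where "k \<noteq> 0" "u = k *s v"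
proof -
  have "u \<in> point_of v" using assms(1) by (metis self_mem_point_of)
  then obtain k where "u = k *s v" by (auto simp: mem_point_of)
  moreover have "k \<noteq> 0" using calculation assms(2) by auto
  ultimately show ?thesis using that by blast
qed

lemma symplectic_form_bilinear:
  assumes "symplectic_form \<beta>"
  shows "\<beta> (u + u') v = \<beta> u v + \<beta> u' v" "\<beta> (k *s u) v = k * \<beta> u v"
    "\<beta> u (v + v') = \<beta> u v + \<beta> u v'" "\<beta> u (k *s v) = k * \<beta> u v" "\<beta> u u = 0"
  using assms unfolding symplectic_form_def Vector_Spaces.linear_iff by auto

lemma symplectic_form_skew:
  assumes "symplectic_form \<beta>"
  shows "\<beta> v u = - \<beta> u v"
proof -
  note bil = symplectic_form_bilinear[OF assms]
  have "\<beta> u v + \<beta> v u = \<beta> (u + v) (u + v)"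
    unfolding bil(1) bil(3) bil(5)[of u] bil(5)[of v] by simp
  also have "\<dots> = 0" by (rule bil)
  finally have "\<beta> u v + \<beta> v u = 0" .
  then show ?thesis by (simp add: eq_neg_iff_add_eq_0 add.commute)
qed

lemma symplectic_quadrangle_simps [simp]:
  "Points (symplectic_quadrangle \<beta>) = pg_points"
  "Inc (symplectic_quadrangle \<beta>) = (\<in>)"
  by (simp_all add: symplectic_quadrangle_def)

lemma symplectic_quadrangle_lines: "l \<in> Lines (symplectic_quadrangle \<beta>) \<Longrightarrow> l \<subseteq> Points (symplectic_quadrangle \<beta>)"
  by (auto simp: symplectic_quadrangle_def)

lemma isotropic_line_exists:
  assumes \<beta>: "symplectic_form \<beta>" and u: "u \<noteq> 0" and w: "w \<notin> point_of u" and uw: "\<beta> u w = 0"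
  shows "\<exists>l\<in>Lines (symplectic_quadrangle \<beta>). point_of u \<in> l \<and> point_of w \<in> l"
proof -
  note bil = symplectic_form_bilinear[OF \<beta>]
  have ind: "vec.independent {w, u}"
    using u w by (simp add: vec.independent_insert point_of_def)
  have ne: "w \<noteq> u" using w by auto
  define L where "L = vec.span {w, u}"
  have dim: "vec.dim L = 2"
    unfolding L_def using vec.dim_span_eq_card_independent[OF ind] ne by simp
  have "\<exists>a b. z = a *s u + b *s w" if "z \<in> L" for z
  proof -
    have "z \<in> {z. \<exists>k. z - k *s w \<in> vec.span {u}}"
      using that unfolding L_def vec.span_insert[of w "{u}"] .
    then obtain k j where "z - k *s w = j *s u" by (auto simp: vec.span_singleton)
    then have "z = j *s u + k *s w" by (simp add: algebra_simps)
    then show ?thesis by blast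
  qed
  note L = this
  have wu: "\<beta> w u = 0" using symplectic_form_skew[OF \<beta>, of w u] uw by simp
  have iso: "\<forall>y\<in>L. \<forall>z\<in>L. \<beta> y z = 0"
  proof (intro ballI)
    fix y z assume "y \<in> L" "z \<in> L"
    then obtain a b c d where "y = a *s u + b *s w" "z = c *s u + d *s w" using L by blast
    then show "\<beta> y z = 0" by (simp add: bil uw wu)
  qed
  have "u \<in> L" "w \<in> L" by (auto simp: L_def vec.span_base)
  then have "point_of u \<subseteq> L" "point_of w \<subseteq> L"
    using point_of_subset[of L] by (auto simp: L_def)
  moreover have "w \<noteq> 0"
  proof
    assume "w = 0"
    then have "w = 0 *s u" by simp
    then show False using w unfolding mem_point_of by blast
  qed
  ultimately have mem: "point_of u \<in> {p \<in> pg_points. p \<subseteq> L}" "point_of w \<in> {p \<in> pg_points. p \<subseteq> L}"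
    using u by (simp_all add: point_of_in_pg_points)
  have "vec.subspace L" by (simp add: L_def)
  then have line: "{p \<in> pg_points. p \<subseteq> L} \<in> Lines (symplectic_quadrangle \<beta>)"
    using dim iso unfolding symplectic_quadrangle_def by auto
  show ?thesis by (rule bexI[OF _ line]) (rule conjI[OF mem])
qed

text \<open>\<open>e0\<close>, \<open>e3\<close> and \<open>e1\<close>, \<open>e2\<close> are two
  mutually orthogonal hyperbolic pairs. Independence follows from these values of the form, and
  spanning from counting vectors.\<close>

locale symp_frame =
  fixes \<beta> :: "('a::{field,finite})^4 \<Rightarrow> 'a^4 \<Rightarrow> 'a" and e0 e1 e2 e3 :: "'a^4"
  assumes symp: "symplectic_form \<beta>"
    and frame: "\<beta> e0 e3 = 1" "\<beta> e1 e2 = 1" "\<beta> e0 e1 = 0" "\<beta> e0 e2 = 0" "\<beta> e1 e3 = 0" "\<beta> e2 e3 = 0"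

lemmas (in symp_frame) bil = symplectic_form_bilinear[OF symp]

definition (in symp_frame) "V r0 r1 r2 r3 = r0 *s e0 + r1 *s e1 + r2 *s e2 + r3 *s e3"

abbreviation (in symp_frame) "W \<equiv> symplectic_quadrangle \<beta>"
abbreviation (in symp_frame) "x \<equiv> vec.span {e3}"
abbreviation (in symp_frame) "P \<equiv> payne_derived W x"
abbreviation (in symp_frame) "Pl \<equiv> plane_at W x"

lemma (in symp_frame) form_V:
  "\<beta> (V r0 r1 r2 r3) (V s0 s1 s2 s3) = r0 * s3 - r3 * s0 + r1 * s2 - r2 * s1"
proof -
  have sk: "\<beta> e3 e0 = - 1" "\<beta> e2 e1 = - 1" "\<beta> e1 e0 = 0" "\<beta> e2 e0 = 0" "\<beta> e3 e1 = 0" "\<beta> e3 e2 = 0"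
    using frame symplectic_form_skew[OF symp] by (metis neg_equal_0_iff_equal)+
  show ?thesis unfolding V_def by (simp add: bil frame sk)
qed

lemma (in symp_frame) V_inject: "V r0 r1 r2 r3 = V s0 s1 s2 s3 \<longleftrightarrow> r0 = s0 \<and> r1 = s1 \<and> r2 = s2 \<and> r3 = s3"
proof
  assume eq: "V r0 r1 r2 r3 = V s0 s1 s2 s3"
  have "\<beta> (V r0 r1 r2 r3) (V a b c d) = \<beta> (V s0 s1 s2 s3) (V a b c d)" for a b c d
    using eq by simp
  from this[of 0 0 0 1] this[of 0 0 1 0] this[of 0 1 0 0] this[of 1 0 0 0]
  show "r0 = s0 \<and> r1 = s1 \<and> r2 = s2 \<and> r3 = s3" by (simp add: form_V)
qed simp

lemma (in symp_frame) V_cases: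
  obtains r0 r1 r2 r3 where "v = V r0 r1 r2 r3"
proof -
  define f where "f = (\<lambda>(r0, r1, r2, r3). V r0 r1 r2 r3)"
  have "inj f" by (auto simp: inj_on_def f_def V_inject)
  \<comment> \<open>The combinations of the frame are as many as there are vectors.\<close>
  then have "card (range f) = CARD('a \<times> 'a \<times> 'a \<times> 'a)" by (rule card_image)
  also have "\<dots> = CARD('a^4)" by (simp add: CARD_vec power4_eq_xxxx)
  finally have "range f = UNIV" by (intro card_eq_UNIV_imp_eq_UNIV) auto
  then obtain r where "v = f r" by (metis rangeE UNIV_I)
  then show ?thesis using that by (cases r) (auto simp: f_def)
qed

lemma (in symp_frame) V_zero: "V 0 0 0 0 = 0"
  by (simp add: V_def)

lemma (in symp_frame) V_eq_0_iff: "V r0 r1 r2 r3 = 0 \<longleftrightarrow> r0 = 0 \<and> r1 = 0 \<and> r2 = 0 \<and> r3 = 0"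
  using V_inject[of r0 r1 r2 r3 0 0 0 0] by (simp add: V_zero)

lemma (in symp_frame) V_scale: "k *s V r0 r1 r2 r3 = V (k * r0) (k * r1) (k * r2) (k * r3)"
  by (simp add: V_def vec.scale_right_distrib)

lemma (in symp_frame) V_add:
  "V r0 r1 r2 r3 + V s0 s1 s2 s3 = V (r0 + s0) (r1 + s1) (r2 + s2) (r3 + s3)"
  by (simp add: V_def vec.scale_left_distrib algebra_simps)

lemma (in symp_frame) V_frame: "V 1 0 0 0 = e0" "V 0 1 0 0 = e1" "V 0 0 1 0 = e2" "V 0 0 0 1 = e3"
  by (simp_all add: V_def)

lemma (in symp_frame) x_eq: "x = point_of (V 0 0 0 1)"
  by (simp add: V_frame point_of_def)

lemma (in symp_frame) x_point: "x \<in> pg_points"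
  unfolding x_eq by (rule point_of_in_pg_points) (simp add: V_eq_0_iff)

lemma (in symp_frame) collinear_iff:
  assumes u: "u \<noteq> 0" and v: "v \<noteq> 0"
  shows "collinear_in W (point_of u) (point_of v) \<longleftrightarrow> \<beta> u v = 0"
proof
  assume "collinear_in W (point_of u) (point_of v)"
  then obtain L where "point_of u \<subseteq> L" "point_of v \<subseteq> L" "\<forall>u\<in>L. \<forall>v\<in>L. \<beta> u v = 0"
    by (auto simp: collinear_in_def symplectic_quadrangle_def)
  moreover have "u \<in> point_of u" "v \<in> point_of v" by simp_all
  ultimately show "\<beta> u v = 0" by blast
next
  assume uv: "\<beta> u v = 0"
  show "collinear_in W (point_of u) (point_of v)"
  proof (cases "v \<in> point_of u")
    case False
    then show ?thesis using isotropic_line_exists[OF symp u False uv] by (auto simp: collinear_in_def)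
  next
    case True
    then obtain k where k: "v = k *s u" by (auto simp: mem_point_of)
    then have "k \<noteq> 0" using v by auto
    then have same: "point_of v = point_of u" using k by (simp add: point_of_scale)
    obtain r0 r1 r2 r3 where r: "u = V r0 r1 r2 r3" by (rule V_cases)
    \<comment> \<open>When the two points coincide, some totally isotropic line through the point
      must be exhibited. In the last case, the component of \<open>u\<close> in one hyperbolic plane
      is orthogonal to \<open>u\<close> and not proportional to it.\<close>
    have "\<exists>w. w \<notin> point_of u \<and> \<beta> u w = 0"
    proof -
      consider "r0 = 0" "r3 = 0" | "r1 = 0" "r2 = 0" | "r0 \<noteq> 0 \<or> r3 \<noteq> 0" "r1 \<noteq> 0 \<or> r2 \<noteq> 0" by blast
      then show ?thesis
      proof cases
        case 1
        then show ?thesis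
          by (intro exI[of _ "V 1 0 0 0"]) (simp add: r form_V mem_point_of V_scale V_inject)
      next
        case 2
        then show ?thesis
          by (intro exI[of _ "V 0 1 0 0"]) (simp add: r form_V mem_point_of V_scale V_inject)
      next
        case 3
        then show ?thesis
          by (intro exI[of _ "V r0 0 0 r3"]) (auto simp: r form_V mem_point_of V_scale V_inject)
      qed
    qed
    then show ?thesis
      using isotropic_line_exists[OF symp u] unfolding same by (auto simp: collinear_in_def)
  qed
qed

section \<open>Coordinates on the derived quadrangle and on the plane at x\<close>

fun (in symp_frame) pp :: "'a \<times> 'a \<times> 'a \<Rightarrow> ('a^4) set" where
  "pp (a, b, c) = point_of (V 1 a b c)"

lemma (in symp_frame) inj_pp: "inj pp"
proof (rule injI)
  fix y z assume eq: "pp y = pp z"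
  obtain a b c a' b' c' where yz: "y = (a, b, c)" "z = (a', b', c')" by (metis surj_pair)
  have "point_of (V 1 a b c) = point_of (V 1 a' b' c')" using eq yz by simp
  then obtain k where "V 1 a b c = k *s V 1 a' b' c'"
    by (rule point_of_eqD) (auto simp: V_eq_0_iff)
  then show "y = z" by (auto simp: yz V_scale V_inject)
qed

lemma (in symp_frame) collinear_x: "collinear_in W x (point_of (V r0 r1 r2 r3)) \<longleftrightarrow> r0 = 0"
  if "V r0 r1 r2 r3 \<noteq> 0"
  unfolding x_eq using that by (subst collinear_iff) (auto simp: V_eq_0_iff form_V)

lemma (in symp_frame) payne_Points: "Points P = range pp"
proof (intro equalityI subsetI)
  fix y assume "y \<in> Points P"
  then have y: "y \<in> pg_points" "\<not> collinear_in W x y" by (auto simp: payne_derived_def)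
  then obtain v where v: "v \<noteq> 0" "y = point_of v" by (auto simp: pg_points_eq)
  obtain r0 r1 r2 r3 where r: "v = V r0 r1 r2 r3" by (rule V_cases)
  have r0: "r0 \<noteq> 0" using y v r collinear_x by auto
  then have "V 1 (r1 / r0) (r2 / r0) (r3 / r0) = (1 / r0) *s v" by (simp add: r V_scale)
  then have "pp (r1 / r0, r2 / r0, r3 / r0) = y" using r0 v by (simp add: point_of_scale)
  then show "y \<in> range pp" by (metis rangeI)
next
  fix y assume "y \<in> range pp"
  then obtain a b c where y: "y = point_of (V 1 a b c)" by auto
  have "V 1 a b c \<noteq> 0" by (simp add: V_eq_0_iff)
  then show "y \<in> Points P"
    unfolding y by (simp add: payne_derived_def collinear_x point_of_in_pg_points)
qed

lemma (in symp_frame) collinear_pp: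
  "collinear_in W (pp (a, b, c)) (pp (a', b', c')) \<longleftrightarrow> c' - c = b * a' - a * b'"
  using collinear_iff[of "V 1 a b c" "V 1 a' b' c'"] by (simp add: V_eq_0_iff form_V algebra_simps)

lemma (in symp_frame) perp_x: "perp W {x} = {point_of (V 0 r1 r2 r3) | r1 r2 r3. V 0 r1 r2 r3 \<noteq> 0}"
proof (intro equalityI subsetI)
  fix y assume "y \<in> perp W {x}"
  then have y: "y \<in> pg_points" "collinear_in W y x" by (auto simp: perp_def)
  then have c: "collinear_in W x y" by (auto simp: collinear_in_def)
  obtain v where v: "v \<noteq> 0" "y = point_of v" using y by (auto simp: pg_points_eq)
  obtain r0 r1 r2 r3 where r: "v = V r0 r1 r2 r3" by (rule V_cases)
  show "y \<in> {point_of (V 0 r1 r2 r3) | r1 r2 r3. V 0 r1 r2 r3 \<noteq> 0}"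
    using c v r collinear_x by auto
next
  fix y assume "y \<in> {point_of (V 0 r1 r2 r3) | r1 r2 r3. V 0 r1 r2 r3 \<noteq> 0}"
  then obtain r1 r2 r3 where y: "y = point_of (V 0 r1 r2 r3)" "V 0 r1 r2 r3 \<noteq> 0" by blast
  then have "collinear_in W x y" using collinear_x by blast
  then show "y \<in> perp W {x}"
    using y point_of_in_pg_points by (auto simp: perp_def collinear_in_def)
qed

text \<open>The last coordinate \<open>c\<close> does not enter the condition, so the points of the
  plane at \<open>x\<close> are labelled by pairs \<open>(a, b)\<close>.\<close>

lemma (in symp_frame) perp_x_pp: "perp W {x, pp (a, b, c)} =
    {point_of (V 0 r1 r2 r3) | r1 r2 r3. V 0 r1 r2 r3 \<noteq> 0 \<and> r3 = r1 * b - r2 * a}"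
proof -
  have eq: "perp W {x, pp (a, b, c)} = {y \<in> perp W {x}. collinear_in W y (pp (a, b, c))}"
    by (auto simp: perp_def)
  have c: "collinear_in W (point_of (V 0 r1 r2 r3)) (pp (a, b, c)) \<longleftrightarrow> r3 = r1 * b - r2 * a"
    if "V 0 r1 r2 r3 \<noteq> 0" for r1 r2 r3
  proof -
    have "collinear_in W (point_of (V 0 r1 r2 r3)) (pp (a, b, c)) \<longleftrightarrow> \<beta> (V 0 r1 r2 r3) (V 1 a b c) = 0"
      using that collinear_iff[of "V 0 r1 r2 r3" "V 1 a b c"] by (simp add: V_eq_0_iff)
    also have "\<beta> (V 0 r1 r2 r3) (V 1 a b c) = (r1 * b - r2 * a) - r3" by (simp add: form_V)
    finally show ?thesis by auto
  qed
  show ?thesis unfolding eq perp_x using c by blast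
qed

lemma (in symp_frame) mem_perp_x_pp:
  assumes "V 0 r1 r2 r3 \<noteq> 0"
  shows "point_of (V 0 r1 r2 r3) \<in> perp W {x, pp (a, b, c)} \<longleftrightarrow> r3 = r1 * b - r2 * a"
proof
  assume "point_of (V 0 r1 r2 r3) \<in> perp W {x, pp (a, b, c)}"
  then obtain s1 s2 s3 where s: "point_of (V 0 r1 r2 r3) = point_of (V 0 s1 s2 s3)" "s3 = s1 * b - s2 * a"
    unfolding perp_x_pp by blast
  obtain k where "V 0 r1 r2 r3 = k *s V 0 s1 s2 s3" using point_of_eqD[OF s(1) assms] by blast
  then show "r3 = r1 * b - r2 * a" using s(2) by (simp add: V_scale V_inject algebra_simps)
next
  assume "r3 = r1 * b - r2 * a"
  then show "point_of (V 0 r1 r2 r3) \<in> perp W {x, pp (a, b, c)}"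
    unfolding perp_x_pp using assms by blast
qed

definition (in symp_frame) "plp v = perp W {x, pp (fst v, snd v, 0)}"

lemma (in symp_frame) perp_x_pp_eq_plp: "perp W {x, pp (a, b, c)} = plp (a, b)"
  unfolding plp_def perp_x_pp fst_conv snd_conv ..

lemma (in symp_frame) mem_plp:
  assumes "V 0 r1 r2 r3 \<noteq> 0"
  shows "point_of (V 0 r1 r2 r3) \<in> plp (a, b) \<longleftrightarrow> r3 = r1 * b - r2 * a"
  unfolding plp_def fst_conv snd_conv by (rule mem_perp_x_pp[OF assms])

lemma (in symp_frame) plane_Points: "Points Pl = range plp"
proof -
  have "Points Pl = {perp W {x, z} | z. z \<in> Points P}"
    by (auto simp: plane_at_def payne_derived_def)
  also have "\<dots> = {perp W {x, pp y} | y. True}" unfolding payne_Points by blast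
  also have "\<dots> = range plp"
  proof (intro equalityI subsetI)
    fix y assume "y \<in> {perp W {x, pp y} | y. True}"
    then obtain a b c where "y = perp W {x, pp (a, b, c)}" by auto
    then show "y \<in> range plp" unfolding perp_x_pp_eq_plp by blast
  next
    fix y assume "y \<in> range plp"
    then show "y \<in> {perp W {x, pp y} | y. True}" unfolding plp_def by blast
  qed
  finally show ?thesis .
qed

lemma (in symp_frame) plane_Lines:
  "Lines Pl = {point_of (V 0 0 1 g) | g. True} \<union> {point_of (V 0 1 k n) | k n. True}"
proof -
  have L: "Lines Pl = perp W {x} - {x}" by (simp add: plane_at_def)
  show ?thesis
    unfolding L
  proof (intro equalityI subsetI)
    fix y assume y: "y \<in> perp W {x} - {x}"
    then obtain r1 r2 r3 where r: "y = point_of (V 0 r1 r2 r3)" "V 0 r1 r2 r3 \<noteq> 0"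
      unfolding perp_x by blast
    consider "r1 \<noteq> 0" | "r1 = 0" "r2 \<noteq> 0" | "r1 = 0" "r2 = 0" "r3 \<noteq> 0"
      using r(2) V_eq_0_iff by blast
    then show "y \<in> {point_of (V 0 0 1 g) | g. True} \<union> {point_of (V 0 1 k n) | k n. True}"
    proof cases
      case 1
      then have "y = point_of ((1 / r1) *s V 0 r1 r2 r3)" using r by (simp add: point_of_scale)
      then have "y = point_of (V 0 1 (r2 / r1) (r3 / r1))" using 1 by (simp add: V_scale)
      then show ?thesis by blast
    next
      case 2
      then have "y = point_of ((1 / r2) *s V 0 r1 r2 r3)" using r by (simp add: point_of_scale)
      then have "y = point_of (V 0 0 1 (r3 / r2))" using 2 by (simp add: V_scale)
      then show ?thesis by blast
    next
      case 3
      then have "y = point_of ((1 / r3) *s V 0 r1 r2 r3)" using r by (simp add: point_of_scale)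
      then have "y = x" using 3 by (simp add: V_scale x_eq)
      then show ?thesis using y by blast
    qed
  next
    fix y assume "y \<in> {point_of (V 0 0 1 g) | g. True} \<union> {point_of (V 0 1 k n) | k n. True}"
    then obtain r1 r2 r3 where y: "y = point_of (V 0 r1 r2 r3)" and r: "r1 = 1 \<or> r2 = 1" by blast
    have n0: "V 0 r1 r2 r3 \<noteq> 0" using r by (auto simp: V_eq_0_iff)
    have "y \<noteq> x"
    proof
      assume "y = x"
      then have "point_of (V 0 r1 r2 r3) = point_of (V 0 0 0 1)" unfolding y x_eq .
      then obtain k where "V 0 r1 r2 r3 = k *s V 0 0 0 1" using n0 by (rule point_of_eqD)
      then show False using r by (auto simp: V_scale V_inject)
    qed
    then show "y \<in> perp W {x} - {x}" unfolding perp_x using y n0 by blast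
  qed
qed

text \<open>Both formulas are the incidence condition \<open>r3 = r1 * b - r2 * a\<close> read for
  fixed coefficients; the sign in the vertical case comes from there.\<close>

lemma (in symp_frame) line_pts_plane:
  "line_pts Pl plp (point_of (V 0 0 1 g)) = vertical (- g)"
  "line_pts Pl plp (point_of (V 0 1 k n)) = sloped k n"
proof -
  have I: "Inc Pl q y \<longleftrightarrow> y \<in> q" for q y by (simp add: plane_at_def)
  have "v \<in> line_pts Pl plp (point_of (V 0 0 1 g)) \<longleftrightarrow> v \<in> vertical (- g)" for v
    by (cases v) (auto simp: line_pts_def I mem_plp V_eq_0_iff vertical_def)
  then show "line_pts Pl plp (point_of (V 0 0 1 g)) = vertical (- g)" by blast
  have "v \<in> line_pts Pl plp (point_of (V 0 1 k n)) \<longleftrightarrow> v \<in> sloped k n" for v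
    by (cases v) (auto simp: line_pts_def I mem_plp V_eq_0_iff sloped_def)
  then show "line_pts Pl plp (point_of (V 0 1 k n)) = sloped k n" by blast
qed

lemma (in symp_frame) inj_plp: "inj plp"
proof (rule injI)
  fix v w assume eq: "plp v = plp w"
  obtain a b a' b' where vw: "v = (a, b)" "w = (a', b')" by (metis surj_pair)
  have "V 0 1 0 b \<noteq> 0" "V 0 0 1 (- a) \<noteq> 0" by (simp_all add: V_eq_0_iff)
  from mem_plp[OF this(1)] mem_plp[OF this(2)] have
    "point_of (V 0 1 0 b) \<in> plp v" "point_of (V 0 0 1 (- a)) \<in> plp v"
    "point_of (V 0 1 0 b) \<in> plp w \<longleftrightarrow> b = b'" "point_of (V 0 0 1 (- a)) \<in> plp w \<longleftrightarrow> a = a'"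
    by (simp_all add: vw)
  moreover have "plp v = plp w" by (rule eq)
  ultimately show "v = w" by (simp add: vw)
qed

lemma (in symp_frame) coord_plane_Pl: "coord_plane Pl plp"
proof
  show "inj plp" by (rule inj_plp)
  show "Points Pl = range plp" by (rule plane_Points)
  show "(\<exists>a. line_pts Pl plp l = vertical a) \<or> (\<exists>k n. line_pts Pl plp l = sloped k n)"
    if "l \<in> Lines Pl" for l
    using that unfolding plane_Lines using line_pts_plane by blast
  show "\<exists>l\<in>Lines Pl. line_pts Pl plp l = vertical a" for a
  proof
    show "line_pts Pl plp (point_of (V 0 0 1 (- a))) = vertical a" by (simp add: line_pts_plane)
    show "point_of (V 0 0 1 (- a)) \<in> Lines Pl" unfolding plane_Lines by blast
  qed
  show "\<exists>l\<in>Lines Pl. line_pts Pl plp l = sloped k n" for k n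
  proof
    show "line_pts Pl plp (point_of (V 0 1 k n)) = sloped k n" by (rule line_pts_plane)
    show "point_of (V 0 1 k n) \<in> Lines Pl" unfolding plane_Lines by blast
  qed
  fix l m assume "l \<in> Lines Pl" "m \<in> Lines Pl" and eq: "line_pts Pl plp l = line_pts Pl plp m"
  then consider g g' where "l = point_of (V 0 0 1 g)" "m = point_of (V 0 0 1 g')"
    | g k n where "l = point_of (V 0 0 1 g)" "m = point_of (V 0 1 k n)"
    | g k n where "m = point_of (V 0 0 1 g)" "l = point_of (V 0 1 k n)"
    | k n k' n' where "l = point_of (V 0 1 k n)" "m = point_of (V 0 1 k' n')"
    unfolding plane_Lines by blast
  then show "l = m"
  proof cases
    case 1
    then show ?thesis using eq by (simp add: line_pts_plane vertical_eq_iff)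
  next
    case (2 g k n)
    then show ?thesis using eq vertical_ne_sloped[of "- g" k n] by (simp add: line_pts_plane)
  next
    case (3 g k n)
    then show ?thesis using eq vertical_ne_sloped[of "- g" k n, symmetric] by (simp add: line_pts_plane)
  next
    case 4
    then show ?thesis using eq by (simp add: line_pts_plane sloped_eq_iff)
  qed
qed

abbreviation (in symp_frame) "vcl \<equiv> coord_plane.vclass Pl plp"

text \<open>The link between frames and points at infinity: choosing \<open>e2\<close> amounts to
  choosing which point at infinity is the vertical one.\<close>

lemma (in symp_frame) plane_class: "parallel_class Pl (point_of e2) = vcl"
proof -
  interpret C: coord_plane Pl plp by (rule coord_plane_Pl)
  have "point_of e2 = point_of (V 0 0 1 0)" by (simp add: V_frame)
  moreover have "point_of (V 0 0 1 0) \<in> Lines Pl" unfolding plane_Lines by blast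
  ultimately show ?thesis using C.parallel_class_vertical line_pts_plane(1)[of 0] by simp
qed

section \<open>The stabilizer of x acting on coordinates\<close>

lemma (in symp_frame) stabilizer_pp:
  assumes "f \<in> point_stabilizer W x"
  shows "\<exists>\<kappa>. \<forall>y. f (pp y) = pp (\<kappa> y)"
proof -
  have "f ` range pp = range pp"
    using point_stabilizer_payne_Points[OF assms] x_point unfolding payne_Points by simp
  then have "\<forall>y. \<exists>z. f (pp y) = pp z" by blast
  then show ?thesis by (rule choice)
qed

lemma (in symp_frame) pp_point: "pp y \<in> pg_points"
proof -
  have "pp y \<in> Points P" unfolding payne_Points by (rule rangeI)
  then show ?thesis by (simp add: payne_derived_def)
qed

lemma (in symp_frame) stabilizer_plane:
  assumes f: "f \<in> point_stabilizer W x" and k: "f (pp (a, b, c)) = pp (a', b', c')"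
  shows "induced_on_plane W x f (plp (a, b)) = plp (a', b')"
proof -
  have fa: "f \<in> automorphisms W" and fx: "f x = x" using f by (auto simp: point_stabilizer_def)
  have sub: "{x, pp (a, b, c)} \<subseteq> Points W" using x_point pp_point[of "(a, b, c)"] by simp
  have "f ` perp W {x, pp (a, b, c)} = perp W (f ` {x, pp (a, b, c)})"
    by (rule automorphism_perp[OF fa sub])
  also have "f ` {x, pp (a, b, c)} = {x, pp (a', b', c')}"
    unfolding image_insert image_empty fx k ..
  finally have "f ` plp (a, b) = plp (a', b')" unfolding perp_x_pp_eq_plp .
  moreover have "plp (a, b) \<in> Points Pl" unfolding plane_Points by (rule rangeI)
  ultimately show ?thesis by (simp add: induced_on_plane_def)
qed

lemma (in symp_frame) induced_on_payne_transport:
  assumes "\<And>y. f (pp y) = pp (\<kappa> y)"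
  shows "induced_on_payne W x f = transport pp \<kappa>"
  unfolding induced_on_payne_def payne_Points
  by (rule transport_eqI[OF inj_pp]) (simp_all add: assms)

text \<open>The first two coordinates are prescribed by the shear, and connectedness through
  isotropic lines determines the third up to the constant \<open>w\<close>. This applies to all
  automorphisms in the stabilizer; linearity is a consequence.\<close>

lemma (in symp_frame) induced_shear:
  assumes f: "f \<in> point_stabilizer W x" and sh: "induced_on_plane W x f = transport plp (shear s t u)"
  shows "\<exists>w. induced_on_payne W x f = transport pp (unipotent_map s t u w)"
proof -
  have fa: "f \<in> automorphisms W" using f by (auto simp: point_stabilizer_def)
  obtain \<kappa> where "\<forall>y. f (pp y) = pp (\<kappa> y)" using stabilizer_pp[OF f] by (rule exE)
  then have \<kappa>: "f (pp y) = pp (\<kappa> y)" for y by (rule spec)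
  have k: "fst (\<kappa> (a, b, c)) = a + s \<and> fst (snd (\<kappa> (a, b, c))) = b + t * a + u" for a b c
  proof -
    obtain a' b' c' where e: "\<kappa> (a, b, c) = (a', b', c')" by (metis surj_pair)
    have "plp (a', b') = induced_on_plane W x f (plp (a, b))"
      using stabilizer_plane[OF f] \<kappa>[of "(a, b, c)"] e by metis
    also have "\<dots> = plp (a + s, b + t * a + u)" unfolding sh transport_apply[OF inj_plp] by simp
    finally have "(a', b') = (a + s, b + t * a + u)" by (rule injD[OF inj_plp])
    then show ?thesis using e by simp
  qed
  \<comment> \<open>The deviation from the third coordinate of the unipotent map with
    \<open>w = 0\<close>.\<close>
  define D where "D y = snd (snd (\<kappa> y)) - (snd (snd y) + (u - s * t) * fst y - s * fst (snd y))" for y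
  have D: "D y = D (0, 0, 0)" for y
  proof (rule payne_graph_connected[of D])
    fix y z :: "'a \<times> 'a \<times> 'a" assume c: "payne_coll y z" and ns: "\<not> same_fibre y z"
    obtain a b c a' b' c' where yz: "y = (a, b, c)" "z = (a', b', c')" by (metis surj_pair)
    have cc: "c' - c = b * a' - a * b'" using c ns yz by auto
    have "collinear_in W (f (pp y)) (f (pp z))"
      using automorphism_collinear[OF fa, of "pp y" "pp z"] pp_point cc collinear_pp unfolding yz by auto
    then have "collinear_in W (pp (\<kappa> y)) (pp (\<kappa> z))" unfolding \<kappa> .
    moreover obtain d where d: "\<kappa> y = (a + s, b + t * a + u, d)" using k[of a b c] yz by (metis prod.collapse)
    moreover obtain d' where d': "\<kappa> z = (a' + s, b' + t * a' + u, d')" using k[of a' b' c'] yz by (metis prod.collapse)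
    ultimately have "d' - d = (b + t * a + u) * (a' + s) - (a + s) * (b' + t * a' + u)"
      using collinear_pp by metis
    then have e1: "d' = d + ((b + t * a + u) * (a' + s) - (a + s) * (b' + t * a' + u))"
      by (metis diff_add_cancel add.commute)
    have e2: "c' = c + (b * a' - a * b')" using cc by (metis diff_add_cancel add.commute)
    show "D y = D z"
      unfolding D_def unfolding d d' unfolding yz fst_conv snd_conv e1 unfolding e2
      by (simp add: algebra_simps)
  qed
  have "\<kappa> y = unipotent_map s t u (D (0, 0, 0)) y" for y
  proof -
    obtain a b c where y: "y = (a, b, c)" by (metis surj_pair)
    have "snd (snd (\<kappa> y)) = c + (u - s * t) * a - s * b + D (0, 0, 0)"
    proof -
      have "snd (snd (\<kappa> y)) = c + (u - s * t) * a - s * b + D y" by (simp add: D_def y)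
      then show ?thesis unfolding D[of y] .
    qed
    then show ?thesis using k[of a b c] unfolding y by (simp add: prod_eq_iff)
  qed
  then have "induced_on_payne W x f = transport pp (unipotent_map s t u (D (0, 0, 0)))"
    using \<kappa> by (intro induced_on_payne_transport) metis
  then show ?thesis by blast
qed

section \<open>Similitudes fixing x\<close>

lemma image_point_of:
  assumes "Vector_Spaces.linear (*s) (*s) g"
  shows "g ` point_of v = point_of (g v)"
  using vec.linear_span_image[OF assms, of "{v}"] by (simp add: point_of_def)

lemma similitude_point_map:
  assumes lin: "Vector_Spaces.linear (*s) (*s) g" and bij: "bij (g :: ('a::{field,finite})^4 \<Rightarrow> 'a^4)"
  shows "restrict (\<lambda>p. g ` p) pg_points \<in> Bij pg_points"
proof -
  have inj: "inj g" using bij by (rule bij_is_inj)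
  have g0: "g v \<noteq> 0" if "v \<noteq> 0" for v
    using inj vec.linear_0[OF lin] that by (metis injD)
  have sub: "(\<lambda>p. g ` p) ` pg_points \<subseteq> pg_points"
  proof (rule image_subsetI)
    fix p :: "('a^4) set" assume "p \<in> pg_points"
    then obtain v where "p = point_of v" "v \<noteq> 0" by (auto simp: pg_points_eq)
    then show "g ` p \<in> pg_points" using g0 by (simp add: image_point_of[OF lin] point_of_in_pg_points)
  qed
  have i: "inj_on (\<lambda>p. g ` p) pg_points" using inj by (auto intro!: inj_onI simp: inj_image_eq_iff)
  have "(\<lambda>p. g ` p) ` pg_points = pg_points"
    by (rule endo_inj_surj[OF _ sub i]) simp
  then show ?thesis using i by (simp add: Bij_def bij_betw_def inj_on_restrict_eq)
qed

lemma similitude_automorphism: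
  assumes lin: "Vector_Spaces.linear (*s) (*s) g" and bij: "bij (g :: ('a::{field,finite})^4 \<Rightarrow> 'a^4)"
    and sim: "\<And>u v. \<beta> (g u) (g v) = c * \<beta> u v"
  shows "restrict (\<lambda>p. g ` p) pg_points \<in> automorphisms (symplectic_quadrangle \<beta>)"
proof -
  have inj: "inj g" using bij by (rule bij_is_inj)
  let ?f = "\<lambda>p. g ` p"
  have B: "restrict ?f pg_points \<in> Bij pg_points" by (rule similitude_point_map[OF lin bij])
  then have surj: "?f ` pg_points = pg_points" by (simp add: Bij_def bij_betw_def)
  have injF: "inj ?f" by (rule injI) (simp add: inj_image_eq_iff[OF inj])
  then have injf: "?f ` l = ?f ` m \<Longrightarrow> l = m" for l m by (simp add: inj_image_eq_iff)
  show ?thesis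
  proof (rule automorphismI[where F = "\<lambda>l. ?f ` l"])
    show "restrict ?f pg_points \<in> Bij (Points (symplectic_quadrangle \<beta>))" using B by simp
    show "finite (Lines (symplectic_quadrangle \<beta>))" by (rule finite)
    show "inj_on (\<lambda>l. ?f ` l) (Lines (symplectic_quadrangle \<beta>))" by (rule inj_onI) (rule injf)
  next
    fix l assume "l \<in> Lines (symplectic_quadrangle \<beta>)"
    then obtain U where U: "vec.subspace U" "vec.dim U = 2" "\<forall>u\<in>U. \<forall>v\<in>U. \<beta> u v = 0"
      and l: "l = {p \<in> pg_points. p \<subseteq> U}" by (auto simp: symplectic_quadrangle_def)
    have "?f ` l = {p \<in> pg_points. p \<subseteq> g ` U}"
    proof (intro equalityI subsetI)
      fix p assume "p \<in> {p \<in> pg_points. p \<subseteq> g ` U}"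
      then have p: "p \<in> ?f ` pg_points" "p \<subseteq> g ` U" unfolding surj by auto
      then obtain p' where "p' \<in> pg_points" "p = g ` p'" by blast
      moreover then have "p' \<subseteq> U" using p(2) by (simp add: inj_image_subset_iff[OF inj])
      ultimately show "p \<in> ?f ` l" using l by blast
    next
      fix p assume "p \<in> ?f ` l"
      then obtain p' where "p' \<in> pg_points" "p' \<subseteq> U" "p = g ` p'" using l by blast
      moreover then have "p \<in> pg_points" using surj by blast
      ultimately show "p \<in> {p \<in> pg_points. p \<subseteq> g ` U}" by blast
    qed
    moreover have "vec.subspace (g ` U)" by (rule vec.linear_subspace_image[OF lin U(1)])
    moreover have "vec.dim (g ` U) = 2"
      using vec.dim_image_eq[OF lin inj_on_subset[OF inj subset_UNIV], of U] U(2) by simp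
    moreover have "\<forall>u\<in>g ` U. \<forall>v\<in>g ` U. \<beta> u v = 0" using U(3) sim by auto
    ultimately show "?f ` l \<in> Lines (symplectic_quadrangle \<beta>)"
      unfolding symplectic_quadrangle_def incidence_structure.select_convs by blast
  next
    fix p l assume "p \<in> Points (symplectic_quadrangle \<beta>)"
    then show "Inc (symplectic_quadrangle \<beta>) (restrict ?f pg_points p) (?f ` l) \<longleftrightarrow>
        Inc (symplectic_quadrangle \<beta>) p l"
      by (simp add: inj_image_mem_iff[OF injF])
  qed
qed

text \<open>The coordinates of \<open>u\<close> in the frame are \<open>\<beta> u e3\<close>,
  \<open>\<beta> u e2\<close>, \<open>\<beta> e1 u\<close> and \<open>\<beta> e0 u\<close>, so this
  is the linear map whose matrix lifts \<open>payne_affine\<close>.\<close>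

definition (in symp_frame)
  "payne_linear m11 m12 m21 m22 v1 v2 w u =
    V (\<beta> u e3) (m11 * \<beta> u e2 + m12 * \<beta> e1 u + v1 * \<beta> u e3) (m21 * \<beta> u e2 + m22 * \<beta> e1 u + v2 * \<beta> u e3)
      ((m11 * m22 - m12 * m21) * \<beta> e0 u +
       ((m11 * \<beta> u e2 + m12 * \<beta> e1 u) * v2 - (m21 * \<beta> u e2 + m22 * \<beta> e1 u) * v1) + w * \<beta> u e3)"

lemma (in symp_frame) payne_linear_V:
  "payne_linear m11 m12 m21 m22 v1 v2 w (V r0 r1 r2 r3) =
    V r0 (m11 * r1 + m12 * r2 + v1 * r0) (m21 * r1 + m22 * r2 + v2 * r0)
      ((m11 * m22 - m12 * m21) * r3 + ((m11 * r1 + m12 * r2) * v2 - (m21 * r1 + m22 * r2) * v1) + w * r0)"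
proof -
  have "\<beta> (V r0 r1 r2 r3) e3 = r0" "\<beta> (V r0 r1 r2 r3) e2 = r1" "\<beta> e1 (V r0 r1 r2 r3) = r2"
      "\<beta> e0 (V r0 r1 r2 r3) = r3"
    using form_V[of r0 r1 r2 r3 0 0 0 1] form_V[of r0 r1 r2 r3 0 0 1 0]
      form_V[of 0 1 0 0 r0 r1 r2 r3] form_V[of 1 0 0 0 r0 r1 r2 r3]
    by (simp_all add: V_frame)
  then show ?thesis by (simp add: payne_linear_def)
qed

lemma (in symp_frame) payne_linear_similitude:
  "\<beta> (payne_linear m11 m12 m21 m22 v1 v2 w u) (payne_linear m11 m12 m21 m22 v1 v2 w v) =
    (m11 * m22 - m12 * m21) * \<beta> u v"
proof -
  obtain r0 r1 r2 r3 where u: "u = V r0 r1 r2 r3" by (rule V_cases)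
  obtain s0 s1 s2 s3 where v: "v = V s0 s1 s2 s3" by (rule V_cases)
  show ?thesis unfolding u v payne_linear_V form_V by (simp add: algebra_simps)
qed

lemma (in symp_frame) payne_linear_linear:
  "Vector_Spaces.linear (*s) (*s) (payne_linear m11 m12 m21 m22 v1 v2 w)"
  unfolding Vector_Spaces.linear_iff
proof (intro conjI allI)
  fix u v :: "'a^4" and k
  obtain r0 r1 r2 r3 where u: "u = V r0 r1 r2 r3" by (rule V_cases)
  obtain s0 s1 s2 s3 where v: "v = V s0 s1 s2 s3" by (rule V_cases)
  show "payne_linear m11 m12 m21 m22 v1 v2 w (u + v) =
      payne_linear m11 m12 m21 m22 v1 v2 w u + payne_linear m11 m12 m21 m22 v1 v2 w v"
    unfolding u v V_add payne_linear_V V_inject by (simp add: algebra_simps)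
  show "payne_linear m11 m12 m21 m22 v1 v2 w (k *s u) = k *s payne_linear m11 m12 m21 m22 v1 v2 w u"
    unfolding u V_scale payne_linear_V V_inject by (simp add: algebra_simps)
qed (rule vec.vector_space_axioms)+

lemma (in symp_frame) payne_linear_bij:
  assumes D: "m11 * m22 - m12 * m21 \<noteq> 0"
  shows "bij (payne_linear m11 m12 m21 m22 v1 v2 w)"
proof -
  have "inj (payne_linear m11 m12 m21 m22 v1 v2 w)"
  proof (rule injI)
    fix u v assume eq: "payne_linear m11 m12 m21 m22 v1 v2 w u = payne_linear m11 m12 m21 m22 v1 v2 w v"
    obtain r0 r1 r2 r3 where u: "u = V r0 r1 r2 r3" by (rule V_cases)
    obtain s0 s1 s2 s3 where v: "v = V s0 s1 s2 s3" by (rule V_cases)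
    have e: "r0 = s0" "m11 * r1 + m12 * r2 = m11 * s1 + m12 * s2" "m21 * r1 + m22 * r2 = m21 * s1 + m22 * s2"
        "(m11 * m22 - m12 * m21) * r3 = (m11 * m22 - m12 * m21) * s3"
      using eq unfolding u v payne_linear_V V_inject by auto
    then show "u = v" using linear_2x2_inj[OF D e(2,3)] D unfolding u v by simp
  qed
  then show ?thesis by (simp add: bij_def finite_UNIV_inj_surj)
qed

definition (in symp_frame)
  "payne_collineation m11 m12 m21 m22 v1 v2 w =
    restrict (\<lambda>p. payne_linear m11 m12 m21 m22 v1 v2 w ` p) pg_points"

lemma (in symp_frame)
  assumes D: "m11 * m22 - m12 * m21 \<noteq> 0"
  shows payne_collineation_PGSp4: "payne_collineation m11 m12 m21 m22 v1 v2 w \<in> PGSp4 \<beta>"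
    and payne_collineation_stabilizer: "payne_collineation m11 m12 m21 m22 v1 v2 w \<in> point_stabilizer W x"
    and induced_payne_collineation: "induced_on_payne W x (payne_collineation m11 m12 m21 m22 v1 v2 w) =
      transport pp (payne_affine m11 m12 m21 m22 v1 v2 w)"
    and payne_collineation_x: "payne_collineation m11 m12 m21 m22 v1 v2 w x = x"
proof -
  let ?g = "payne_linear m11 m12 m21 m22 v1 v2 w"
  let ?f = "payne_collineation m11 m12 m21 m22 v1 v2 w"
  note lin = payne_linear_linear[of m11 m12 m21 m22 v1 v2 w]
  note bij = payne_linear_bij[OF D, of v1 v2 w]
  note sim = payne_linear_similitude[of m11 m12 m21 m22 v1 v2 w]
  have B: "?f \<in> Bij pg_points"
    unfolding payne_collineation_def by (rule similitude_point_map[OF lin bij])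
  have "\<forall>p\<in>pg_points. ?f p = ?g ` p" by (simp add: payne_collineation_def)
  then show "?f \<in> PGSp4 \<beta>" unfolding PGSp4_def using B lin bij D sim by blast
  have "?f \<in> automorphisms W"
    unfolding payne_collineation_def
    by (rule similitude_automorphism[OF lin bij, where \<beta> = \<beta> and c = "m11 * m22 - m12 * m21"]) (rule sim)
  moreover show fx: "?f x = x"
  proof -
    have "?f x = ?g ` point_of (V 0 0 0 1)" using x_point by (simp add: payne_collineation_def x_eq)
    also have "\<dots> = point_of (?g (V 0 0 0 1))" by (rule image_point_of[OF lin])
    also have "?g (V 0 0 0 1) = (m11 * m22 - m12 * m21) *s V 0 0 0 1"
      unfolding payne_linear_V V_scale V_inject by simp
    also have "point_of ((m11 * m22 - m12 * m21) *s V 0 0 0 1) = x"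
      unfolding point_of_scale[OF D] x_eq ..
    finally show ?thesis .
  qed
  ultimately show "?f \<in> point_stabilizer W x" by (simp add: point_stabilizer_def)
  show "induced_on_payne W x ?f = transport pp (payne_affine m11 m12 m21 m22 v1 v2 w)"
  proof (rule induced_on_payne_transport)
    fix y :: "'a \<times> 'a \<times> 'a"
    obtain a b c where y: "y = (a, b, c)" by (metis surj_pair)
    have "?f (pp y) = ?g ` point_of (V 1 a b c)"
      using pp_point[of y] by (simp add: payne_collineation_def y)
    also have "\<dots> = point_of (?g (V 1 a b c))" by (rule image_point_of[OF lin])
    also have "\<dots> = pp (payne_affine m11 m12 m21 m22 v1 v2 w y)"
      unfolding payne_linear_V y by simp
    finally show "?f (pp y) = pp (payne_affine m11 m12 m21 m22 v1 v2 w y)" .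
  qed
qed

text \<open>A point collinear with \<open>x\<close> but different from it is a line of the plane at
  \<open>x\<close>, and is determined by the points of the derived quadrangle collinear with it.
  Agreement on the latter therefore propagates to all points.\<close>

lemma (in symp_frame) stabilizer_eqI:
  assumes f: "f \<in> point_stabilizer W x" and f': "f' \<in> point_stabilizer W x"
    and eq: "induced_on_payne W x f = induced_on_payne W x f'"
  shows "f = f'"
proof -
  interpret C: coord_plane Pl plp by (rule coord_plane_Pl)
  have fa: "f \<in> automorphisms W" "f x = x" and fa': "f' \<in> automorphisms W" "f' x = x"
    using f f' by (auto simp: point_stabilizer_def)
  have eqp: "f (pp y) = f' (pp y)" for y
  proof -
    have "pp y \<in> Points P" unfolding payne_Points by (rule rangeI)
    then show ?thesis using fun_cong[OF eq, of "pp y"] by (simp add: induced_on_payne_def)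
  qed
  have "f p = f' p" if p: "p \<in> pg_points" for p
  proof -
    consider "p \<in> Points P" | "p = x" | "p \<in> perp W {x} - {x}"
      using p by (auto simp: payne_derived_def perp_def collinear_in_def)
    then show ?thesis
    proof cases
      case 1
      then show ?thesis unfolding payne_Points using eqp by blast
    next
      case 2
      then show ?thesis using fa fa' by simp
    next
      case 3
      have L: "g p \<in> Lines Pl" if g: "g \<in> automorphisms W" "g x = x" for g
      proof -
        have "g p \<in> g ` perp W {x}" using 3 by blast
        then have "g p \<in> perp W {x}" using automorphism_perp[OF g(1), of "{x}"] x_point g(2) by simp
        moreover have "g p \<noteq> x"
        proof
          assume "g p = x"
          then have "g p = g x" using g(2) by simp
          then have "p = x" using automorphism_inj[OF g(1)] p x_point by (auto dest: inj_onD)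
          then show False using 3 by simp
        qed
        ultimately show ?thesis by (simp add: plane_at_def)
      qed
      have mem: "g p \<in> plp v \<longleftrightarrow> collinear_in W (g p) (pp (fst v, snd v, 0))"
        if g: "g \<in> automorphisms W" "g x = x" for g v
      proof -
        have "g p \<in> perp W {x}" using L[OF g] by (simp add: plane_at_def)
        then show ?thesis by (auto simp: plp_def perp_def)
      qed
      obtain \<kappa> where "\<forall>y. f (pp y) = pp (\<kappa> y)" using stabilizer_pp[OF f] by (rule exE)
  then have \<kappa>: "f (pp y) = pp (\<kappa> y)" for y by (rule spec)
      have surj: "\<exists>y. f (pp y) = pp z" for z
      proof -
        have "pp z \<in> f ` Points P"
          using point_stabilizer_payne_Points[OF f] x_point payne_Points by auto
        then show ?thesis unfolding payne_Points by blast
      qed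
      \<comment> \<open>Every coordinate pair lifts to a point \<open>f (pp y) = f' (pp y)\<close>,
        and both maps preserve collinearity with \<open>p\<close>.\<close>
      have "line_pts Pl plp (f p) = line_pts Pl plp (f' p)"
      proof (rule Set.set_eqI)
        fix v
        obtain y where y: "f (pp y) = pp (fst v, snd v, 0)" using surj by blast
        have "v \<in> line_pts Pl plp (f p) \<longleftrightarrow> collinear_in W (f p) (f (pp y))"
          unfolding y mem[OF fa, symmetric] by (simp add: line_pts_def plane_at_def)
        also have "\<dots> \<longleftrightarrow> collinear_in W p (pp y)"
          using automorphism_collinear[OF fa(1)] p pp_point by simp
        also have "\<dots> \<longleftrightarrow> collinear_in W (f' p) (f' (pp y))"
          using automorphism_collinear[OF fa'(1)] p pp_point by simp
        also have "\<dots> \<longleftrightarrow> v \<in> line_pts Pl plp (f' p)"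
          unfolding eqp[symmetric] y mem[OF fa', symmetric] by (simp add: line_pts_def plane_at_def)
        finally show "v \<in> line_pts Pl plp (f p) \<longleftrightarrow> v \<in> line_pts Pl plp (f' p)" .
      qed
      then show ?thesis by (rule C.line_eqI[OF L[OF fa] L[OF fa']])
    qed
  qed
  moreover have "f \<in> extensional pg_points" "f' \<in> extensional pg_points"
    using automorphisms_Bij[OF fa(1)] automorphisms_Bij[OF fa'(1)] by (auto simp: Bij_def)
  ultimately show ?thesis by (metis extensionalityI)
qed

section \<open>The groups eta and collinearity, in coordinates\<close>

lemma collinear_in_sym: "collinear_in S y z \<longleftrightarrow> collinear_in S z y"
  by (auto simp: collinear_in_def)

lemma unipotent_map_eq_payne_affine: "unipotent_map s t u w = payne_affine 1 0 t 1 s u w"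
  by (auto simp: fun_eq_iff algebra_simps)

abbreviation (in symp_frame) "unipotent s t u w \<equiv> payne_collineation 1 0 t 1 s u w"

lemma (in symp_frame)
  shows unipotent_PGSp4: "unipotent s t u w \<in> PGSp4 \<beta>"
    and unipotent_stabilizer: "unipotent s t u w \<in> point_stabilizer W x"
    and induced_unipotent: "induced_on_payne W x (unipotent s t u w) = transport pp (unipotent_map s t u w)"
    and unipotent_x: "unipotent s t u w x = x"
  using payne_collineation_PGSp4[of 1 1 0 t s u w] payne_collineation_stabilizer[of 1 1 0 t s u w]
    induced_payne_collineation[of 1 1 0 t s u w] payne_collineation_x[of 1 1 0 t s u w]
  unfolding unipotent_map_eq_payne_affine by simp_all

lemma (in symp_frame) induced_plane_unipotent:
  "induced_on_plane W x (unipotent s t u w) = transport plp (shear s t u)"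
proof (rule transport_eqI[OF inj_plp])
  show "induced_on_plane W x (unipotent s t u w) \<in> extensional (range plp)"
    unfolding induced_on_plane_def plane_Points by simp
  fix v :: "'a \<times> 'a"
  obtain a b where v: "v = (a, b)" by (metis surj_pair)
  have "pp (a, b, 0) \<in> Points P" unfolding payne_Points by (rule rangeI)
  then have "unipotent s t u w (pp (a, b, 0)) = induced_on_payne W x (unipotent s t u w) (pp (a, b, 0))"
    by (simp only: induced_on_payne_def restrict_apply')
  also have "\<dots> = pp (unipotent_map s t u w (a, b, 0))"
    unfolding induced_unipotent by (rule transport_apply[OF inj_pp])
  also have "\<dots> = pp (a + s, b + t * a + u, 0 + (u - s * t) * a - s * b + w)"
    by (simp only: unipotent_map_simp)
  finally have "induced_on_plane W x (unipotent s t u w) (plp (a, b)) = plp (a + s, b + t * a + u)"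
    by (rule stabilizer_plane[OF unipotent_stabilizer])
  then show "induced_on_plane W x (unipotent s t u w) (plp v) = plp (shear s t u v)"
    unfolding v by (simp only: shear.simps)
qed

definition unipotent_graph :: "('a::field \<Rightarrow> 'a) \<Rightarrow> ('a \<times> 'a \<times> 'a \<Rightarrow> 'a \<times> 'a \<times> 'a) set" where
  "unipotent_graph r = {unipotent_map s (r s) u w | s u w. True}"

text \<open>A shear \<open>shear s (r s) u\<close> is induced by
  \<open>unipotent s (r s) u w\<close> for every \<open>w\<close>, and by
  \<open>induced_shear\<close> nothing else restricts to a map over it. The free parameter
  \<open>w\<close> accounts for the symmetries about \<open>x\<close>.\<close>

lemma (in symp_frame) chi_graph:
  "chi W x {transport plp (shear s (r s) u) | s u. True} = transport pp ` unipotent_graph r"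
proof (intro equalityI subsetI)
  fix k assume "k \<in> chi W x {transport plp (shear s (r s) u) | s u. True}"
  then obtain f where f: "f \<in> point_stabilizer W x" "k = induced_on_payne W x f"
      "induced_on_plane W x f \<in> {transport plp (shear s (r s) u) | s u. True}"
    unfolding chi_def by blast
  then obtain s u where "induced_on_plane W x f = transport plp (shear s (r s) u)" by blast
  then obtain w where "k = transport pp (unipotent_map s (r s) u w)"
    using induced_shear[OF f(1)] f(2) by blast
  then show "k \<in> transport pp ` unipotent_graph r" unfolding unipotent_graph_def by blast
next
  fix k assume "k \<in> transport pp ` unipotent_graph r"
  then obtain s u w where k: "k = transport pp (unipotent_map s (r s) u w)"
    unfolding unipotent_graph_def by blast
  show "k \<in> chi W x {transport plp (shear s (r s) u) | s u. True}"
    unfolding chi_def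
  proof (rule image_eqI)
    show "k = induced_on_payne W x (unipotent s (r s) u w)" unfolding k induced_unipotent ..
    show "unipotent s (r s) u w \<in> {f \<in> point_stabilizer W x.
        induced_on_plane W x f \<in> {transport plp (shear s (r s) u) | s u. True}}"
      using unipotent_stabilizer induced_plane_unipotent by blast
  qed
qed

lemma (in symp_frame) eta_vcl:
  "{eta W x vcl U | U. U \<in> complement_subgroups CARD('a) Pl vcl} =
    {transport pp ` unipotent_graph r | r :: 'a \<Rightarrow> 'a. \<forall>a b. r (a + b) = r a + r b}"
proof -
  interpret C: coord_plane Pl plp by (rule coord_plane_Pl)
  have "{eta W x vcl U | U. U \<in> complement_subgroups CARD('a) Pl vcl} =
      chi W x ` (preimage_in_H Pl vcl ` complement_subgroups CARD('a) Pl vcl)"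
    unfolding eta_def by blast
  also have "\<dots> = chi W x ` {C.graph_shears r | r. \<forall>a b. r (a + b) = r a + r b}"
    unfolding C.preimage_complement_subgroups ..
  also have "\<dots> = {transport pp ` unipotent_graph r | r. \<forall>a b. r (a + b) = r a + r b}"
    unfolding C.graph_shears_def chi_graph[symmetric] by blast
  finally show ?thesis .
qed

lemma (in symp_frame) payne_collineation_induced_eq:
  assumes "m11 * m22 - m12 * m21 \<noteq> 0" and "f \<in> point_stabilizer W x"
    and "induced_on_payne W x f = transport pp (payne_affine m11 m12 m21 m22 v1 v2 w)"
  shows "f = payne_collineation m11 m12 m21 m22 v1 v2 w"
  using stabilizer_eqI[OF assms(2) payne_collineation_stabilizer[OF assms(1)]]
    induced_payne_collineation[OF assms(1)] assms(3) by metis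

text \<open>By uniqueness of extensions, an element of the overlined group inducing a
  \<open>payne_affine\<close> map is the corresponding similitude, so linearity can be checked on
  coordinates.\<close>

lemma (in symp_frame) linear_singer_groupI:
  assumes singer: "singer_group P K"
    and K: "\<And>k. k \<in> K \<Longrightarrow> \<exists>m11 m12 m21 m22 v1 v2 w. m11 * m22 - m12 * m21 \<noteq> 0 \<and>
      k = transport pp (payne_affine m11 m12 m21 m22 v1 v2 w)"
  shows "linear_singer_group \<beta> x K"
  unfolding linear_singer_group_def
proof (intro conjI)
  show "induced_on_payne W x ` overline_group W x K = K"
  proof (intro equalityI subsetI)
    fix k assume k: "k \<in> K"
    then obtain m11 m12 m21 m22 v1 v2 w where D: "m11 * m22 - m12 * m21 \<noteq> 0"
      and keq: "k = transport pp (payne_affine m11 m12 m21 m22 v1 v2 w)" using K by blast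
    show "k \<in> induced_on_payne W x ` overline_group W x K"
    proof (rule image_eqI)
      show e: "k = induced_on_payne W x (payne_collineation m11 m12 m21 m22 v1 v2 w)"
        unfolding keq induced_payne_collineation[OF D] ..
      show "payne_collineation m11 m12 m21 m22 v1 v2 w \<in> overline_group W x K"
        unfolding overline_group_def using payne_collineation_stabilizer[OF D] k e by simp
    qed
  qed (auto simp: overline_group_def)
  show "overline_group W x K \<subseteq> {f \<in> PGSp4 \<beta>. f x = x}"
  proof
    fix f assume "f \<in> overline_group W x K"
    then have f: "f \<in> point_stabilizer W x" "induced_on_payne W x f \<in> K"
      by (simp_all add: overline_group_def)
    then obtain m11 m12 m21 m22 v1 v2 w where D: "m11 * m22 - m12 * m21 \<noteq> 0"
      and "induced_on_payne W x f = transport pp (payne_affine m11 m12 m21 m22 v1 v2 w)"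
      using K by blast
    then have "f = payne_collineation m11 m12 m21 m22 v1 v2 w"
      using payne_collineation_induced_eq[OF D f(1)] by blast
    then show "f \<in> {f \<in> PGSp4 \<beta>. f x = x}"
      using payne_collineation_PGSp4[OF D] payne_collineation_x[OF D] by simp
  qed
qed (rule singer)

lemma (in symp_frame) singer_unipotent_graph:
  assumes add: "\<And>a b :: 'a. r (a + b) = r a + r b"
  shows "singer_group P (transport pp ` unipotent_graph r)"
proof (rule singer_group_transportI[OF inj_pp payne_Points])
  fix k assume "k \<in> unipotent_graph r"
  then obtain s u w where k: "k = unipotent_map s (r s) u w" unfolding unipotent_graph_def by blast
  have "induced_on_payne W x (unipotent s (r s) u w) \<in> automorphisms P"
    by (rule induced_on_payne_automorphism[OF unipotent_stabilizer])
       (simp_all add: x_point symplectic_quadrangle_lines[unfolded symplectic_quadrangle_simps])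
  then show "transport pp k \<in> automorphisms P" unfolding k induced_unipotent .
next
  fix k k' assume "k \<in> unipotent_graph r" "k' \<in> unipotent_graph r"
  then show "k \<circ> k' \<in> unipotent_graph r"
    unfolding unipotent_graph_def by (auto simp: unipotent_map_comp add[symmetric])
next
  fix y z :: "'a \<times> 'a \<times> 'a"
  obtain a b c a' b' c' where yz: "y = (a, b, c)" "z = (a', b', c')" by (metis surj_pair)
  define s where "s = a' - a"
  define u where "u = b' - b - r s * a"
  define w where "w = c' - c - (u - s * r s) * a + s * b"
  show "\<exists>!k. k \<in> unipotent_graph r \<and> k y = z"
  proof (rule ex1I[of _ "unipotent_map s (r s) u w"], rule conjI)
    show "unipotent_map s (r s) u w \<in> unipotent_graph r" unfolding unipotent_graph_def by blast
    show "unipotent_map s (r s) u w y = z" by (simp add: yz s_def u_def w_def)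
    fix k assume k: "k \<in> unipotent_graph r \<and> k y = z"
    then obtain s' u' w' where keq: "k = unipotent_map s' (r s') u' w'" unfolding unipotent_graph_def by blast
    have e: "a + s' = a'" "b + r s' * a + u' = b'" "c + (u' - s' * r s') * a - s' * b + w' = c'"
      using k unfolding keq yz by auto
    have s': "s' = s" using e(1) by (auto simp: s_def)
    have u': "u' = u" using e(2) unfolding s' by (auto simp: u_def)
    have w': "w' = w" using e(3) unfolding s' u' by (auto simp: w_def)
    show "k = unipotent_map s (r s) u w" unfolding keq s' u' w' ..
  qed
qed

lemma (in symp_frame) linear_singer_unipotent_graph:
  assumes "\<And>a b :: 'a. r (a + b) = r a + r b"
  shows "linear_singer_group \<beta> x (transport pp ` unipotent_graph r)"
proof (rule linear_singer_groupI[OF singer_unipotent_graph[OF assms]])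
  fix k assume "k \<in> transport pp ` unipotent_graph r"
  then obtain s u w where "k = transport pp (unipotent_map s (r s) u w)"
    unfolding unipotent_graph_def by blast
  then have "(1::'a) * 1 - 0 * r s \<noteq> 0 \<and> k = transport pp (payne_affine 1 0 (r s) 1 s u w)"
    unfolding unipotent_map_eq_payne_affine by simp
  then show "\<exists>m11 m12 m21 m22 v1 v2 w. m11 * m22 - m12 * m21 \<noteq> 0 \<and>
      k = transport pp (payne_affine m11 m12 m21 m22 v1 v2 w)" by blast
qed

lemma (in symp_frame) symmetries_stabilizer:
  assumes "f \<in> symmetries W x"
  shows "f \<in> point_stabilizer W x" "induced_on_plane W x f = transport plp (shear 0 0 0)"
proof -
  have f: "f \<in> automorphisms W" "\<And>y. y \<in> perp W {x} \<Longrightarrow> f y = y"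
    using assms by (auto simp: symmetries_def)
  have "V 0 0 0 1 \<noteq> 0" by (simp add: V_eq_0_iff)
  then have "x \<in> perp W {x}" unfolding perp_x unfolding x_eq by blast
  then show "f \<in> point_stabilizer W x" using f by (simp add: point_stabilizer_def)
  show "induced_on_plane W x f = transport plp (shear 0 0 0)"
  proof (rule transport_eqI[OF inj_plp])
    show "induced_on_plane W x f \<in> extensional (range plp)"
      unfolding induced_on_plane_def plane_Points by simp
    fix v
    have "f y = y" if "y \<in> plp v" for y
      using that by (intro f(2)) (simp add: plp_def perp_def)
    then have "f ` plp v = plp v" by simp
    moreover have "plp v \<in> Points Pl" unfolding plane_Points by (rule rangeI)
    ultimately show "induced_on_plane W x f (plp v) = plp (shear 0 0 0 v)"
      by (simp add: induced_on_plane_def)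
  qed
qed

lemma (in symp_frame) symmetries_subset_overline:
  assumes add: "\<And>a b :: 'a. r (a + b) = r a + r b"
  shows "symmetries W x \<subseteq> overline_group W x (transport pp ` unipotent_graph r)"
proof
  fix f assume f: "f \<in> symmetries W x"
  have r0: "r 0 = 0" using add[of 0 0] by (metis add.right_neutral add_left_cancel)
  obtain w where "induced_on_payne W x f = transport pp (unipotent_map 0 0 0 w)"
    using induced_shear[OF symmetries_stabilizer[OF f]] by blast
  moreover have "unipotent_map 0 0 0 w \<in> unipotent_graph r"
    unfolding unipotent_graph_def using r0 by (intro CollectI exI[of _ 0] exI[of _ w]) simp
  ultimately show "f \<in> overline_group W x (transport pp ` unipotent_graph r)"
    unfolding overline_group_def using symmetries_stabilizer(1)[OF f] by simp
qed

lemma (in symp_frame) unipotent_symmetry: "unipotent 0 0 0 w \<in> symmetries W x"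
proof -
  have a: "unipotent 0 0 0 w \<in> automorphisms W"
    using unipotent_stabilizer by (simp add: point_stabilizer_def)
  have "unipotent 0 0 0 w y = y" if yx: "y \<in> perp W {x}" for y
  proof -
    obtain r1 r2 r3 where y: "y = point_of (V 0 r1 r2 r3)" "V 0 r1 r2 r3 \<noteq> 0"
      using yx unfolding perp_x by blast
    have "y \<in> pg_points" using y by (simp add: point_of_in_pg_points)
    then have "unipotent 0 0 0 w y = payne_linear 1 0 0 1 0 0 w ` point_of (V 0 r1 r2 r3)"
      by (simp add: payne_collineation_def y)
    also have "\<dots> = point_of (payne_linear 1 0 0 1 0 0 w (V 0 r1 r2 r3))"
      by (rule image_point_of[OF payne_linear_linear])
    finally show ?thesis unfolding payne_linear_V y by simp
  qed
  then show ?thesis using a by (simp add: symmetries_def)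
qed

text \<open>Identifies the abstract collinearity relation with the coordinate relation used for
  regularity: lines missing \<open>x\<close> give the equation, and the punctured hyperbolic lines
  through \<open>x\<close> give the fibres.\<close>

lemma (in symp_frame) payne_collinear:
  "collinear_in P (pp y) (pp z) \<longleftrightarrow> payne_coll y z"
proof -
  obtain a b c a' b' c' where yz: "y = (a, b, c)" "z = (a', b', c')" by (metis surj_pair)
  \<comment> \<open>The hyperbolic line consists of one fibre and \<open>x\<close>. Testing against
    the two points with coordinates \<open>(0, 1, 0, b0)\<close> and \<open>(0, 0, 1, - a0)\<close>
    reads off \<open>d2\<close> and \<open>d1\<close>.\<close>
  have hyp: "pp (d1, d2, d3) \<in> perp W (plp (a0, b0)) \<longleftrightarrow> d1 = a0 \<and> d2 = b0" for d1 d2 d3 a0 b0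
  proof
    assume h: "pp (d1, d2, d3) \<in> perp W (plp (a0, b0))"
    have n: "V 0 1 0 b0 \<noteq> 0" "V 0 0 1 (- a0) \<noteq> 0" "V 1 d1 d2 d3 \<noteq> 0" by (simp_all add: V_eq_0_iff)
    have "point_of (V 0 1 0 b0) \<in> plp (a0, b0)" "point_of (V 0 0 1 (- a0)) \<in> plp (a0, b0)"
      using mem_plp[OF n(1)] mem_plp[OF n(2)] by simp_all
    then have "collinear_in W (point_of (V 1 d1 d2 d3)) (point_of (V 0 1 0 b0))"
        "collinear_in W (point_of (V 1 d1 d2 d3)) (point_of (V 0 0 1 (- a0)))"
      using h unfolding perp_def pp.simps by blast+
    then have "\<beta> (V 1 d1 d2 d3) (V 0 1 0 b0) = 0" "\<beta> (V 1 d1 d2 d3) (V 0 0 1 (- a0)) = 0"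
      using collinear_iff n by blast+
    then show "d1 = a0 \<and> d2 = b0" by (simp add: form_V)
  next
    assume "d1 = a0 \<and> d2 = b0"
    then have "plp (a0, b0) = perp W {x, pp (d1, d2, d3)}" by (simp only: perp_x_pp_eq_plp)
    then have "collinear_in W (pp (d1, d2, d3)) q" if "q \<in> plp (a0, b0)" for q
      using that collinear_in_sym[of W q "pp (d1, d2, d3)"] unfolding perp_def by blast
    then show "pp (d1, d2, d3) \<in> perp W (plp (a0, b0))"
      unfolding perp_def using pp_point[of "(d1, d2, d3)"] by simp
  qed
  have ncx: "\<not> collinear_in W x (pp v)" for v
  proof -
    have "pp v \<in> Points P" unfolding payne_Points by (rule rangeI)
    then show ?thesis by (simp add: payne_derived_def)
  qed
  have px: "pp v \<noteq> x" for v
  proof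
    assume e: "pp v = x"
    have "collinear_in W x x"
      unfolding x_eq by (subst collinear_iff) (simp_all add: V_eq_0_iff form_V)
    then show False using ncx[of v] e by simp
  qed
  have L: "Lines P = {l \<in> Lines W. x \<notin> l} \<union> {perp W (plp (fst v, fst (snd v))) - {x} | v :: 'a \<times> 'a \<times> 'a. True}"
  proof -
    have e1: "{perp W (perp W {x, r}) - {x} | r. r \<in> Points P} = {perp W (perp W {x, pp v}) - {x} | v. True}"
      unfolding payne_Points by blast
    have e2: "{perp W (perp W {x, pp v}) - {x} | v. True} = {perp W (plp (fst v, fst (snd v))) - {x} | v :: 'a \<times> 'a \<times> 'a. True}"
    proof -
      have "perp W {x, pp v} = plp (fst v, fst (snd v))" for v
        using perp_x_pp_eq_plp[of "fst v" "fst (snd v)" "snd (snd v)"] by (simp only: prod.collapse)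
      then show ?thesis by simp
    qed
    have "Lines P = {l \<in> Lines W. x \<notin> l} \<union> {perp W (perp W {x, r}) - {x} | r. r \<in> Points P}"
      unfolding payne_derived_def by simp
    then show ?thesis unfolding e1 e2 .
  qed
  have I: "Inc P q l \<longleftrightarrow> q \<in> l" for q l by (simp add: payne_derived_def)
  show ?thesis
  proof
    assume "collinear_in P (pp y) (pp z)"
    then obtain l where l: "l \<in> Lines P" "pp y \<in> l" "pp z \<in> l" by (auto simp: collinear_in_def I)
    then consider "l \<in> Lines W" | v :: "'a \<times> 'a \<times> 'a" where "l = perp W (plp (fst v, fst (snd v))) - {x}"
      unfolding L by blast
    then show "payne_coll y z"
    proof cases
      case 1
      then have "collinear_in W (pp y) (pp z)" using l by (auto simp: collinear_in_def)
      then show ?thesis unfolding yz collinear_pp by simp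
    next
      case (2 v)
      then have "pp y \<in> perp W (plp (fst v, fst (snd v)))" "pp z \<in> perp W (plp (fst v, fst (snd v)))"
        using l by blast+
      then show ?thesis unfolding yz hyp by simp
    qed
  next
    assume c: "payne_coll y z"
    show "collinear_in P (pp y) (pp z)"
    proof (cases "a = a' \<and> b = b'")
      case True
      have "pp y \<in> perp W (plp (a, b))" "pp z \<in> perp W (plp (a, b))" unfolding yz hyp using True by simp_all
      moreover have "perp W (plp (a, b)) - {x} \<in> Lines P"
        unfolding L by (rule UnI2, rule CollectI, rule exI[of _ y]) (simp add: yz)
      moreover have "pp y \<noteq> x" "pp z \<noteq> x" using px by blast+
      ultimately show ?thesis
        unfolding collinear_in_def I by (intro bexI[of _ "perp W (plp (a, b)) - {x}"]) simp_all
    next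
      case False
      moreover have "a = a' \<and> b = b' \<or> c' - c = b * a' - a * b'" using c unfolding yz by simp
      ultimately have "c' - c = b * a' - a * b'" by blast
      then have "collinear_in W (pp y) (pp z)" unfolding yz collinear_pp .
      then obtain l where l: "l \<in> Lines W" "pp y \<in> l" "pp z \<in> l" by (auto simp: collinear_in_def)
      have "x \<notin> l" using ncx[of y] l by (auto simp: collinear_in_def)
      then have "l \<in> Lines P" unfolding L using l(1) by (intro UnI1) simp
      then show ?thesis unfolding collinear_in_def I using l by (intro bexI[of _ l]) simp_all
    qed
  qed
qed

section \<open>Groups of prime power order\<close>

text \<open>Orbit sizes are powers of p. If \<open>x0\<close> were the only fixed point, all other
  orbits would have size divisible by p, and the cardinality of \<open>E\<close> would be 1 modulo
  p.\<close>

lemma p_group_second_fixed_point: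
  assumes act: "group_action G E \<phi>" and p: "prime p" and G: "order G = p ^ n"
    and fin: "finite E" and E: "p dvd card E"
    and x0: "x0 \<in> E" "\<And>g. g \<in> carrier G \<Longrightarrow> \<phi> g x0 = x0"
  shows "\<exists>y\<in>E. y \<noteq> x0 \<and> (\<forall>g\<in>carrier G. \<phi> g y = y)"
proof (rule ccontr)
  assume no: "\<not> ?thesis"
  interpret group_action G E \<phi> by (rule act)
  interpret group G using group_hom group_hom.axioms(1) by auto
  have orb0: "orbit G \<phi> x0 = {x0}"
    using x0 orbit_refl[OF x0(1)] by (auto simp: orbit_def)
  define C where "C = orbits G E \<phi> - {{x0}}"
  have UC: "\<Union>C = E - {x0}"
  proof (intro equalityI subsetI)
    fix y assume "y \<in> \<Union>C"
    then obtain c where c: "c \<in> orbits G E \<phi>" "c \<noteq> {x0}" "y \<in> c" by (auto simp: C_def)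
    have "{x0} \<in> orbits G E \<phi>" unfolding orbits_def using orb0 x0(1) by blast
    then have "c \<inter> {x0} = {}" using disjoint_union[OF c(1)] c(2) by blast
    then show "y \<in> E - {x0}" using c orbits_coverture by blast
  next
    fix y assume y: "y \<in> E - {x0}"
    then have "orbit G \<phi> y \<in> orbits G E \<phi>" by (auto simp: orbits_def)
    moreover have "y \<in> orbit G \<phi> y" using y orbit_refl by blast
    ultimately show "y \<in> \<Union>C" using y by (auto simp: C_def)
  qed
  have "p dvd card (\<Union>C)"
  proof (rule dvd_partition)
    show "finite (\<Union>C)" unfolding UC using fin by simp
    show "\<forall>c1\<in>C. \<forall>c2\<in>C. c1 \<noteq> c2 \<longrightarrow> c1 \<inter> c2 = {}"
      using disjoint_union by (auto simp: C_def)
    show "\<forall>c\<in>C. p dvd card c"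
    proof
      fix c assume "c \<in> C"
      then obtain y where y: "y \<in> E" "c = orbit G \<phi> y" "c \<noteq> {x0}" by (auto simp: C_def orbits_def)
      have yx: "y \<noteq> x0" using y orb0 by blast
      have "card c dvd p ^ n" using orbit_stabilizer_theorem[OF y(1)] G y(2) by (metis dvd_triv_left)
      then obtain i where i: "card c = p ^ i" using divides_primepow_nat[OF p] by blast
      have "i \<noteq> 0"
      proof
        assume "i = 0"
        then obtain z where z: "c = {z}" using i by (auto simp: card_1_singleton_iff)
        have "y \<in> c" using orbit_refl[OF y(1)] y(2) by simp
        then have "c = {y}" using z by simp
        then have "\<forall>g\<in>carrier G. \<phi> g y = y" using y(2) by (auto simp: orbit_def)
        then show False using no y(1) yx by blast
      qed
      then show "p dvd card c" unfolding i by (simp add: dvd_power)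
    qed
  qed
  moreover have "card (\<Union>C) = card E - 1" unfolding UC using x0(1) fin by simp
  moreover have "card E > 0" using x0(1) fin by (auto simp: card_gt_0_iff)
  ultimately have "p dvd 1" using E by (metis Suc_diff_1 dvd_add_right_iff plus_1_eq_Suc add.commute)
  then show False using p by (metis not_prime_unit)
qed

definition perm_monoid :: "('b \<Rightarrow> 'b) set \<Rightarrow> ('b \<Rightarrow> 'b) monoid" where
  "perm_monoid K = \<lparr>carrier = K, mult = (\<circ>), one = id\<rparr>"

lemma regular_closed_group:
  assumes bij: "\<And>k. k \<in> K \<Longrightarrow> bij k"
    and closed: "\<And>k k'. k \<in> K \<Longrightarrow> k' \<in> K \<Longrightarrow> k \<circ> k' \<in> K"
    and trans: "\<And>y z. \<exists>!k. k \<in> K \<and> k y = (z :: 'b)"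
  shows "group (perm_monoid K)"
proof -
  have fixid: "k = id" if "k \<in> K" "k y = y" for k y
  proof -
    have "k \<circ> k = k" using trans[of y y] closed[OF that(1) that(1)] that by (metis comp_apply)
    then have "k (k z) = k z" for z by (metis comp_apply)
    then have "k z = z" for z using bij_is_inj[OF bij[OF that(1)]] by (metis injD)
    then show ?thesis by (simp add: fun_eq_iff)
  qed
  fix y0 :: 'b
  obtain k0 where k0: "k0 \<in> K" "k0 y0 = y0" using trans by blast
  have idK: "id \<in> K" using fixid[OF k0] k0 by simp
  show ?thesis
  proof (rule groupI)
    fix k assume "k \<in> carrier (perm_monoid K)"
    then have k: "k \<in> K" by (simp add: perm_monoid_def)
    obtain k' where k': "k' \<in> K" "k' (k y0) = y0" using trans by blast
    have "k' \<circ> k = id" using fixid[OF closed[OF k'(1) k], of y0] k' by simp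
    then show "\<exists>k'\<in>carrier (perm_monoid K). k' \<otimes>\<^bsub>perm_monoid K\<^esub> k = \<one>\<^bsub>perm_monoid K\<^esub>"
      using k' by (auto simp: perm_monoid_def)
  qed (use idK closed in \<open>auto simp: perm_monoid_def comp_assoc\<close>)
qed

text \<open>Evaluation at any one point is a bijection from \<open>K\<close> onto the codomain
  type.\<close>

lemma regular_card:
  fixes K :: "('c \<Rightarrow> 'b) set"
  assumes "\<And>y z. \<exists>!k. k \<in> K \<and> k y = z"
  shows "card K = CARD('b)"
proof -
  fix y0 :: 'c
  have "bij_betw (\<lambda>k. k y0) K UNIV"
    unfolding bij_betw_def
  proof (intro conjI)
    show "inj_on (\<lambda>k. k y0) K"
    proof (rule inj_onI)
      fix k k' assume k: "k \<in> K" "k' \<in> K" "k y0 = k' y0"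
      have "(THE i. i \<in> K \<and> i y0 = k y0) = k" by (rule the1_equality[OF assms]) (simp add: k)
      moreover have "(THE i. i \<in> K \<and> i y0 = k y0) = k'" by (rule the1_equality[OF assms]) (simp add: k)
      ultimately show "k = k'" by (rule trans[OF sym])
    qed
    have "z \<in> (\<lambda>k. k y0) ` K" for z
    proof -
      obtain k where "k \<in> K \<and> k y0 = z" using ex1_implies_ex[OF assms[of y0 z]] by (rule exE)
      then show ?thesis by (intro image_eqI[of _ _ k]) simp_all
    qed
    then show "(\<lambda>k. k y0) ` K = UNIV" by (intro UNIV_eq_I[symmetric])
  qed
  then show ?thesis by (rule bij_betw_same_card)
qed

text \<open>Lagrange's theorem for the cyclic group generated by \<open>k\<close>, phrased with
  iteration of functions so that it combines with coordinate formulas for iterates.\<close>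

lemma regular_funpow_card:
  assumes "group (perm_monoid K)" and k: "k \<in> K"
  shows "k ^^ card K = id"
\<comment> \<open>For infinite \<open>K\<close> the cardinality is 0 by convention, and the 0-th
  iterate is the identity.\<close>
proof (cases "finite K")
  case True
  interpret group "perm_monoid K" by (rule assms)
  have kn: "k ^^ n \<in> K" for n :: nat
  proof (induction n)
    case 0
    show ?case using one_closed by (simp only: funpow.simps perm_monoid_def monoid.select_convs partial_object.select_convs)
  next
    case (Suc n)
    then show ?case using m_closed[of k "k ^^ n"] k
      by (simp only: funpow.simps perm_monoid_def monoid.select_convs partial_object.select_convs)
  qed
  obtain k' where k': "k' \<circ> k = id" using l_inv_ex[of k] k by (auto simp: perm_monoid_def)
  have "inj k" using inj_on_imageI2[of k' k UNIV] unfolding k' by simp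
  then have injn: "inj (k ^^ n)" for n by (rule inj_fn)
  have diff: "k ^^ (j - i) = id" if "i < j" "k ^^ i = k ^^ j" for i j :: nat
  proof (rule HOL.ext)
    fix y
    have "(k ^^ i) ((k ^^ (j - i)) y) = (k ^^ (i + (j - i))) y" by (simp only: funpow_add comp_apply)
    also have "\<dots> = (k ^^ i) y" using that by simp
    finally show "(k ^^ (j - i)) y = id y" using injD[OF injn] by simp
  qed
  have "\<not> inj (\<lambda>n. k ^^ n)"
  proof
    assume "inj (\<lambda>n. k ^^ n)"
    moreover have "finite (range (\<lambda>n. k ^^ n))" using kn by (intro finite_subset[OF _ True]) auto
    ultimately show False using finite_imageD infinite_UNIV_nat by blast
  qed
  then obtain i j where ij: "k ^^ i = k ^^ j" "i \<noteq> j" unfolding inj_def not_all not_imp by (elim exE conjE) (rule that)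
  have ex: "\<exists>m>0. k ^^ m = id"
  proof (cases "i < j")
    case True
    then show ?thesis using diff[OF True ij(1)] by (intro exI[of _ "j - i"]) simp
  next
    case False
    then have "j < i" using ij(2) by simp
    then show ?thesis using diff[OF _ ij(1)[symmetric]] by (intro exI[of _ "i - j"]) simp
  qed
  define m where "m = (LEAST m. m > 0 \<and> k ^^ m = id)"
  have m: "m > 0" "k ^^ m = id" using LeastI_ex[OF ex] by (simp_all add: m_def)
  have least: "\<not> (n > 0 \<and> k ^^ n = id)" if "n < m" for n
    using not_less_Least[OF that[unfolded m_def]] .
  define H where "H = (\<lambda>i. k ^^ i) ` {..<m}"
  have "inj_on (\<lambda>i. k ^^ i) {..<m}"
  proof (rule linorder_inj_onI)
    fix i j assume "i < j" "i \<in> {..<m}" "j \<in> {..<m}"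
    then show "k ^^ i \<noteq> k ^^ j" using diff[of i j] least[of "j - i"] by auto
  qed auto
  then have cH: "card H = m" unfolding H_def by (simp add: card_image)
  have kH: "k ^^ n \<in> H" for n
  proof -
    have "k ^^ (n mod m) = k ^^ n" using m(2) by (intro HOL.ext funpow_mod_eq) simp
    moreover have "n mod m \<in> {..<m}" using m(1) by simp
    ultimately show ?thesis unfolding H_def by (intro image_eqI[of _ _ "n mod m"]) simp_all
  qed
  have "subgroup H (perm_monoid K)"
  proof (rule subgroupI)
    show "H \<subseteq> carrier (perm_monoid K)" using kn by (auto simp: H_def perm_monoid_def)
    show "H \<noteq> {}" using kH by blast
    fix a assume "a \<in> H"
    then obtain i where i: "a = k ^^ i" "i < m" by (auto simp: H_def)
    have "k ^^ (m - i) \<circ> k ^^ i = id" using i(2) m(2) by (simp flip: funpow_add)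
    then have "inv\<^bsub>perm_monoid K\<^esub> a = k ^^ (m - i)"
      using kn by (intro inv_equality) (simp_all add: perm_monoid_def i(1))
    then show "inv\<^bsub>perm_monoid K\<^esub> a \<in> H" using kH by simp
    fix b assume "b \<in> H"
    then obtain j where j: "b = k ^^ j" by (auto simp: H_def)
    show "a \<otimes>\<^bsub>perm_monoid K\<^esub> b \<in> H"
      using kH[of "i + j"] unfolding i(1) j perm_monoid_def by (simp add: funpow_add)
  qed
  then have "m dvd card K"
    using lagrange cH by (metis dvd_triv_right order_def perm_monoid_def partial_object.select_convs(1))
  then obtain c where "card K = m * c" by (elim dvdE)
  then have "k ^^ card K = (k ^^ m) ^^ c" by (simp only: funpow_mult)
  then show ?thesis unfolding m(2) by simp
qed simp

text \<open>The linear parts of the elements of \<open>K\<close> act on the \<open>q\<^sup>2\<close> vectors of the plane; since \<open>K\<close> is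
  a \<open>p\<close>-group, they fix a nonzero vector.\<close>

lemma regular_p_group_fixes_direction:
  fixes K :: "('a::{field,finite} \<times> 'a \<times> 'a \<Rightarrow> 'a \<times> 'a \<times> 'a) set"
  assumes p: "prime p" and card: "CARD('a) = p ^ h" and h: "h > 0"
    and G: "group (perm_monoid K)" and cK: "card K = CARD('a \<times> 'a \<times> 'a)"
    and L0: "\<And>k v w. k \<in> K \<Longrightarrow> L k (v + w) = L k v + L k (w :: 'a \<times> 'a)"
    and Lbij: "\<And>k. k \<in> K \<Longrightarrow> inj (L k)"
    and Lcomp: "\<And>k k'. k \<in> K \<Longrightarrow> k' \<in> K \<Longrightarrow> L (k \<circ> k') = L k \<circ> L k'"
  shows "\<exists>z. z \<noteq> 0 \<and> (\<forall>k\<in>K. L k z = z)"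
proof -
  have "group_hom (perm_monoid K) (BijGroup UNIV) L"
  proof (rule group_hom.intro[OF G group_BijGroup], unfold_locales)
    have LB: "L k \<in> Bij UNIV" if "k \<in> K" for k
      using Lbij[OF that] by (simp add: Bij_def bij_betw_def finite_UNIV_inj_surj)
    show "L \<in> hom (perm_monoid K) (BijGroup UNIV)"
    proof (rule homI)
      show "L k \<in> carrier (BijGroup UNIV)" if "k \<in> carrier (perm_monoid K)" for k
        using LB that by (simp add: BijGroup_def perm_monoid_def)
      show "L (k \<otimes>\<^bsub>perm_monoid K\<^esub> k') = L k \<otimes>\<^bsub>BijGroup UNIV\<^esub> L k'"
        if "k \<in> carrier (perm_monoid K)" "k' \<in> carrier (perm_monoid K)" for k k'
        using LB Lcomp that by (simp add: BijGroup_def perm_monoid_def compose_def fun_eq_iff)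
    qed
  qed
  then have act: "group_action (perm_monoid K) UNIV L" by (rule group_action.intro)
  have o: "order (perm_monoid K) = p ^ (h * 3)"
    using cK card by (simp add: order_def perm_monoid_def power_mult power3_eq_cube)
  have E: "p dvd card (UNIV :: ('a \<times> 'a) set)"
    using card h by (simp add: dvd_power)
  have z: "L k 0 = 0" if "k \<in> K" for k using L0[OF that, of 0 0] by simp
  have "\<exists>y\<in>UNIV. y \<noteq> 0 \<and> (\<forall>g\<in>carrier (perm_monoid K). L g y = y)"
    by (rule p_group_second_fixed_point[OF act p o _ E]) (use z in \<open>simp_all add: perm_monoid_def\<close>)
  then show ?thesis by (simp add: perm_monoid_def)
qed

section \<open>Linear Singer groups\<close>

lemma symplectic_form_nondegenerate:
  assumes "symplectic_form \<beta>" and "v \<noteq> 0"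
  shows "\<exists>u. \<beta> v u \<noteq> 0"
proof -
  have "\<forall>u. (\<forall>v. \<beta> u v = 0) \<longrightarrow> u = 0"
    using assms(1) unfolding symplectic_form_def by (elim conjE)
  then show ?thesis using assms(2) by blast
qed

text \<open>Gram-Schmidt for the symplectic form, started from a prescribed pair. The key is a
  vector orthogonal to \<open>v3\<close> but not to \<open>v2\<close>; if none existed,
  nondegeneracy would make \<open>v2\<close> a multiple of \<open>v3\<close>.\<close>

lemma symp_frame_exists:
  assumes \<beta>: "symplectic_form (\<beta> :: ('a::{field,finite})^4 \<Rightarrow> 'a^4 \<Rightarrow> 'a)"
    and v3: "v3 \<noteq> 0" and v23: "\<beta> v2 v3 = 0" and v2: "v2 \<notin> point_of v3"
  shows "\<exists>e0 e1. symp_frame \<beta> e0 e1 v2 v3"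
proof -
  note bil = symplectic_form_bilinear[OF \<beta>]
  note sk = symplectic_form_skew[OF \<beta>]
  have bild: "\<beta> (a - b) z = \<beta> a z - \<beta> b z" for a b z
    using bil(1)[of "a - b" b z] by (simp add: algebra_simps)
  have nondeg: "\<exists>u. \<beta> u v \<noteq> 0" if nz: "v \<noteq> 0" for v
  proof -
    obtain u where "\<beta> v u \<noteq> 0" using symplectic_form_nondegenerate[OF \<beta> nz] by (rule exE)
    then have "\<beta> u v \<noteq> 0" using sk[of u v] by simp
    then show ?thesis by blast
  qed
  obtain u where u: "\<beta> u v3 \<noteq> 0" using nondeg[OF v3] by blast
  have "\<exists>w. \<beta> w v3 = 0 \<and> \<beta> w v2 \<noteq> 0"
  proof (rule ccontr)
    assume "\<not> ?thesis"
    then have no: "\<beta> w v2 = 0" if "\<beta> w v3 = 0" for w using that by blast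
    \<comment> \<open>The functional given by \<open>v2\<close> vanishes on the kernel of the one
      given by \<open>v3\<close>, hence is \<open>r\<close> times it; evaluation at \<open>u\<close>
      yields the factor.\<close>
    define r where "r = \<beta> u v2 / \<beta> u v3"
    have "\<beta> z (v2 + (- r) *s v3) = 0" for z
    proof -
      have "\<beta> (z - (\<beta> z v3 / \<beta> u v3) *s u) v3 = 0" using u by (simp only: bild bil) simp
      then have "\<beta> (z - (\<beta> z v3 / \<beta> u v3) *s u) v2 = 0" by (rule no)
      then have "\<beta> z v2 = (\<beta> z v3 / \<beta> u v3) * \<beta> u v2" by (simp only: bild bil) simp
      then show ?thesis unfolding bil r_def by (simp add: mult.commute)
    qed
    then have "v2 + (- r) *s v3 = 0" using nondeg by blast
    then have "v2 = r *s v3" by (simp add: eq_neg_iff_add_eq_0)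
    then show False using v2 by (auto simp: mem_point_of)
  qed
  then obtain w where w: "\<beta> w v3 = 0" "\<beta> w v2 \<noteq> 0" by blast
  define e1 where "e1 = (1 / \<beta> w v2) *s w"
  have e1: "\<beta> e1 v2 = 1" "\<beta> e1 v3 = 0" using w by (simp_all add: e1_def bil)
  define a where "a = (1 / \<beta> u v3) *s u"
  have a: "\<beta> a v3 = 1" using u by (simp add: a_def bil)
  \<comment> \<open>Two corrections follow: along \<open>e1\<close> to become orthogonal to
    \<open>v2\<close>, then along \<open>v2\<close> to become orthogonal to \<open>e1\<close>. Both
    directions are orthogonal to \<open>v3\<close>, so the pairing with \<open>v3\<close> stays
    1.\<close>
  define b where "b = a - \<beta> a v2 *s e1"
  have b: "\<beta> b v3 = 1" "\<beta> b v2 = 0" by (simp_all only: b_def bild bil a e1) simp_all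
  define e0 where "e0 = b + \<beta> b e1 *s v2"
  have v2e1: "\<beta> v2 e1 = - 1" using sk[of v2 e1] e1 by simp
  have "\<beta> e0 v3 = 1" "\<beta> e0 v2 = 0" "\<beta> e0 e1 = 0"
    by (simp_all add: e0_def bil b v23 v2e1)
  then have "symp_frame \<beta> e0 e1 v2 v3"
    using \<beta> e1 v23 by (intro symp_frame.intro)
  then show ?thesis by blast
qed

text \<open>A vector \<open>z\<close> outside the span of \<open>u\<close> and \<open>v3\<close>,
  where \<open>u\<close> is not orthogonal to \<open>v3\<close>, is moved along \<open>u\<close>
  into the hyperplane orthogonal to \<open>v3\<close>; it cannot land in the span of
  \<open>v3\<close>.\<close>

lemma perp_vector_exists:
  assumes \<beta>: "symplectic_form (\<beta> :: ('a::{field,finite})^4 \<Rightarrow> 'a^4 \<Rightarrow> 'a)" and v3: "v3 \<noteq> 0"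
  shows "\<exists>v2. \<beta> v2 v3 = 0 \<and> v2 \<notin> point_of v3"
proof -
  note bil = symplectic_form_bilinear[OF \<beta>]
  have bild: "\<beta> (a - b) z = \<beta> a z - \<beta> b z" for a b z
    using bil(1)[of "a - b" b z] by (simp add: algebra_simps)
  obtain u where "\<beta> v3 u \<noteq> 0" using symplectic_form_nondegenerate[OF \<beta> v3] by (rule exE)
  then have u: "\<beta> u v3 \<noteq> 0" using symplectic_form_skew[OF \<beta>, of u v3] by simp
  have "vec.dim {u, v3} \<le> card {u, v3}"
    by (rule vec.dim_le_card') simp
  also have "\<dots> \<le> 2" by (simp add: card_insert_if)
  finally have "vec.dim (vec.span {u, v3}) \<le> 2" by (simp only: vec.dim_span)
  moreover have "vec.dim (UNIV :: ('a^4) set) = 4" using vec_dim_card[where 'n = 4 and 'a = 'a] by simp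
  ultimately have "vec.span {u, v3} \<noteq> UNIV" by (metis numeral_le_iff semiring_norm(69) semiring_norm(71))
  then obtain z where z: "z \<notin> vec.span {u, v3}" by blast
  define w where "w = z - (\<beta> z v3 / \<beta> u v3) *s u"
  have "\<beta> w v3 = 0" using u by (simp only: w_def bild bil) simp
  moreover have "w \<notin> point_of v3"
  proof
    assume "w \<in> point_of v3"
    then have "z = w + (\<beta> z v3 / \<beta> u v3) *s u" "w \<in> vec.span {u, v3}"
      using vec.span_mono[of "{v3}" "{u, v3}"] by (auto simp: w_def point_of_def)
    moreover have "(\<beta> z v3 / \<beta> u v3) *s u \<in> vec.span {u, v3}"
      by (intro vec.span_scale vec.span_base) simp
    ultimately show False using z vec.span_add by metis
  qed
  ultimately show ?thesis by blast
qed

text \<open>The similitude relations between the images of the frame vectors fix everything except a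
  2 by 2 block, the image of \<open>e0\<close> and a scale; dividing by that scale gives the seven
  parameters.\<close>

lemma (in symp_frame) PGSp4_payne_affine:
  assumes f: "f \<in> PGSp4 \<beta>" and fx: "f x = x"
  shows "\<exists>m11 m12 m21 m22 v1 v2 w. m11 * m22 - m12 * m21 \<noteq> 0 \<and>
    induced_on_payne W x f = transport pp (payne_affine m11 m12 m21 m22 v1 v2 w)"
proof -
  obtain g c where lin: "Vector_Spaces.linear (*s) (*s) g" and c: "c \<noteq> 0"
    and sim': "\<forall>u v. \<beta> (g u) (g v) = c * \<beta> u v" and fg': "\<forall>p\<in>pg_points. f p = g ` p"
    using f unfolding PGSp4_def by (elim CollectE conjE exE) (rule that)
  note sim = sim'[rule_format] and fg = fg'[rule_format]
  have sim': "\<beta> (g (V r0 r1 r2 r3)) (g (V s0 s1 s2 s3)) = c * (r0 * s3 - r3 * s0 + r1 * s2 - r2 * s1)"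
    for r0 r1 r2 r3 s0 s1 s2 s3 unfolding sim form_V ..
  have "f x = point_of (g (V 0 0 0 1))"
    unfolding fg[OF x_point] unfolding x_eq by (rule image_point_of[OF lin])
  then have px: "point_of (g (V 0 0 0 1)) = point_of (V 0 0 0 1)" unfolding fx unfolding x_eq by simp
  have "g (V 0 0 0 1) \<noteq> 0"
  proof
    assume "g (V 0 0 0 1) = 0"
    then have "\<beta> (g (V 1 0 0 0)) (g (V 0 0 0 1)) = 0"
      using bil(4)[of "g (V 1 0 0 0)" 0 "g (V 0 0 0 1)"] by simp
    then show False unfolding sim' using c by simp
  qed
  then obtain d where d: "d \<noteq> 0" "g (V 0 0 0 1) = d *s V 0 0 0 1" using point_of_eqD[OF px] by blast
  have g3: "g (V 0 0 0 1) = V 0 0 0 d" using d(2) by (simp add: V_scale)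
  obtain n0 A B C where g0: "g (V 1 0 0 0) = V n0 A B C" by (rule V_cases)
  obtain p0 p1 p2 p3 where g1: "g (V 0 1 0 0) = V p0 p1 p2 p3" by (rule V_cases)
  obtain q0 q1 q2 q3 where g2: "g (V 0 0 1 0) = V q0 q1 q2 q3" by (rule V_cases)
  \<comment> \<open>Each relation below pairs two images of frame vectors. The pairs with
    \<open>e3\<close> kill the \<open>e0\<close>-coordinates \<open>p0\<close> and
    \<open>q0\<close>; those with \<open>e0\<close> determine \<open>p3\<close> and
    \<open>q3\<close>.\<close>
  have n0: "n0 * d = c" using sim'[of 1 0 0 0 0 0 0 1] unfolding g0 g3 form_V by simp
  then have n0': "n0 \<noteq> 0" using c by auto
  have p0: "p0 = 0" using sim'[of 0 1 0 0 0 0 0 1] d(1) unfolding g1 g3 form_V by simp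
  have q0: "q0 = 0" using sim'[of 0 0 1 0 0 0 0 1] d(1) unfolding g2 g3 form_V by simp
  have pq: "p1 * q2 - p2 * q1 = c" using sim'[of 0 1 0 0 0 0 1 0] unfolding g1 g2 form_V p0 q0 by simp
  have p3: "n0 * p3 + A * p2 - B * p1 = 0" using sim'[of 1 0 0 0 0 1 0 0] unfolding g0 g1 form_V p0 by simp
  have q3: "n0 * q3 + A * q2 - B * q1 = 0" using sim'[of 1 0 0 0 0 0 1 0] unfolding g0 g2 form_V q0 by simp
  \<comment> \<open>Rescaling makes the \<open>e0\<close>-coordinate of the image of
    \<open>e0\<close> equal to 1. The coefficient \<open>i * d\<close> of the third coordinate then
    equals the determinant of the rescaled block, by \<open>D\<close> and \<open>D'\<close>.\<close>
  define i where "i = 1 / n0"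
  have i: "i * n0 = 1" "i \<noteq> 0" using n0' by (simp_all add: i_def)
  have ip3: "i * p3 = i * p1 * (i * B) - i * p2 * (i * A)"
  proof -
    have "n0 * p3 = B * p1 - A * p2" using p3 by (simp add: algebra_simps)
    then have "i * (i * n0) * p3 = i * i * (B * p1 - A * p2)" by (simp add: mult.assoc)
    then show ?thesis unfolding i by (simp add: algebra_simps)
  qed
  have iq3: "i * q3 = i * q1 * (i * B) - i * q2 * (i * A)"
  proof -
    have "n0 * q3 = B * q1 - A * q2" using q3 by (simp add: algebra_simps)
    then have "i * (i * n0) * q3 = i * i * (B * q1 - A * q2)" by (simp add: mult.assoc)
    then show ?thesis unfolding i by (simp add: algebra_simps)
  qed
  have D: "(i * p1) * (i * q2) - (i * q1) * (i * p2) = i * i * c"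
    unfolding pq[symmetric] by (simp add: algebra_simps)
  have "i * i * (n0 * d) = i * (i * n0) * d" by (simp add: algebra_simps)
  then have D': "i * i * c = i * d" unfolding n0 i(1) by simp
  have "f (pp y) = pp (payne_affine (i * p1) (i * q1) (i * p2) (i * q2) (i * A) (i * B) (i * C) y)" for y
  proof -
    obtain a b t where y: "y = (a, b, t)" by (metis surj_pair)
    have "V 1 a b t = V 1 0 0 0 + a *s V 0 1 0 0 + b *s V 0 0 1 0 + t *s V 0 0 0 1"
      by (simp add: V_scale V_add)
    then have "g (V 1 a b t) = g (V 1 0 0 0) + a *s g (V 0 1 0 0) + b *s g (V 0 0 1 0) + t *s g (V 0 0 0 1)"
      by (simp only: vec.linear_add[OF lin] vec.linear_scale[OF lin])
    also have "\<dots> = V n0 (A + a * p1 + b * q1) (B + a * p2 + b * q2) (C + a * p3 + b * q3 + t * d)"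
      unfolding g0 g1 g2 g3 p0 q0 by (simp add: V_scale V_add)
    finally have gV: "g (V 1 a b t) = \<dots>" .
    have "f (pp y) = point_of (g (V 1 a b t))"
      unfolding fg[OF pp_point] unfolding y pp.simps by (rule image_point_of[OF lin])
    also have "\<dots> = point_of (i *s g (V 1 a b t))" using i(2) by (simp add: point_of_scale)
    also have "i *s g (V 1 a b t) = V 1 (i * p1 * a + i * q1 * b + i * A) (i * p2 * a + i * q2 * b + i * B)
        (i * C + a * (i * p3) + b * (i * q3) + i * d * t)"
      unfolding gV V_scale V_inject using i(1) by (simp add: algebra_simps)
    also have "i * C + a * (i * p3) + b * (i * q3) + i * d * t =
       ((i * p1) * (i * q2) - (i * q1) * (i * p2)) * t +
         ((i * p1 * a + i * q1 * b) * (i * B) - (i * p2 * a + i * q2 * b) * (i * A)) + i * C"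
      unfolding D D' ip3 iq3 by (simp add: algebra_simps)
    finally show ?thesis unfolding y payne_affine.simps pp.simps .
  qed
  then have "induced_on_payne W x f =
      transport pp (payne_affine (i * p1) (i * q1) (i * p2) (i * q2) (i * A) (i * B) (i * C))"
    by (rule induced_on_payne_transport)
  moreover have "(i * p1) * (i * q2) - (i * q1) * (i * p2) \<noteq> 0" unfolding D using i c by simp
  ultimately show ?thesis by blast
qed

lemma (in symp_frame) linear_singer_affine:
  assumes K: "linear_singer_group \<beta> x K" and k: "k \<in> K"
  shows "\<exists>f m11 m12 m21 m22 v1 v2 w. f \<in> overline_group W x K \<and> m11 * m22 - m12 * m21 \<noteq> 0 \<and>
    k = transport pp (payne_affine m11 m12 m21 m22 v1 v2 w) \<and>
    f = payne_collineation m11 m12 m21 m22 v1 v2 w"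
proof -
  have ov: "induced_on_payne W x ` overline_group W x K = K"
    and sub: "overline_group W x K \<subseteq> {f \<in> PGSp4 \<beta>. f x = x}"
    using K unfolding linear_singer_group_def by blast+
  have "k \<in> induced_on_payne W x ` overline_group W x K" unfolding ov by (rule k)
  then obtain f where f: "f \<in> overline_group W x K" "k = induced_on_payne W x f" by blast
  then have "f \<in> PGSp4 \<beta>" "f x = x" using sub by blast+
  then obtain m11 m12 m21 m22 v1 v2 w where D: "m11 * m22 - m12 * m21 \<noteq> 0" and
      e: "induced_on_payne W x f = transport pp (payne_affine m11 m12 m21 m22 v1 v2 w)"
    using PGSp4_payne_affine by blast
  have "f \<in> point_stabilizer W x" using f(1) by (simp add: overline_group_def)
  then have "f = payne_collineation m11 m12 m21 m22 v1 v2 w"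
    using e by (rule payne_collineation_induced_eq[OF D])
  then show ?thesis using f D e by blast
qed

text \<open>Subtracting the image of the origin removes the translation. Setting the third
  coordinate to 0 is harmless for \<open>payne_affine\<close> maps, whose first two coordinates
  ignore it.\<close>

definition linear_part :: "('a \<times> 'a \<times> 'a \<Rightarrow> 'a \<times> 'a \<times> 'a) \<Rightarrow> 'a \<times> 'a \<Rightarrow> ('a::field) \<times> 'a" where
  "linear_part k v = (fst (k (fst v, snd v, 0)) - fst (k (0, 0, 0)),
     fst (snd (k (fst v, snd v, 0))) - fst (snd (k (0, 0, 0))))"

lemma linear_part_payne_affine:
  "linear_part (payne_affine m11 m12 m21 m22 v1 v2 w) (a, b) = (m11 * a + m12 * b, m21 * a + m22 * b)"
  by (simp add: linear_part_def)

lemma payne_affine_comp: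
  "\<exists>v1'' v2'' w''. payne_affine m11 m12 m21 m22 v1 v2 w \<circ> payne_affine n11 n12 n21 n22 v1' v2' w' =
    payne_affine (m11 * n11 + m12 * n21) (m11 * n12 + m12 * n22) (m21 * n11 + m22 * n21) (m21 * n12 + m22 * n22)
      v1'' v2'' w''"
  by (rule exI[of _ "m11 * v1' + m12 * v2' + v1"], rule exI[of _ "m21 * v1' + m22 * v2' + v2"],
      rule exI[of _ "(m11 * m22 - m12 * m21) * w' + ((m11 * v1' + m12 * v2') * v2 - (m21 * v1' + m22 * v2') * v1) + w"])
     (simp add: fun_eq_iff algebra_simps)

lemma affine_group_fixes_direction:
  fixes K :: "('a::{field,finite} \<times> 'a \<times> 'a \<Rightarrow> 'a \<times> 'a \<times> 'a) set"
  assumes p: "prime p" and card: "CARD('a) = p ^ h" and h: "h > 0"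
    and G: "group (perm_monoid K)" and cK: "card K = CARD('a \<times> 'a \<times> 'a)"
    and K: "\<And>k. k \<in> K \<Longrightarrow> \<exists>m11 m12 m21 m22 v1 v2 w. m11 * m22 - m12 * m21 \<noteq> 0 \<and>
      k = payne_affine m11 m12 m21 m22 v1 v2 w"
  shows "\<exists>z. z \<noteq> 0 \<and> (\<forall>k\<in>K. linear_part k z = z)"
proof (rule regular_p_group_fixes_direction[OF p card h G cK])
  fix k assume kK: "k \<in> K"
  obtain m11 m12 m21 m22 v1 v2 w where D: "m11 * m22 - m12 * m21 \<noteq> 0"
    and k: "k = payne_affine m11 m12 m21 m22 v1 v2 w" using K[OF kK] by (elim exE conjE) (rule that)
  show "linear_part k (v + v') = linear_part k v + linear_part k v'" for v v'
    unfolding k by (cases v; cases v') (simp add: linear_part_payne_affine algebra_simps)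
  show "inj (linear_part k)"
  proof (rule injI)
    fix v v' assume e: "linear_part k v = linear_part k v'"
    obtain a b a' b' where v: "v = (a, b)" "v' = (a', b')" by (metis surj_pair)
    have "m11 * a + m12 * b = m11 * a' + m12 * b'" "m21 * a + m22 * b = m21 * a' + m22 * b'"
      using e unfolding v k linear_part_payne_affine by simp_all
    then have "a = a' \<and> b = b'" by (rule linear_2x2_inj[OF D])
    then show "v = v'" unfolding v by simp
  qed
  fix k' assume k'K: "k' \<in> K"
  obtain n11 n12 n21 n22 u1 u2 w' where "n11 * n22 - n12 * n21 \<noteq> 0" and
    k': "k' = payne_affine n11 n12 n21 n22 u1 u2 w'" using K[OF k'K] by (elim exE conjE) (rule that)
  have "\<exists>v1'' v2'' w''. k \<circ> k' =
    payne_affine (m11 * n11 + m12 * n21) (m11 * n12 + m12 * n22) (m21 * n11 + m22 * n21) (m21 * n12 + m22 * n22)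
      v1'' v2'' w''"
    unfolding k k' by (rule payne_affine_comp)
  then obtain v1'' v2'' w'' where e: "k \<circ> k' =
    payne_affine (m11 * n11 + m12 * n21) (m11 * n12 + m12 * n22) (m21 * n11 + m22 * n21) (m21 * n12 + m22 * n22)
      v1'' v2'' w''" by (elim exE) (rule that)
  have "linear_part (k \<circ> k') v = (linear_part k \<circ> linear_part k') v" for v
  proof -
    obtain a b where v: "v = (a, b)" by (metis surj_pair)
    show ?thesis
      unfolding e comp_apply unfolding k k' v linear_part_payne_affine by (simp add: algebra_simps)
  qed
  then show "linear_part (k \<circ> k') = linear_part k \<circ> linear_part k'" by (rule HOL.ext)
qed

text \<open>The diagonal entries of the iterate are \<open>m11\<close> and \<open>m22\<close> raised
  to a power of q, which in a field of order q are \<open>m11\<close> and \<open>m22\<close>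
  themselves. The iterate is the identity, so both are 1.\<close>

lemma triangular_periodic_unipotent:
  fixes m11 :: "'a::{field,finite}"
  assumes k: "k = payne_affine m11 0 m21 m22 v1 v2 w" and per: "k ^^ (CARD('a) ^ n) = id"
  shows "m11 = 1 \<and> m22 = 1"
proof -
  \<comment> \<open>Only diagonal powers are tracked; the off-diagonal and translation contributions
    are collected in \<open>e\<close> and in the unspecified function \<open>g\<close> of
    \<open>a\<close>.\<close>
  have "\<exists>e g. \<forall>a b c. fst ((k ^^ i) (a, b, c)) = m11 ^ i * a + e \<and>
      fst (snd ((k ^^ i) (a, b, c))) = m22 ^ i * b + g a" for i
  proof (induction i)
    case 0
    show ?case by (rule exI[of _ 0], rule exI[of _ "\<lambda>a. 0"]) simp
  next
    case (Suc i)
    then obtain e g where eg: "\<And>a b c. fst ((k ^^ i) (a, b, c)) = m11 ^ i * a + e"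
      "\<And>a b c. fst (snd ((k ^^ i) (a, b, c))) = m22 ^ i * b + g a" by blast
    have "fst (k y) = m11 * fst y + v1" "fst (snd (k y)) = m21 * fst y + m22 * fst (snd y) + v2" for y
      unfolding k by (cases y; simp)+
    then have "fst ((k ^^ Suc i) (a, b, c)) = m11 ^ Suc i * a + (m11 * e + v1) \<and>
      fst (snd ((k ^^ Suc i) (a, b, c))) = m22 ^ Suc i * b + (m21 * (m11 ^ i * a + e) + m22 * g a + v2)"
      for a b c by (simp add: eg algebra_simps)
    then show ?case
      by (intro exI[of _ "m11 * e + v1"] exI[of _ "\<lambda>a. m21 * (m11 ^ i * a + e) + m22 * g a + v2"] allI)
  qed
  then obtain e g where eg: "\<And>a b c. fst ((k ^^ (CARD('a) ^ n)) (a, b, c)) = m11 ^ (CARD('a) ^ n) * a + e"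
      "\<And>a b c. fst (snd ((k ^^ (CARD('a) ^ n)) (a, b, c))) = m22 ^ (CARD('a) ^ n) * b + g a" by blast
  have a: "a = m11 * a + e" for a using eg(1)[of a 0 0] unfolding per power_CARD_power_eq by simp
  have b: "b = m22 * b + g 0" for b using eg(2)[of 0 b 0] unfolding per power_CARD_power_eq by simp
  show ?thesis using a[of 0] a[of 1] b[of 0] b[of 1] by simp
qed

lemma (in symp_frame) linear_singer_coordinates:
  assumes K: "linear_singer_group \<beta> x K"
  obtains K' where "K = transport pp ` K'" "group (perm_monoid K')" "card K' = CARD('a \<times> 'a \<times> 'a)"
    "\<And>\<kappa> \<kappa>'. \<kappa> \<in> K' \<Longrightarrow> \<kappa>' \<in> K' \<Longrightarrow> \<kappa> \<circ> \<kappa>' \<in> K'"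
    "\<And>y z. \<exists>!\<kappa>. \<kappa> \<in> K' \<and> \<kappa> y = z"
    "\<And>\<kappa>. \<kappa> \<in> K' \<Longrightarrow> \<exists>m11 m12 m21 m22 v1 v2 w. m11 * m22 - m12 * m21 \<noteq> 0 \<and>
      \<kappa> = payne_affine m11 m12 m21 m22 v1 v2 w \<and>
      payne_collineation m11 m12 m21 m22 v1 v2 w \<in> overline_group W x K"
proof -
  have S: "singer_group P K" using K by (simp add: linear_singer_group_def)
  obtain K' where K': "K = transport pp ` K'" "\<And>\<kappa>. \<kappa> \<in> K' \<Longrightarrow> bij \<kappa>"
    "\<And>\<kappa> \<kappa>'. \<kappa> \<in> K' \<Longrightarrow> \<kappa>' \<in> K' \<Longrightarrow> \<kappa> \<circ> \<kappa>' \<in> K'"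
    "\<And>y z. \<exists>!\<kappa>. \<kappa> \<in> K' \<and> \<kappa> y = z"
    by (rule singer_group_transportD[OF inj_pp payne_Points S]) (rule that)
  show ?thesis
  proof (rule that[OF K'(1) regular_closed_group[OF K'(2,3,4)] regular_card[OF K'(4)] K'(3) K'(4)])
    fix \<kappa> assume "\<kappa> \<in> K'"
    then have "transport pp \<kappa> \<in> K" unfolding K'(1) by (rule imageI)
    then obtain f m11 m12 m21 m22 v1 v2 w where f: "f \<in> overline_group W x K" "m11 * m22 - m12 * m21 \<noteq> 0"
      "transport pp \<kappa> = transport pp (payne_affine m11 m12 m21 m22 v1 v2 w)"
      "f = payne_collineation m11 m12 m21 m22 v1 v2 w"
      using linear_singer_affine[OF K] by blast
    have "\<kappa> = payne_affine m11 m12 m21 m22 v1 v2 w" using f(3) unfolding transport_inject[OF inj_pp] .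
    then show "\<exists>m11 m12 m21 m22 v1 v2 w. m11 * m22 - m12 * m21 \<noteq> 0 \<and>
      \<kappa> = payne_affine m11 m12 m21 m22 v1 v2 w \<and>
      payne_collineation m11 m12 m21 m22 v1 v2 w \<in> overline_group W x K"
      using f by blast
  qed
qed

text \<open>The fixed vector of the linear parts is turned into a statement about \<open>v2\<close>
  and the overlined group that does not refer to coordinates, so that it remains available in a
  different frame. The multiple of \<open>e3\<close> appears because only the action modulo
  \<open>e3\<close> is seen on pairs \<open>(a, b)\<close>.\<close>

lemma (in symp_frame) linear_singer_direction:
  assumes p: "prime p" and card: "CARD('a) = p ^ h" and h: "h > 0" and K: "linear_singer_group \<beta> x K"
  shows "\<exists>v2. \<beta> v2 e3 = 0 \<and> v2 \<notin> point_of e3 \<and>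
    (\<forall>f\<in>overline_group W x K. \<exists>r. f (point_of v2) = point_of (v2 + r *s e3))"
proof -
  obtain K' where KK: "K = transport pp ` K'" and G: "group (perm_monoid K')"
    and cK: "card K' = CARD('a \<times> 'a \<times> 'a)"
    and aff: "\<And>\<kappa>. \<kappa> \<in> K' \<Longrightarrow> \<exists>m11 m12 m21 m22 v1 v2 w. m11 * m22 - m12 * m21 \<noteq> 0 \<and>
      \<kappa> = payne_affine m11 m12 m21 m22 v1 v2 w \<and>
      payne_collineation m11 m12 m21 m22 v1 v2 w \<in> overline_group W x K"
    by (rule linear_singer_coordinates[OF K]) (rule that)
  have "\<exists>z. z \<noteq> 0 \<and> (\<forall>k\<in>K'. linear_part k z = z)"
  proof (rule affine_group_fixes_direction[OF p card h G cK])
    fix k assume "k \<in> K'"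
    from aff[OF this] show "\<exists>m11 m12 m21 m22 v1 v2 w. m11 * m22 - m12 * m21 \<noteq> 0 \<and>
        k = payne_affine m11 m12 m21 m22 v1 v2 w" by (elim exE conjE) (intro exI conjI)
  qed
  then obtain z where z: "z \<noteq> 0" "\<And>k. k \<in> K' \<Longrightarrow> linear_part k z = z" by blast
  obtain z1 z2 where zz: "z = (z1, z2)" by (metis surj_pair)
  have z0: "z1 \<noteq> 0 \<or> z2 \<noteq> 0" using z(1) by (auto simp: zz zero_prod_def)
  define v2 where "v2 = V 0 z1 z2 0"
  have v23: "\<beta> v2 e3 = 0" unfolding v2_def using form_V[of 0 z1 z2 0 0 0 0 1] by (simp add: V_frame)
  have n3: "v2 \<notin> point_of e3"
  proof
    assume "v2 \<in> point_of e3"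
    then have "v2 \<in> point_of (V 0 0 0 1)" by (simp add: V_frame)
    then obtain k where "V 0 z1 z2 0 = k *s V 0 0 0 1" unfolding mem_point_of v2_def by (elim exE)
    then show False using z0 unfolding V_scale V_inject by simp
  qed
  have "\<exists>r. f (point_of v2) = point_of (v2 + r *s e3)" if f: "f \<in> overline_group W x K" for f
  proof -
    have fs: "f \<in> point_stabilizer W x" and fK: "induced_on_payne W x f \<in> K"
      using f by (simp_all add: overline_group_def)
    obtain k where k: "k \<in> K'" and fk: "induced_on_payne W x f = transport pp k"
      using fK unfolding KK by (elim imageE)
    obtain m11 m12 m21 m22 u1 u2 w where D: "m11 * m22 - m12 * m21 \<noteq> 0" and
        keq: "k = payne_affine m11 m12 m21 m22 u1 u2 w" and
        "payne_collineation m11 m12 m21 m22 u1 u2 w \<in> overline_group W x K"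
      using aff[OF k] by (elim exE conjE) (rule that)
    have feq: "f = payne_collineation m11 m12 m21 m22 u1 u2 w"
      by (rule payne_collineation_induced_eq[OF D fs]) (simp only: fk keq)
    have lz: "m11 * z1 + m12 * z2 = z1" "m21 * z1 + m22 * z2 = z2"
      using z(2)[OF k] unfolding keq zz linear_part_payne_affine by simp_all
    have "v2 \<noteq> 0" unfolding v2_def V_eq_0_iff using z0 by blast
    then have "f (point_of v2) = payne_linear m11 m12 m21 m22 u1 u2 w ` point_of v2"
      unfolding feq payne_collineation_def by (intro restrict_apply' point_of_in_pg_points)
    also have "\<dots> = point_of (payne_linear m11 m12 m21 m22 u1 u2 w v2)"
      by (rule image_point_of[OF payne_linear_linear])
    also have "payne_linear m11 m12 m21 m22 u1 u2 w v2 =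
        V 0 z1 z2 (z1 * u2 - z2 * u1)"
      unfolding v2_def payne_linear_V V_inject using lz by simp
    also have "\<dots> = v2 + (z1 * u2 - z2 * u1) *s e3"
      unfolding v2_def V_def by simp
    finally show ?thesis by blast
  qed
  then show ?thesis using v23 n3 by blast
qed

text \<open>When \<open>e2\<close> spans the fixed direction modulo \<open>e3\<close>, the linear
  parts are triangular, and having q-power order they are unipotent. This reduces the classification
  to \<open>regular_unipotent_group\<close>.\<close>

lemma (in symp_frame) linear_singer_unipotent:
  assumes K: "linear_singer_group \<beta> x K"
    and dir: "\<And>f. f \<in> overline_group W x K \<Longrightarrow> \<exists>r. f (point_of e2) = point_of (e2 + r *s e3)"
    and odd: "(2::'a) \<noteq> 0 \<or> symmetries W x \<subseteq> overline_group W x K"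
  shows "\<exists>r :: 'a \<Rightarrow> 'a. (\<forall>a b. r (a + b) = r a + r b) \<and> K = transport pp ` unipotent_graph r"
proof -
  obtain K' where KK: "K = transport pp ` K'" and G: "group (perm_monoid K')"
    and cK: "card K' = CARD('a \<times> 'a \<times> 'a)"
    and closed: "\<And>\<kappa> \<kappa>'. \<kappa> \<in> K' \<Longrightarrow> \<kappa>' \<in> K' \<Longrightarrow> \<kappa> \<circ> \<kappa>' \<in> K'"
    and trans: "\<And>y z. \<exists>!\<kappa>. \<kappa> \<in> K' \<and> \<kappa> y = z"
    and aff: "\<And>\<kappa>. \<kappa> \<in> K' \<Longrightarrow> \<exists>m11 m12 m21 m22 v1 v2 w. m11 * m22 - m12 * m21 \<noteq> 0 \<and>
      \<kappa> = payne_affine m11 m12 m21 m22 v1 v2 w \<and>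
      payne_collineation m11 m12 m21 m22 v1 v2 w \<in> overline_group W x K"
    by (rule linear_singer_coordinates[OF K]) (rule that)
  have cK3: "card K' = CARD('a) ^ 3" using cK by (simp add: power3_eq_cube)
  have uni: "\<exists>s t u w. k = unipotent_map s t u w" if k: "k \<in> K'" for k
  proof -
    obtain m11 m12 m21 m22 v1 v2 w where D: "m11 * m22 - m12 * m21 \<noteq> 0" and
        keq: "k = payne_affine m11 m12 m21 m22 v1 v2 w" and
        f: "payne_collineation m11 m12 m21 m22 v1 v2 w \<in> overline_group W x K"
      using aff[OF k] by (elim exE conjE) (rule that)
    obtain r where r: "payne_collineation m11 m12 m21 m22 v1 v2 w (point_of e2) = point_of (e2 + r *s e3)"
      using dir[OF f] by (rule exE)
    have e2V: "V 0 0 1 0 = e2" "V 0 0 1 r = e2 + r *s e3" by (simp_all add: V_def)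
    have "V 0 0 1 0 \<noteq> 0" by (simp add: V_eq_0_iff)
    then have "payne_collineation m11 m12 m21 m22 v1 v2 w (point_of (V 0 0 1 0)) =
        payne_linear m11 m12 m21 m22 v1 v2 w ` point_of (V 0 0 1 0)"
      unfolding payne_collineation_def by (intro restrict_apply' point_of_in_pg_points)
    also have "\<dots> = point_of (payne_linear m11 m12 m21 m22 v1 v2 w (V 0 0 1 0))"
      by (rule image_point_of[OF payne_linear_linear])
    also have "\<dots> = point_of (V 0 m12 m22 (m12 * v2 - m22 * v1))"
      unfolding payne_linear_V by simp
    finally have "payne_collineation m11 m12 m21 m22 v1 v2 w (point_of (V 0 0 1 0)) =
        point_of (V 0 m12 m22 (m12 * v2 - m22 * v1))" .
    from this[unfolded e2V] r have "point_of (V 0 m12 m22 (m12 * v2 - m22 * v1)) = point_of (V 0 0 1 r)"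
      unfolding e2V by (rule HOL.trans[OF HOL.sym])
    moreover have "V 0 m12 m22 (m12 * v2 - m22 * v1) \<noteq> 0"
    proof
      assume "V 0 m12 m22 (m12 * v2 - m22 * v1) = 0"
      then have "m12 = 0" "m22 = 0" unfolding V_eq_0_iff by simp_all
      with D show False by simp
    qed
    ultimately obtain j where "V 0 m12 m22 (m12 * v2 - m22 * v1) = j *s V 0 0 1 r"
      by (rule point_of_eqD)
    then have m12: "m12 = 0" unfolding V_scale V_inject by simp
    \<comment> \<open>The direction was only used projectively, so \<open>m22\<close> is not yet
      known to be 1; periodicity settles both diagonal entries.\<close>
    have "k ^^ (CARD('a) ^ 3) = id" using regular_funpow_card[OF G k] unfolding cK3 .
    then have "m11 = 1 \<and> m22 = 1"
      by (rule triangular_periodic_unipotent[OF keq[unfolded m12]])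
    then have "k = unipotent_map v1 m21 v2 w"
      unfolding keq m12 unipotent_map_eq_payne_affine by simp
    then show ?thesis by blast
  qed
  have sym: "(2::'a) \<noteq> 0 \<or> (\<forall>w. unipotent_map 0 0 0 w \<in> K')"
  proof (cases "(2::'a) = 0")
    case True
    then have S: "symmetries W x \<subseteq> overline_group W x K" using odd by (elim disjE) (erule (1) notE)
    have "unipotent_map 0 0 0 w \<in> K'" for w
    proof -
      have "unipotent 0 0 0 w \<in> overline_group W x K" using unipotent_symmetry S by (rule rev_subsetD)
      then have "transport pp (unipotent_map 0 0 0 w) \<in> transport pp ` K'"
        unfolding overline_group_def mem_Collect_eq induced_unipotent KK by (rule conjunct2)
      then obtain k where "k \<in> K'" "transport pp (unipotent_map 0 0 0 w) = transport pp k" by (elim imageE)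
      then show ?thesis unfolding transport_inject[OF inj_pp] by (simp only:)
    qed
    then show ?thesis by blast
  qed simp
  have "\<exists>r. (\<forall>s s'. r (s + s') = r s + r s') \<and> K' = {unipotent_map s (r s) u w | s u w. True}"
    by (rule regular_unipotent_group) (erule uni, erule (1) closed, rule trans, rule sym)
  then obtain r :: "'a \<Rightarrow> 'a" where "\<forall>s s'. r (s + s') = r s + r s'"
      "K' = {unipotent_map s (r s) u w | s u w. True}" by (elim exE conjE) (rule that)
  then show ?thesis unfolding KK unipotent_graph_def by (intro exI[of _ r] conjI) simp_all
qed

text \<open>Each element has order dividing q^3, a power of p, so its field automorphism has p-power
  order and is trivial.\<close>

lemma (in symp_frame) singer_group_linear:
  assumes p: "prime p" "odd p" and card: "CARD('a) = p ^ h" and q: "5 \<le> CARD('a)" and cop: "coprime p h"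
    and K: "singer_group P K"
  shows "linear_singer_group \<beta> x K"
proof -
  obtain K' where K': "K = transport pp ` K'" "\<And>\<kappa>. \<kappa> \<in> K' \<Longrightarrow> bij \<kappa>"
    "\<And>\<kappa> \<kappa>'. \<kappa> \<in> K' \<Longrightarrow> \<kappa>' \<in> K' \<Longrightarrow> \<kappa> \<circ> \<kappa>' \<in> K'"
    "\<And>y z. \<exists>!\<kappa>. \<kappa> \<in> K' \<and> \<kappa> y = z"
    by (rule singer_group_transportD[OF inj_pp payne_Points K]) (rule that)
  have G: "group (perm_monoid K')" by (rule regular_closed_group[OF K'(2,3,4)])
  have "card K' = CARD('a \<times> 'a \<times> 'a)" by (rule regular_card[OF K'(4)])
  then have cK: "card K' = p ^ (h * 3)" by (simp add: card power_mult power3_eq_cube)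
  show ?thesis
  proof (rule linear_singer_groupI[OF K])
    fix k assume kK: "k \<in> K"
    then obtain \<kappa> where \<kappa>: "\<kappa> \<in> K'" "k = transport pp \<kappa>" unfolding K'(1) by (elim imageE)
    have "K \<subseteq> automorphisms P"
      using K unfolding singer_group_def by (metis carrier_aut_group subgroup.subset)
    then have ka: "transport pp \<kappa> \<in> automorphisms P" using kK \<kappa>(2) by blast
    have coll: "payne_coll (\<kappa> y) (\<kappa> z) \<longleftrightarrow> payne_coll y z" for y z
    proof -
      have "pp y \<in> Points P" "pp z \<in> Points P" unfolding payne_Points by (rule rangeI)+
      from automorphism_collinear[OF ka this] show ?thesis
        unfolding transport_apply[OF inj_pp] payne_collinear .
    qed
    have "\<kappa> ^^ (p ^ (h * 3)) = id" using regular_funpow_card[OF G \<kappa>(1)] unfolding cK .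
    from payne_collineation_linear[OF p card q cop K'(2)[OF \<kappa>(1)] coll this]
    show "\<exists>m11 m12 m21 m22 v1 v2 w. m11 * m22 - m12 * m21 \<noteq> 0 \<and>
        k = transport pp (payne_affine m11 m12 m21 m22 v1 v2 w)"
      unfolding \<kappa>(2) transport_inject[OF inj_pp] .
  qed
qed

section \<open>Choice of the frame, and the two inclusions\<close>

lemma frame_at_point:
  assumes \<beta>: "symplectic_form (\<beta> :: ('a::{field,finite})^4 \<Rightarrow> 'a^4 \<Rightarrow> 'a)" and v3: "v3 \<noteq> 0"
  shows "\<exists>e0 e1 e2. symp_frame \<beta> e0 e1 e2 v3"
  using perp_vector_exists[OF \<beta> v3] symp_frame_exists[OF \<beta> v3] by blast

text \<open>A point at infinity is the parallel class of some line of the plane, and a vector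
  spanning that line serves as \<open>e2\<close> in a new frame.\<close>

lemma frame_at_infinity:
  assumes \<beta>: "symplectic_form (\<beta> :: ('a::{field,finite})^4 \<Rightarrow> 'a^4 \<Rightarrow> 'a)" and v3: "v3 \<noteq> 0"
    and l: "l \<in> points_at_infinity (plane_at (symplectic_quadrangle \<beta>) (vec.span {v3}))"
  shows "\<exists>e0 e1 e2. symp_frame \<beta> e0 e1 e2 v3 \<and>
    l = parallel_class (plane_at (symplectic_quadrangle \<beta>) (vec.span {v3})) (point_of e2)"
proof -
  obtain e0 e1 e2 where F: "symp_frame \<beta> e0 e1 e2 v3" using frame_at_point[OF \<beta> v3] by (elim exE)
  interpret symp_frame \<beta> e0 e1 e2 v3 by (rule F)
  obtain y where y: "y \<in> Lines Pl" "l = parallel_class Pl y"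
    using l unfolding points_at_infinity_def by (elim imageE)
  then obtain r1 r2 r3 where yr: "y = point_of (V 0 r1 r2 r3)" "r1 \<noteq> 0 \<or> r2 \<noteq> 0"
    unfolding plane_Lines by (elim UnE CollectE exE conjE) (metis zero_neq_one)+
  have "\<beta> (V 0 r1 r2 r3) v3 = 0" using form_V[of 0 r1 r2 r3 0 0 0 1] by (simp add: V_frame)
  moreover have "V 0 r1 r2 r3 \<notin> point_of v3"
  proof
    assume "V 0 r1 r2 r3 \<in> point_of v3"
    then have "V 0 r1 r2 r3 \<in> point_of (V 0 0 0 1)" by (simp add: V_frame)
    then obtain k where "V 0 r1 r2 r3 = k *s V 0 0 0 1" unfolding mem_point_of by (elim exE)
    then show False using yr(2) unfolding V_scale V_inject by simp
  qed
  ultimately obtain f0 f1 where "symp_frame \<beta> f0 f1 (V 0 r1 r2 r3) v3"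
    using symp_frame_exists[OF \<beta> v3] by blast
  then show ?thesis using y(2) yr(1) by blast
qed

lemma eta_linear_singer_group:
  assumes \<beta>: "symplectic_form (\<beta> :: ('a::{field,finite})^4 \<Rightarrow> 'a^4 \<Rightarrow> 'a)" and v3: "v3 \<noteq> 0"
    and x: "x = vec.span {v3}"
    and l: "l \<in> points_at_infinity (plane_at (symplectic_quadrangle \<beta>) x)"
    and U: "U \<in> complement_subgroups CARD('a) (plane_at (symplectic_quadrangle \<beta>) x) l"
  shows "linear_singer_group \<beta> x (eta (symplectic_quadrangle \<beta>) x l U) \<and>
    symmetries (symplectic_quadrangle \<beta>) x \<subseteq>
      overline_group (symplectic_quadrangle \<beta>) x (eta (symplectic_quadrangle \<beta>) x l U)"
proof -
  obtain e0 e1 e2 where F: "symp_frame \<beta> e0 e1 e2 v3" and le: "l = parallel_class (plane_at (symplectic_quadrangle \<beta>) (vec.span {v3})) (point_of e2)"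
    using frame_at_infinity[OF \<beta> v3 l[unfolded x]] by (elim exE conjE) (rule that)
  interpret F: symp_frame \<beta> e0 e1 e2 v3 by (rule F)
  have lv: "l = F.vcl" unfolding le F.plane_class ..
  have "eta F.W x l U \<in> {eta F.W (vec.span {v3}) F.vcl U | U. U \<in> complement_subgroups CARD('a) F.Pl F.vcl}"
    using U unfolding x lv by blast
  then obtain r :: "'a \<Rightarrow> 'a" where r: "\<forall>a b. r (a + b) = r a + r b"
      and e: "eta F.W x l U = transport F.pp ` unipotent_graph r"
    unfolding F.eta_vcl by (elim CollectE exE conjE) (rule that)
  show ?thesis
    unfolding e unfolding x
    using F.linear_singer_unipotent_graph[of r] F.symmetries_subset_overline[of r] r by blast
qed

lemma linear_singer_group_eta:
  assumes \<beta>: "symplectic_form (\<beta> :: ('a::{field,finite})^4 \<Rightarrow> 'a^4 \<Rightarrow> 'a)" and v3: "v3 \<noteq> 0"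
    and x: "x = vec.span {v3}"
    and p: "prime p" and card: "CARD('a) = p ^ h" and h: "h > 0"
    and K: "linear_singer_group \<beta> x K"
    and odd: "(2::'a) \<noteq> 0 \<or> symmetries (symplectic_quadrangle \<beta>) x \<subseteq> overline_group (symplectic_quadrangle \<beta>) x K"
  shows "\<exists>l U. K = eta (symplectic_quadrangle \<beta>) x l U \<and>
    l \<in> points_at_infinity (plane_at (symplectic_quadrangle \<beta>) x) \<and>
    U \<in> complement_subgroups CARD('a) (plane_at (symplectic_quadrangle \<beta>) x) l"
proof -
  obtain e0 e1 e2 where F: "symp_frame \<beta> e0 e1 e2 v3" using frame_at_point[OF \<beta> v3] by (elim exE)
  interpret F: symp_frame \<beta> e0 e1 e2 v3 by (rule F)
  obtain v2 where v2: "\<beta> v2 v3 = 0" "v2 \<notin> point_of v3"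
      "\<forall>f\<in>overline_group F.W (vec.span {v3}) K. \<exists>r. f (point_of v2) = point_of (v2 + r *s v3)"
    using F.linear_singer_direction[OF p card h K[unfolded x]] by (elim exE conjE) (rule that)
  obtain f0 f1 where F': "symp_frame \<beta> f0 f1 v2 v3"
    using symp_frame_exists[OF \<beta> v3 v2(1,2)] by (elim exE)
  \<comment> \<open>The first frame serves only to find \<open>v2\<close>. Both frames have the same
    last vector, hence the same \<open>x\<close>, and in the second one the fixed direction is
    vertical.\<close>
  interpret F': symp_frame \<beta> f0 f1 v2 v3 by (rule F')
  interpret C: coord_plane F'.Pl F'.plp by (rule F'.coord_plane_Pl)
  have "\<exists>r :: 'a \<Rightarrow> 'a. (\<forall>a b. r (a + b) = r a + r b) \<and> K = transport F'.pp ` unipotent_graph r"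
    by (rule F'.linear_singer_unipotent[OF K[unfolded x] _ odd[unfolded x]]) (erule v2(3)[THEN bspec])
  then have "K \<in> {eta F'.W (vec.span {v3}) F'.vcl U | U. U \<in> complement_subgroups CARD('a) F'.Pl F'.vcl}"
    unfolding F'.eta_vcl by blast
  then obtain U where "K = eta F'.W (vec.span {v3}) F'.vcl U" "U \<in> complement_subgroups CARD('a) F'.Pl F'.vcl"
    by (elim CollectE exE conjE) (rule that)
  then show ?thesis unfolding x using C.vclass_at_infinity by blast
qed

theorem theorem4p9:
  fixes \<beta> :: "('a::{field,finite}) ^ 4 \<Rightarrow> 'a ^ 4 \<Rightarrow> 'a"
    and x :: "('a ^ 4) set"
    and p h q :: nat
  assumes "prime p" and "q = p ^ h" and "CARD('a) = q"
    and "symplectic_form \<beta>"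
    and "x \<in> Points (symplectic_quadrangle \<beta>)"
  shows
    "(odd p \<and> 5 \<le> q \<longrightarrow>
        {K. linear_singer_group \<beta> x K} =
          {eta (symplectic_quadrangle \<beta>) x l U | l U.
             l \<in> points_at_infinity (plane_at (symplectic_quadrangle \<beta>) x) \<and>
             U \<in> complement_subgroups q (plane_at (symplectic_quadrangle \<beta>) x) l} \<and>
        (gcd p h = 1 \<longrightarrow>
          {K. singer_group (payne_derived (symplectic_quadrangle \<beta>) x) K} =
            {eta (symplectic_quadrangle \<beta>) x l U | l U.
               l \<in> points_at_infinity (plane_at (symplectic_quadrangle \<beta>) x) \<and>
               U \<in> complement_subgroups q (plane_at (symplectic_quadrangle \<beta>) x) l})) \<and>
     (even q \<and> 8 \<le> q \<longrightarrow>
        {K. linear_singer_group \<beta> x K \<and>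
            symmetries (symplectic_quadrangle \<beta>) x
              \<subseteq> overline_group (symplectic_quadrangle \<beta>) x K} =
          {eta (symplectic_quadrangle \<beta>) x l U | l U.
             l \<in> points_at_infinity (plane_at (symplectic_quadrangle \<beta>) x) \<and>
             U \<in> complement_subgroups q (plane_at (symplectic_quadrangle \<beta>) x) l})"
proof -
  let ?W = "symplectic_quadrangle \<beta>"
  let ?E = "{eta ?W x l U | l U. l \<in> points_at_infinity (plane_at ?W x) \<and> U \<in> complement_subgroups q (plane_at ?W x) l}"
  have sf: "symplectic_form \<beta>" by (rule assms(4))
  obtain v3 where v3: "v3 \<noteq> 0" and x: "x = vec.span {v3}"
    using assms(5) unfolding symplectic_quadrangle_simps pg_points_eq point_of_def by blast
  obtain e0 e1 e2 where F: "symp_frame \<beta> e0 e1 e2 v3" using frame_at_point[OF sf v3] by (elim exE)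
  have cq: "q = CARD('a)" and card: "CARD('a) = p ^ h" using assms(2,3) by simp_all
  \<comment> \<open>For h = 0 the order q would be 1.\<close>
  have h: "h > 0" if "5 \<le> q" using that assms(2) by (cases h) simp_all
  have eta: "linear_singer_group \<beta> x K \<and> symmetries ?W x \<subseteq> overline_group ?W x K" if "K \<in> ?E" for K
  proof -
    from that obtain l U where K: "K = eta ?W x l U" and l: "l \<in> points_at_infinity (plane_at ?W x)"
        and U: "U \<in> complement_subgroups q (plane_at ?W x) l" by (elim CollectE exE conjE) (rule that)
    show ?thesis unfolding K by (rule eta_linear_singer_group[OF sf v3 x l U[unfolded cq]])
  qed
  \<comment> \<open>The disjunction serves both parts: odd p supplies the first alternative, and in
    the even case the second is the condition on the group.\<close>
  have "K \<in> ?E" if "5 \<le> q" "linear_singer_group \<beta> x K" "(2::'a) \<noteq> 0 \<or> symmetries ?W x \<subseteq> overline_group ?W x K" for K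
    using linear_singer_group_eta[OF sf v3 x assms(1) card h[OF that(1)] that(2,3)] unfolding cq by (rule CollectI)
  note sub = this
  have two: "(2::'a) \<noteq> 0" if "odd p" "5 \<le> q"
  proof -
    have "CHAR('a) = p" by (rule CHAR_eq_prime[OF assms(1) card])
    then have "of_nat 2 = (0::'a) \<longleftrightarrow> p dvd 2" using of_nat_eq_0_iff_char_dvd[of 2, where 'a = 'a] by simp
    moreover have "\<not> p dvd 2" using assms(1) \<open>odd p\<close> by (metis primes_dvd_imp_eq two_is_prime_nat dvd_refl)
    ultimately show ?thesis by simp
  qed
  have lin: "{K. linear_singer_group \<beta> x K} = ?E" if "odd p" "5 \<le> q"
  proof (intro Set.equalityI subsetI)
    fix K assume "K \<in> {K. linear_singer_group \<beta> x K}"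
    then show "K \<in> ?E" using sub[OF that(2) _ disjI1[OF two[OF that]]] by (simp only: mem_Collect_eq)
  next
    fix K assume "K \<in> ?E"
    then show "K \<in> {K. linear_singer_group \<beta> x K}" unfolding mem_Collect_eq[of _ "linear_singer_group \<beta> x"]
      by (rule eta[THEN conjunct1])
  qed
  have all: "{K. singer_group (payne_derived ?W x) K} = {K. linear_singer_group \<beta> x K}"
    if "odd p" "5 \<le> q" "gcd p h = 1"
  proof (intro Collect_cong iffI)
    fix K assume "singer_group (payne_derived ?W x) K"
    then show "linear_singer_group \<beta> x K"
      unfolding x by (rule symp_frame.singer_group_linear[OF F assms(1) that(1) card that(2)[unfolded cq]
        that(3)[folded coprime_iff_gcd_eq_1]])
  next
    fix K assume "linear_singer_group \<beta> x K"
    then show "singer_group (payne_derived ?W x) K" unfolding linear_singer_group_def by (rule conjunct1)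
  qed
  have sym: "{K. linear_singer_group \<beta> x K \<and> symmetries ?W x \<subseteq> overline_group ?W x K} = ?E" if "8 \<le> q"
  proof (intro Set.equalityI subsetI)
    fix K assume "K \<in> {K. linear_singer_group \<beta> x K \<and> symmetries ?W x \<subseteq> overline_group ?W x K}"
    then have K: "linear_singer_group \<beta> x K" "symmetries ?W x \<subseteq> overline_group ?W x K" by (simp_all only: mem_Collect_eq)
    show "K \<in> ?E" by (rule sub[OF _ K(1) disjI2[OF K(2)]]) (use that in simp)
  next
    fix K assume KE: "K \<in> ?E"
    show "K \<in> {K. linear_singer_group \<beta> x K \<and> symmetries ?W x \<subseteq> overline_group ?W x K}"
      by (rule CollectI) (rule eta[OF KE])
  qed
  show ?thesis
    by (intro conjI impI; elim conjE) (erule (1) lin, (rule HOL.trans[OF all lin]; assumption), erule sym)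
qed

end
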